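(* Let $\eta\in H_{++}$ and suppose that $\lim_{x\to0^+}[x\,U_2(x)]=-\infty$. Then $V_k(\eta)\to V_0(\eta)$ as $k\to\infty$. Moreover, for every $\varepsilon>0$ one can find a constant $M_\varepsilon$ and a $k_\varepsilon\in\mathbb{N}$ such that the strategy $$c_{k_\varepsilon,M_\varepsilon}(t):=\begin{cases}c^*_{k_\varepsilon}(t),& t\in[0,M_\varepsilon],\\ 0,& t>M_\varepsilon,\end{cases}$$ where $c_k^*$ denotes the optimal feedback strategy for the problem $V_k(\eta)$, is an $\varepsilon$-optimal strategy for the problem $V_0(\eta)$, i.e. $c_{k_\varepsilon,M_\varepsilon}\in\mathcal{C}^0_{ad}(\eta)$ and $J_0(\eta;c_{k_\varepsilon,M_\varepsilon})>V_0(\eta)-\varepsilon$.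
   Context: Setting. Fix $T>0$, $\rho>0$. Put $L^2_{-T}=L^2([-T,0];\mathbb{R})$, $W^{1,2}_{-T}=W^{1,2}([-T,0];\mathbb{R})$, $H_+=(0,+\infty)\times L^2_{-T}$, $H_{++}=(0,+\infty)\times\{\eta_1\in L^2_{-T}:\eta_1\ge0\text{ a.e.}\}$, with elements $\eta=(\eta_0,\eta_1(\cdot))$; $\mathbb{R}^+=[0,+\infty)$. Assumptions: $f_0:[0,\infty)\times\mathbb{R}\to\mathbb{R}$ is jointly concave, nondecreasing in the second variable, Lipschitz continuous with constant $C_{f_0}$, $f_0(0,y)>0$ for all $y>0$, and $f_0(x,0)\ge0$ for all $x\ge0$. (A linear term $rx$ in the state equation is incorporated in $f_0$.) $U_1\in C([0,\infty))\cap C^2((0,\infty))$ is bounded, $U_1'>0$, $U_1'(0^+)=+\infty$, $U_1''<0$; $U_2\in C((0,\infty))$ is increasing (not necessarily strictly), concave, bounded from above, and $\int_0^{\infty}e^{-\rho t}U_2(e^{-C_{f_0}t})\,dt>-\infty$. Kernels: $(a_k)_{k\in\mathbb{N}}\subset W^{1,2}_{-T}$ is a sequence with $a_k\ge0$, $a_k(-T)=0$, $\|a_k\|_{L^2_{-T}}\le1$, $\int_{-\delta}^0a_k(\xi)d\xi>0$ for all $\delta>0$, and $a_k\stackrel{*}{\rightharpoonup}\delta_{-T/2}$ in $(C([-T,0];\mathbb{R}))^*$, where $\delta_{-T/2}$ is the Dirac measure at $-T/2$, i.e. $\int_{-T}^0a_k\varphi\,d\xi\to\varphi(-T/2)$ for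 all $\varphi\in C([-T,0];\mathbb{R})$. For $\eta\in H_+$ and a control $c\in L^1_{loc}([0,\infty);\mathbb{R}^+)$, $x_k(\cdot;\eta,c)$ and $y(\cdot;\eta,c)$ are the unique solutions, absolutely continuous on $[0,\infty)$, of (in integral form) $x'(t)=f_0\big(x(t),\int_{-T}^0a_k(\xi)x(t+\xi)d\xi\big)-c(t)$ and $y'(t)=f_0\big(y(t),y(t-\tfrac T2)\big)-c(t)$ respectively, with value $\eta_0$ at $0$ and equal to $\eta_1$ on $[-T,0)$. $\mathcal{C}^k_{ad}(\eta)=\{c\in L^1_{loc}([0,\infty);\mathbb{R}^+):x_k(\cdot;\eta,c)>0\}$ ($k\in\mathbb{N}$), $\mathcal{C}^0_{ad}(\eta)=\{c\in L^1_{loc}([0,\infty);\mathbb{R}^+):y(\cdot;\eta,c)>0\}$. $J_k(\eta;c)=\int_0^\infty e^{-\rho t}[U_1(c(t))+U_2(x_k(t;\eta,c))]dt$, $J_0(\eta;c)=\int_0^\infty e^{-\rho t}[U_1(c(t))+U_2(y(t;\eta,c))]dt$, and $V_k(\eta)=\sup_{\mathcal{C}^k_{ad}(\eta)}J_k(\eta;\cdot)$, $V_0(\eta)=\sup_{\mathcal{C}^0_{ad}(\eta)}J_0(\eta;\cdot)$. Index $0$ always refers to the pointwise-delay problem and $k\in\mathbb{N}$ to the problem with kernel $a_k$. Optimal feedback strategy for $V_k$: $V_k$ is known to be differentiable in the direction $\eta_0$ on $\mathcal{D}(V_k)=\{\eta\in H_+:V_k(\eta)>-\infty\}\supset H_{++}$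 with continuous derivative $V_{k,\eta_0}>0$; with $C_k(\zeta)=\mathrm{argmax}_{c\ge0}(U_1(c)-cV_{k,\eta_0}(\zeta))$, one sets $c_k^*(t)=C_k(x_k^*(t),x_k^*(t+\xi)|_{\xi\in[-T,0]})$ where $x_k^*>0$ solves the state equation with kernel $a_k$, initial datum $\eta$ and $c(t)$ replaced by $C_k(x(t),x(t+\xi)|_{\xi\in[-T,0]})$; then $c_k^*\in\mathcal{C}^k_{ad}(\eta)$ and $J_k(\eta;c_k^* )=V_k(\eta)$.
   Formalization: The assumed bound ‖a_k‖_{L²} ≤ 1 contradicts weak-* convergence of a_k to the Dirac measure at −T/2 (by Cauchy–Schwarz), so it is replaced by: for each k, the L² norm or the L¹ norm of a_k is at most 1. *)

theory Defs
  imports "HOL-Analysis.Analysis"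
begin

section \<open>Function spaces\<close>

text \<open>Elements of \<open>L\<^sup>2\<close> are given by representatives of type \<^typ>\<open>real \<Rightarrow> real\<close>; only their values on
  \<open>[-T, 0]\<close> matter.\<close>

definition L2 :: "real \<Rightarrow> (real \<Rightarrow> real) set" where
  "L2 T = {h. set_borel_measurable lebesgue {-T..0} h \<and>
              set_integrable lebesgue {-T..0} (\<lambda>\<xi>. (h \<xi>)\<^sup>2)}"

definition L2_norm :: "real \<Rightarrow> (real \<Rightarrow> real) \<Rightarrow> real" where
  "L2_norm T h = sqrt (LINT \<xi>:{-T..0}|lebesgue. (h \<xi>)\<^sup>2)"

text \<open>The \<open>L\<^sup>1\<close> norm serves to normalise the kernels. A family bounded in \<open>L\<^sup>2\<close> cannot converge weakly-* to a
  Dirac measure: testing with continuous \<open>\<phi>\<close> that have \<open>\<phi> (-T/2) = 1\<close> and small \<open>L\<^sup>2\<close> norm contradicts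
  the Cauchy-Schwarz bound. Hence a theorem about such kernels that demands \<open>L2_norm T (a k) \<le> 1\<close> for
  all \<open>k\<close> is vacuous; a theorem demanding \<open>L2_norm T (a k) \<le> 1 \<or> L1_norm T (a k) \<le> 1\<close> contains
  it as a special case and is not.\<close>

definition L1_norm :: "real \<Rightarrow> (real \<Rightarrow> real) \<Rightarrow> real" where
  "L1_norm T h = (LINT \<xi>:{-T..0}|lebesgue. \<bar>h \<xi>\<bar>)"

definition weak_derivative :: "real \<Rightarrow> (real \<Rightarrow> real) \<Rightarrow> (real \<Rightarrow> real) \<Rightarrow> bool" where
  "weak_derivative T h g \<longleftrightarrow>
     (\<forall>\<phi>. (\<forall>\<xi>. \<phi> field_differentiable at \<xi>) \<and> continuous_on UNIV (deriv \<phi>) \<and>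
          (\<exists>K. compact K \<and> K \<subseteq> {-T<..<0} \<and> (\<forall>\<xi>. \<xi> \<notin> K \<longrightarrow> \<phi> \<xi> = 0)) \<longrightarrow>
          (LINT \<xi>:{-T..0}|lebesgue. h \<xi> * deriv \<phi> \<xi>)
            = - (LINT \<xi>:{-T..0}|lebesgue. g \<xi> * \<phi> \<xi>))"

text \<open>\<open>W\<^sup>1\<^sup>,\<^sup>2\<close>, each class being given by its continuous representative, so that point values such as
  \<open>h (-T)\<close> make sense.\<close>

definition W12 :: "real \<Rightarrow> (real \<Rightarrow> real) set" where
  "W12 T = {h \<in> L2 T. continuous_on {-T..0} h \<and> (\<exists>g \<in> L2 T. weak_derivative T h g)}"

definition H_plus :: "real \<Rightarrow> (real \<times> (real \<Rightarrow> real)) set" where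
  "H_plus T = {0<..} \<times> L2 T"

definition H_plusplus :: "real \<Rightarrow> (real \<times> (real \<Rightarrow> real)) set" where
  "H_plusplus T = {0<..} \<times> {h \<in> L2 T. AE \<xi> in lebesgue. \<xi> \<in> {-T..0} \<longrightarrow> 0 \<le> h \<xi>}"

text \<open>\<open>L\<^sup>1\<^sub>l\<^sub>o\<^sub>c([0,\<infinity>); \<real>\<^sup>+)\<close>; values at negative times are irrelevant.\<close>

definition L1_loc_nonneg :: "(real \<Rightarrow> real) set" where
  "L1_loc_nonneg = {c. (\<forall>t\<ge>0. 0 \<le> c t) \<and> (\<forall>R\<ge>0. set_integrable lebesgue {0..R} c)}"

text \<open>The integral over \<open>[0, \<infinity>)\<close> with values in the extended reals. It is used only for functions
  whose positive part has a finite integral, so \<open>\<infinity> - \<infinity>\<close> does not occur.\<close>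

definition ext_integral :: "(real \<Rightarrow> real) \<Rightarrow> ereal" where
  "ext_integral g = enn2ereal (\<integral>\<^sup>+ t \<in> {0..}. ennreal (g t) \<partial>lebesgue)
                  - enn2ereal (\<integral>\<^sup>+ t \<in> {0..}. ennreal (- g t) \<partial>lebesgue)"

section \<open>State equations\<close>

text \<open>A memory term maps a trajectory \<open>x\<close> and a time \<open>t\<close> to the second argument of \<open>f0\<close>. Everything
  below is parametrised by it, so that the distributed and the pointwise delay share their
  definitions.\<close>

type_synonym memory = "(real \<Rightarrow> real) \<Rightarrow> real \<Rightarrow> real"

definition kernel_memory :: "real \<Rightarrow> (real \<Rightarrow> real) \<Rightarrow> memory" where
  "kernel_memory T a x t = (LINT \<xi>:{-T..0}|lebesgue. a \<xi> * x (t + \<xi>))"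

definition point_memory :: "real \<Rightarrow> memory" where
  "point_memory T x t = x (t - T / 2)"

text \<open>Integral form of \<open>x' = f0(x, D x) - c\<close> on \<open>[0, \<infinity>)\<close>; integrability of the right-hand side makes
  \<open>x\<close> absolutely continuous there. As \<open>f0\<close> is given only for a nonnegative first argument, it is
  extended by \<open>f0(x, y) = f0(0, y)\<close> for \<open>x < 0\<close>; this has no effect on positive trajectories.
  The value \<open>0\<close> before time \<open>-T\<close> is a normalisation that makes solutions unique as functions on
  the whole line.\<close>

definition solves_state ::
  "real \<Rightarrow> (real \<Rightarrow> real \<Rightarrow> real) \<Rightarrow> memory \<Rightarrow> real \<times> (real \<Rightarrow> real) \<Rightarrow> (real \<Rightarrow> real) \<Rightarrow> (real \<Rightarrow> real) \<Rightarrow> bool"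
where
  "solves_state T f0 D \<eta> c x \<longleftrightarrow>
     (\<forall>t < -T. x t = 0) \<and>
     (\<forall>t \<in> {-T..<0}. x t = snd \<eta> t) \<and>
     (\<forall>t \<ge> 0. set_integrable lebesgue {0..t} (\<lambda>s. f0 (max 0 (x s)) (D x s) - c s) \<and>
              x t = fst \<eta> + (LINT s:{0..t}|lebesgue. f0 (max 0 (x s)) (D x s) - c s))"

definition state ::
  "real \<Rightarrow> (real \<Rightarrow> real \<Rightarrow> real) \<Rightarrow> memory \<Rightarrow> real \<times> (real \<Rightarrow> real) \<Rightarrow> (real \<Rightarrow> real) \<Rightarrow> real \<Rightarrow> real"
where
  "state T f0 D \<eta> c = (THE x. solves_state T f0 D \<eta> c x)"

section \<open>Control problems\<close>

definition admissible ::
  "real \<Rightarrow> (real \<Rightarrow> real \<Rightarrow> real) \<Rightarrow> memory \<Rightarrow> real \<times> (real \<Rightarrow> real) \<Rightarrow> (real \<Rightarrow> real) set"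
where
  "admissible T f0 D \<eta> = {c \<in> L1_loc_nonneg. \<forall>t\<ge>0. 0 < state T f0 D \<eta> c t}"

definition payoff ::
  "real \<Rightarrow> real \<Rightarrow> (real \<Rightarrow> real \<Rightarrow> real) \<Rightarrow> (real \<Rightarrow> real) \<Rightarrow> (real \<Rightarrow> real) \<Rightarrow> memory \<Rightarrow>
   real \<times> (real \<Rightarrow> real) \<Rightarrow> (real \<Rightarrow> real) \<Rightarrow> ereal"
where
  "payoff T \<rho> f0 U1 U2 D \<eta> c =
     ext_integral (\<lambda>t. exp (- \<rho> * t) * (U1 (c t) + U2 (state T f0 D \<eta> c t)))"

definition val ::
  "real \<Rightarrow> real \<Rightarrow> (real \<Rightarrow> real \<Rightarrow> real) \<Rightarrow> (real \<Rightarrow> real) \<Rightarrow> (real \<Rightarrow> real) \<Rightarrow> memory \<Rightarrow>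
   real \<times> (real \<Rightarrow> real) \<Rightarrow> ereal"
where
  "val T \<rho> f0 U1 U2 D \<eta> = (SUP c \<in> admissible T f0 D \<eta>. payoff T \<rho> f0 U1 U2 D \<eta> c)"

section \<open>Optimal feedback strategies\<close>

definition val_domain ::
  "real \<Rightarrow> real \<Rightarrow> (real \<Rightarrow> real \<Rightarrow> real) \<Rightarrow> (real \<Rightarrow> real) \<Rightarrow> (real \<Rightarrow> real) \<Rightarrow> memory \<Rightarrow>
   (real \<times> (real \<Rightarrow> real)) set"
where
  "val_domain T \<rho> f0 U1 U2 D = {\<zeta> \<in> H_plus T. val T \<rho> f0 U1 U2 D \<zeta> > -\<infinity>}"

text \<open>The derivative of the value function in the direction of the present state.\<close>

definition val_deriv0 ::
  "real \<Rightarrow> real \<Rightarrow> (real \<Rightarrow> real \<Rightarrow> real) \<Rightarrow> (real \<Rightarrow> real) \<Rightarrow> (real \<Rightarrow> real) \<Rightarrow> memory \<Rightarrow>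
   real \<times> (real \<Rightarrow> real) \<Rightarrow> real"
where
  "val_deriv0 T \<rho> f0 U1 U2 D \<zeta> =
     deriv (\<lambda>s. real_of_ereal (val T \<rho> f0 U1 U2 D (s, snd \<zeta>))) (fst \<zeta>)"

definition feedback ::
  "real \<Rightarrow> real \<Rightarrow> (real \<Rightarrow> real \<Rightarrow> real) \<Rightarrow> (real \<Rightarrow> real) \<Rightarrow> (real \<Rightarrow> real) \<Rightarrow> memory \<Rightarrow>
   real \<times> (real \<Rightarrow> real) \<Rightarrow> real"
where
  "feedback T \<rho> f0 U1 U2 D \<zeta> =
     arg_max (\<lambda>c. U1 c - c * val_deriv0 T \<rho> f0 U1 U2 D \<zeta>) (\<lambda>c. 0 \<le> c)"

text \<open>\<open>c\<close> is generated along a positive solution of the closed-loop equation by the feedback map, and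
  it is optimal.\<close>

definition optimal_feedback_strategy ::
  "real \<Rightarrow> real \<Rightarrow> (real \<Rightarrow> real \<Rightarrow> real) \<Rightarrow> (real \<Rightarrow> real) \<Rightarrow> (real \<Rightarrow> real) \<Rightarrow> memory \<Rightarrow>
   real \<times> (real \<Rightarrow> real) \<Rightarrow> (real \<Rightarrow> real) \<Rightarrow> bool"
where
  "optimal_feedback_strategy T \<rho> f0 U1 U2 D \<eta> c \<longleftrightarrow>
     (\<exists>x. solves_state T f0 D \<eta> (\<lambda>t. feedback T \<rho> f0 U1 U2 D (x t, \<lambda>\<xi>. x (t + \<xi>))) x \<and>
          (\<forall>t\<ge>0. 0 < x t \<and> (x t, \<lambda>\<xi>. x (t + \<xi>)) \<in> val_domain T \<rho> f0 U1 U2 D \<and>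
                 c t = feedback T \<rho> f0 U1 U2 D (x t, \<lambda>\<xi>. x (t + \<xi>)))) \<and>
     c \<in> admissible T f0 D \<eta> \<and>
     payoff T \<rho> f0 U1 U2 D \<eta> c = val T \<rho> f0 U1 U2 D \<eta>"

definition truncate_strategy :: "real \<Rightarrow> (real \<Rightarrow> real) \<Rightarrow> real \<Rightarrow> real" where
  "truncate_strategy M c t = (if t \<in> {0..M} then c t else 0)"

end

theory Submission
  imports Defs
begin

text \<open>
  A pointwise delay and a distributed delay are instances of one class of memory operators, for which
  the state equation is well posed, obeys a comparison principle and depends concavely on the control.

  If a control \<open>c\<close> is nearly optimal and its state \<open>x\<close> falls to the level \<open>r / 2\<close> at some time in \<open>[0, M]\<close>,
  then \<open>x \<le> r\<close> for a time of order \<open>r\<^sup>2\<close>, because the past is only square integrable and so \<open>x\<close> may grow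
  like a square root. Replacing \<open>c\<close> by \<open>(1 - \<theta>) c\<close> with \<open>\<theta>\<close> of order \<open>r\<close> raises the state by \<open>r\<close> there, by
  concavity. It costs a multiple of \<open>r\<close> and gains a multiple of \<open>r\<^sup>2 (U2 (2 r) - U2 r)\<close>. Since
  \<open>x U2 x \<longrightarrow> -\<infinity>\<close>, some \<open>r\<close> makes this gain win; hence nearly optimal states are bounded below on \<open>[0, M]\<close>
  by a constant that is the same for all the memories.

  The controls that admit a positive state up to time \<open>R\<close> are bounded in \<open>L\<^sup>1\<close>, so their states are bounded in
  variation, and on such functions \<open>a k\<close> acts almost like the shift by \<open>T / 2\<close>, uniformly. The states for \<open>a k\<close>
  and for the pointwise delay are therefore uniformly close, and truncated nearly optimal controls can be
  carried over from either problem to the other: after the truncation the state does not decrease, which controls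
  the tail of the payoff.
\<close>

section \<open>State equations with memory\<close>

lemmas hk_integral_add = Henstock_Kurzweil_Integration.integral_add
lemmas hk_integral_combine = Henstock_Kurzweil_Integration.integral_combine
lemmas hk_integral_diff = Henstock_Kurzweil_Integration.integral_diff
lemmas hk_integral_nonneg = Henstock_Kurzweil_Integration.integral_nonneg
lemmas hk_integral_restrict_Int = Henstock_Kurzweil_Integration.integral_restrict_Int
lemmas integrable_of_absolutely = set_lebesgue_integral_eq_integral(1)

text \<open>The supremum of \<open>u s * exp (- 2 * L * s)\<close> is at most \<open>e\<close> plus half of itself.\<close>

lemma weighted_gronwall:
  fixes u :: "real \<Rightarrow> real"
  assumes bdd: "\<And>t. 0 \<le> t \<Longrightarrow> t \<le> R \<Longrightarrow> u t \<le> B" and "0 \<le> e" and "0 \<le> L"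
    and step: "\<And>t S. \<lbrakk>0 \<le> t; t \<le> R; 0 \<le> S; \<And>s. 0 \<le> s \<Longrightarrow> s \<le> t \<Longrightarrow> u s \<le> S * exp (2 * L * s)\<rbrakk>
      \<Longrightarrow> u t \<le> e + S * exp (2 * L * t) / 2"
    and t: "0 \<le> t" "t \<le> R"
  shows "u t \<le> 2 * e * exp (2 * L * t)"
proof -
  define w where "w s = u s * exp (- 2 * L * s)" for s
  have R: "0 \<le> R" using t by simp
  have wB: "w s \<le> max 0 B" if "0 \<le> s" "s \<le> R" for s
  proof -
    have "w s \<le> max 0 B * exp (- 2 * L * s)"
      unfolding w_def using bdd[OF that] by (intro mult_right_mono) auto
    also have "\<dots> \<le> max 0 B * 1" using \<open>0 \<le> L\<close> that by (intro mult_left_mono) auto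
    finally show ?thesis by simp
  qed
  have bw: "bdd_above (w ` {0..R})" using wB by (auto intro!: bdd_aboveI)
  define S where "S = max 0 (SUP s\<in>{0..R}. w s)"
  have "0 \<le> S" by (simp add: S_def)
  have wS: "w s \<le> S" if "0 \<le> s" "s \<le> R" for s
    using cSUP_upper[OF _ bw, of s] that by (auto simp: S_def)
  have uS: "u s \<le> S * exp (2 * L * s)" if "0 \<le> s" "s \<le> R" for s
  proof -
    have "u s = w s * exp (2 * L * s)" by (simp add: w_def exp_minus field_simps)
    then show ?thesis using wS[OF that] by simp
  qed
  have "w s \<le> e + S / 2" if "0 \<le> s" "s \<le> R" for s
  proof -
    have "u s \<le> e + S * exp (2 * L * s) / 2" using that uS by (intro step \<open>0 \<le> S\<close>) auto
    then have "w s \<le> (e + S * exp (2 * L * s) / 2) * exp (- 2 * L * s)"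
      unfolding w_def by (intro mult_right_mono) auto
    also have "\<dots> = e * exp (- 2 * L * s) + S / 2" by (simp add: exp_minus field_simps)
    also have "\<dots> \<le> e * 1 + S / 2"
      using \<open>0 \<le> L\<close> \<open>0 \<le> e\<close> that by (intro add_right_mono mult_left_mono) auto
    finally show ?thesis by simp
  qed
  then have "(SUP s\<in>{0..R}. w s) \<le> e + S / 2" using R by (intro cSUP_least) auto
  then have "S \<le> 2 * e" using \<open>0 \<le> e\<close> by (auto simp: S_def max_def split: if_splits)
  then show ?thesis using uS[OF t] by (smt (verit) exp_gt_zero mult_right_mono)
qed

lemma integral_weight_le:
  fixes L S a t :: real
  assumes "a \<le> t" "0 \<le> S"
  shows "(\<lambda>s. L * (S * exp (2 * L * s))) integrable_on {a..t}"
    and "integral {a..t} (\<lambda>s. L * (S * exp (2 * L * s))) \<le> S * exp (2 * L * t) / 2"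
proof -
  have I: "((\<lambda>s. L * (S * exp (2 * L * s))) has_integral (S * exp (2 * L * t) / 2 - S * exp (2 * L * a) / 2)) {a..t}"
    by (rule fundamental_theorem_of_calculus[OF assms(1)])
      (auto intro!: derivative_eq_intros simp flip: has_real_derivative_iff_has_vector_derivative)
  then show "(\<lambda>s. L * (S * exp (2 * L * s))) integrable_on {a..t}" by blast
  show "integral {a..t} (\<lambda>s. L * (S * exp (2 * L * s))) \<le> S * exp (2 * L * t) / 2"
    using integral_unique[OF I] assms(2) by simp
qed

locale delay_system =
  fixes T C :: real and f0 :: "real \<Rightarrow> real \<Rightarrow> real" and \<eta> :: "real \<times> (real \<Rightarrow> real)"
  assumes T_pos: "0 < T" and C_nonneg: "0 \<le> C"
    and lip: "\<And>x x' y y'. 0 \<le> x \<Longrightarrow> 0 \<le> x' \<Longrightarrow> \<bar>f0 x y - f0 x' y'\<bar> \<le> C * (\<bar>x - x'\<bar> + \<bar>y - y'\<bar>)"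
    and mono_snd: "\<And>x y y'. 0 \<le> x \<Longrightarrow> y \<le> y' \<Longrightarrow> f0 x y \<le> f0 x y'"
    and f0_nonneg: "\<And>x. 0 \<le> x \<Longrightarrow> 0 \<le> f0 x 0"
    and concave: "\<And>x x' y y' \<theta>. \<lbrakk>0 \<le> x; 0 \<le> x'; 0 \<le> \<theta>; \<theta> \<le> 1\<rbrakk> \<Longrightarrow>
      (1 - \<theta>) * f0 x y + \<theta> * f0 x' y' \<le> f0 ((1 - \<theta>) * x + \<theta> * x') ((1 - \<theta>) * y + \<theta> * y')"
    and init_pos: "0 < fst \<eta>"
begin

definition F :: "real \<Rightarrow> real \<Rightarrow> real" where "F x y = f0 (max 0 x) y"

definition traj :: "(real \<Rightarrow> real) \<Rightarrow> bool" where
  "traj x \<longleftrightarrow> (\<forall>t < -T. x t = 0) \<and> (\<forall>t \<in> {-T..<0}. x t = snd \<eta> t) \<and> continuous_on {0..} x"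

definition past :: "real \<Rightarrow> real" where
  "past t = (if - T \<le> t \<and> t < 0 then snd \<eta> t else 0)"

definition glue :: "(real \<Rightarrow> real) \<Rightarrow> real \<Rightarrow> real" where
  "glue z t = (if t < 0 then past t else z t)"

lemma traj_iff: "traj x \<longleftrightarrow> (\<forall>t<0. x t = past t) \<and> continuous_on {0..} x"
proof -
  have "(\<forall>t < -T. x t = 0) \<and> (\<forall>t \<in> {-T..<0}. x t = snd \<eta> t) \<longleftrightarrow> (\<forall>t<0. x t = past t)"
    using T_pos by (force simp: past_def)
  then show ?thesis unfolding traj_def by blast
qed

lemma traj_cont: "traj x \<Longrightarrow> 0 \<le> a \<Longrightarrow> continuous_on {a..b} x"
  unfolding traj_def by (auto elim: continuous_on_subset)

lemma traj_glue: "continuous_on {0..} z \<Longrightarrow> traj (glue z)"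
  unfolding traj_iff by (auto simp: glue_def cong: continuous_on_cong_simp)

lemma traj_past: "traj past"
  unfolding traj_iff using T_pos
  by (auto simp: past_def cong: continuous_on_cong_simp)

lemma traj_eqI: "traj x \<Longrightarrow> traj y \<Longrightarrow> (\<And>t. 0 \<le> t \<Longrightarrow> x t = y t) \<Longrightarrow> x = y"
  unfolding traj_iff by (metis ext not_le)

lemma F_lip: "\<bar>F x y - F x' y'\<bar> \<le> C * (\<bar>x - x'\<bar> + \<bar>y - y'\<bar>)"
proof -
  have "\<bar>F x y - F x' y'\<bar> \<le> C * (\<bar>max 0 x - max 0 x'\<bar> + \<bar>y - y'\<bar>)"
    unfolding F_def by (intro lip) auto
  also have "\<dots> \<le> C * (\<bar>x - x'\<bar> + \<bar>y - y'\<bar>)"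
    using C_nonneg by (intro mult_left_mono) auto
  finally show ?thesis .
qed

lemma F_mono: "y \<le> y' \<Longrightarrow> F x y \<le> F x y'"
  unfolding F_def by (rule mono_snd) auto

lemma F_upper: "y - y' \<le> B \<Longrightarrow> 0 \<le> B \<Longrightarrow> F x y - F x' y' \<le> C * (\<bar>x - x'\<bar> + B)"
proof -
  assume "y - y' \<le> B" "0 \<le> B"
  have "F x y - F x' y' \<le> F x (max y y') - F x' y'" using F_mono[of y "max y y'" x] by simp
  also have "\<dots> \<le> C * (\<bar>x - x'\<bar> + \<bar>max y y' - y'\<bar>)" using F_lip[of x "max y y'" x' y'] by linarith
  also have "\<dots> \<le> C * (\<bar>x - x'\<bar> + B)"
    using C_nonneg \<open>y - y' \<le> B\<close> \<open>0 \<le> B\<close> by (intro mult_left_mono add_left_mono) auto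
  finally show ?thesis .
qed

lemma F_bound: "\<bar>F x y\<bar> \<le> f0 0 0 + C * (\<bar>x\<bar> + \<bar>y\<bar>)"
  using F_lip[of x y 0 0] f0_nonneg[of 0] by (simp add: F_def)

lemma F_lower: "- B \<le> y \<Longrightarrow> 0 \<le> B \<Longrightarrow> - C * B \<le> F x y"
  using F_upper[of 0 y B x x] f0_nonneg[of "max 0 x"] by (simp add: F_def)

lemma F_continuous: "continuous_on UNIV (\<lambda>p. F (fst p) (snd p))"
proof -
  have "(2 * C)-lipschitz_on UNIV (\<lambda>p. F (fst p) (snd p))"
  proof (rule lipschitz_onI)
    fix p q :: "real \<times> real"
    have "\<bar>fst p - fst q\<bar> \<le> dist p q" "\<bar>snd p - snd q\<bar> \<le> dist p q"
      using dist_fst_le[of p q] dist_snd_le[of p q] by (simp_all add: dist_real_def)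
    then have "C * (\<bar>fst p - fst q\<bar> + \<bar>snd p - snd q\<bar>) \<le> C * (2 * dist p q)"
      using C_nonneg by (intro mult_left_mono) auto
    then show "dist (F (fst p) (snd p)) (F (fst q) (snd q)) \<le> 2 * C * dist p q"
      using F_lip[of "fst p" "snd p" "fst q" "snd q"] by (simp add: dist_real_def)
  qed (use C_nonneg in simp)
  then show ?thesis by (rule lipschitz_on_continuous_on)
qed

end

locale memory_system = delay_system +
  fixes A I :: real and D :: memory
  assumes A_ge: "1 \<le> A" and I_nonneg: "0 \<le> I"
    and D_integrable: "\<And>x a b. traj x \<Longrightarrow> 0 \<le> a \<Longrightarrow> D x absolutely_integrable_on {a..b}"
    and D_upper: "\<And>x y t B. \<lbrakk>traj x; traj y; 0 \<le> t; 0 \<le> B; \<And>s. 0 \<le> s \<Longrightarrow> s \<le> t \<Longrightarrow> x s - y s \<le> B\<rbrakk>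
      \<Longrightarrow> D x t - D y t \<le> A * B"
    and D_convex: "\<And>x y t \<theta>. \<lbrakk>traj x; traj y; 0 \<le> t\<rbrakk>
      \<Longrightarrow> D (\<lambda>s. (1 - \<theta>) * x s + \<theta> * y s) t = (1 - \<theta>) * D x t + \<theta> * D y t"
    and D_past_nonneg: "AE t in lebesgue. 0 \<le> t \<longrightarrow> 0 \<le> D past t"
    and D_past_le: "\<And>s t. 0 \<le> s \<Longrightarrow> s \<le> t \<Longrightarrow> integral {s..t} (\<lambda>r. \<bar>D past r\<bar>) \<le> I * sqrt (t - s)"
begin

definition L where "L = C * (1 + A) + 1"

lemma L_nonneg: "0 \<le> L"
  using C_nonneg A_ge unfolding L_def by simp

lemma CA_le: "0 \<le> S \<Longrightarrow> C * (S + A * S) \<le> L * S"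
  unfolding L_def by (simp add: algebra_simps)

lemma D_abs:
  assumes "traj x" "traj y" "0 \<le> t" "\<And>s. 0 \<le> s \<Longrightarrow> s \<le> t \<Longrightarrow> \<bar>x s - y s\<bar> \<le> B"
  shows "\<bar>D x t - D y t\<bar> \<le> A * B"
proof -
  have B: "0 \<le> B" using assms(3) assms(4)[of 0] by auto
  have "D x t - D y t \<le> A * B" "D y t - D x t \<le> A * B"
    by (rule D_upper[OF assms(1,2,3) B] D_upper[OF assms(2,1,3) B], insert assms(4), force)+
  then show ?thesis by linarith
qed

lemma F_integrable: 
  assumes "traj x" "0 \<le> a"
  shows "(\<lambda>s. F (x s) (D x s)) absolutely_integrable_on {a..b}"
proof (rule measurable_bounded_by_integrable_imp_absolutely_integrable)
  have mx: "x \<in> borel_measurable (lebesgue_on {a..b})"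
    by (intro continuous_imp_measurable_on_sets_lebesgue traj_cont assms) auto
  have mD: "D x \<in> borel_measurable (lebesgue_on {a..b})"
    by (intro absolutely_integrable_imp_borel_measurable D_integrable assms) auto
  show "(\<lambda>s. F (x s) (D x s)) \<in> borel_measurable (lebesgue_on {a..b})"
    by (rule borel_measurable_continuous_Pair[OF mx mD F_continuous])
  have "x absolutely_integrable_on {a..b}"
    by (intro absolutely_integrable_continuous_real traj_cont assms)
  then have "(\<lambda>s. f0 0 0 + C * (\<bar>x s\<bar> + \<bar>D x s\<bar>)) absolutely_integrable_on {a..b}"
    using D_integrable[OF assms]
    by (intro set_integral_add set_integrable_mult_right set_integrable_abs) (auto simp: absolutely_integrable_on_const)
  then show "(\<lambda>s. f0 0 0 + C * (\<bar>x s\<bar> + \<bar>D x s\<bar>)) integrable_on {a..b}"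
    by (rule integrable_of_absolutely)
  show "norm (F (x s) (D x s)) \<le> f0 0 0 + C * (\<bar>x s\<bar> + \<bar>D x s\<bar>)" for s
    using F_bound by simp
qed auto

text \<open>A subsolution stays below a solution: after the last zero of \<open>x2 - x1\<close> before \<open>t\<close> the difference is
  nonnegative, so that the one-sided bound on the memory suffices.\<close>

lemma comparison:
  assumes x1: "traj x1" and x2: "traj x2" and init: "x2 0 \<le> x1 0"
    and ineq: "\<And>s t. \<lbrakk>0 \<le> s; s \<le> t; t \<le> R\<rbrakk> \<Longrightarrow> (x2 t - x1 t) - (x2 s - x1 s)
      \<le> integral {s..t} (\<lambda>r. F (x2 r) (D x2 r) - F (x1 r) (D x1 r))"
    and t: "0 \<le> t" "t \<le> R"
  shows "x2 t \<le> x1 t"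
proof -
  define u where "u s = x2 s - x1 s" for s
  have cu: "continuous_on {a..b} u" if "0 \<le> a" for a b
    unfolding u_def using that by (intro continuous_intros traj_cont x1 x2)
  have "bdd_above (u ` {0..R})"
    by (intro bounded_imp_bdd_above compact_imp_bounded compact_continuous_image cu) auto
  then obtain B where B: "\<And>s. 0 \<le> s \<Longrightarrow> s \<le> R \<Longrightarrow> u s \<le> B" unfolding bdd_above_def by fastforce
  have "u t \<le> 2 * 0 * exp (2 * L * t)"
  proof (rule weighted_gronwall[where u=u and R=R and B=B])
    fix t S assume t: "0 \<le> t" "t \<le> R" and S: "0 \<le> S"
      and le: "\<And>s. 0 \<le> s \<Longrightarrow> s \<le> t \<Longrightarrow> u s \<le> S * exp (2 * L * s)"
    show "u t \<le> 0 + S * exp (2 * L * t) / 2"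
    proof (cases "u t \<le> 0")
      case True
      moreover have "0 \<le> S * exp (2 * L * t)" using S by simp
      ultimately show ?thesis by linarith
    next
      case False
      define Z where "Z = {0..t} \<inter> u -` {0}"
      have "\<exists>s\<ge>0. s \<le> t \<and> u s = 0"
        using False init t by (intro IVT' cu) (auto simp: u_def)
      then have ne: "Z \<noteq> {}" by (auto simp: Z_def)
      have bZ: "bdd_above Z" by (auto simp: Z_def)
      have "closed Z" unfolding Z_def by (intro continuous_closed_preimage cu) auto
      then have "Sup Z \<in> Z" using ne bZ by (intro closed_contains_Sup)
      then obtain t0 where t0: "t0 = Sup Z" "0 \<le> t0" "t0 \<le> t" "u t0 = 0" by (auto simp: Z_def)
      have pos: "0 \<le> u r" if "t0 \<le> r" "r \<le> t" for r
      proof (rule ccontr)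
        assume "\<not> 0 \<le> u r"
        then have "\<exists>s\<ge>r. s \<le> t \<and> u s = 0" 
          using False that t0 by (intro IVT' cu) auto
        then obtain s where s: "r \<le> s" "s \<le> t" "u s = 0" by blast
        then have "s \<in> Z" using that t0 by (auto simp: Z_def)
        then have "s \<le> t0" using bZ t0 by (auto intro: cSup_upper)
        then have "s = r" using s that by linarith
        then show False using s \<open>\<not> 0 \<le> u r\<close> by simp
      qed
      have "u t - u t0 \<le> integral {t0..t} (\<lambda>r. F (x2 r) (D x2 r) - F (x1 r) (D x1 r))"
        unfolding u_def using t0 t by (intro ineq) auto
      also have "\<dots> \<le> integral {t0..t} (\<lambda>s. L * (S * exp (2 * L * s)))"
      proof (rule integral_le)
        show "(\<lambda>r. F (x2 r) (D x2 r) - F (x1 r) (D x1 r)) integrable_on {t0..t}"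
          using t0 x1 x2 by (intro integrable_of_absolutely set_integral_diff F_integrable)
        show "(\<lambda>s. L * (S * exp (2 * L * s))) integrable_on {t0..t}"
          using t0 S by (intro integral_weight_le)
        fix r assume r: "r \<in> {t0..t}"
        have Sr: "0 \<le> S * exp (2 * L * r)" using S by simp
        have "D x2 r - D x1 r \<le> A * (S * exp (2 * L * r))"
        proof (rule D_upper[OF x2 x1 _ Sr])
          fix s assume s: "0 \<le> s" "s \<le> r"
          have "S * exp (2 * L * s) \<le> S * exp (2 * L * r)"
            using S s L_nonneg by (intro mult_left_mono) (auto intro: mult_left_mono)
          then show "x2 s - x1 s \<le> S * exp (2 * L * r)" using le[of s] s r by (simp add: u_def)
        qed (use r t0 in auto)
        then have "F (x2 r) (D x2 r) - F (x1 r) (D x1 r) \<le> C * (\<bar>x2 r - x1 r\<bar> + A * (S * exp (2 * L * r)))"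
          using A_ge Sr by (intro F_upper) auto
        also have "\<dots> \<le> C * (S * exp (2 * L * r) + A * (S * exp (2 * L * r)))"
          using pos[of r] le[of r] r t0 C_nonneg
          by (intro mult_left_mono add_right_mono) (auto simp: u_def)
        also have "\<dots> \<le> L * (S * exp (2 * L * r))" by (rule CA_le[OF Sr])
        finally show "F (x2 r) (D x2 r) - F (x1 r) (D x1 r) \<le> L * (S * exp (2 * L * r))" .
      qed
      also have "\<dots> \<le> S * exp (2 * L * t) / 2" using t0 S by (intro integral_weight_le)
      finally show ?thesis using t0 by simp
    qed
  qed (use B L_nonneg t in auto)
  then show ?thesis by (simp add: u_def)
qed

end

lemma continuous_on_halfline:
  fixes f :: "real \<Rightarrow> real"
  assumes "\<And>R. continuous_on {0..R} f"
  shows "continuous_on {0..} f"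
  unfolding continuous_on_eq_continuous_within
proof
  fix x :: real assume x: "x \<in> {0..}"
  have "continuous (at x within {0..x+1}) f"
    using assms[of "x+1"] x by (auto simp: continuous_on_eq_continuous_within)
  moreover have "at x within {0..x+1} = at x within {0..}"
    by (rule at_within_nhd[where S="{..<x+1}"]) auto
  ultimately show "continuous (at x within {0..}) f" by simp
qed

context memory_system begin

definition solution :: "(real \<Rightarrow> real) \<Rightarrow> (real \<Rightarrow> real) \<Rightarrow> bool" where
  "solution c x \<longleftrightarrow> traj x \<and> (\<forall>t\<ge>0. x t = fst \<eta> + integral {0..t} (\<lambda>s. F (x s) (D x s) - c s))"

lemma L1_loc_integrable:
  assumes "c \<in> L1_loc_nonneg" "0 \<le> a"
  shows "c absolutely_integrable_on {a..b}"
proof (cases "0 \<le> b")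
  case True
  then have "c absolutely_integrable_on {0..b}" using assms by (auto simp: L1_loc_nonneg_def)
  then show ?thesis by (rule absolutely_integrable_on_subinterval) (use assms in auto)
qed (use assms in auto)

lemma rhs_integrable:
  assumes "c \<in> L1_loc_nonneg" "traj x" "0 \<le> a"
  shows "(\<lambda>s. F (x s) (D x s) - c s) absolutely_integrable_on {a..b}"
  using assms by (intro set_integral_diff F_integrable L1_loc_integrable)

lemma continuous_indefinite:
  assumes "\<And>R. f integrable_on {0..R::real}"
  shows "continuous_on {0..} (\<lambda>t. e + integral {0..t} (f :: real \<Rightarrow> real))"
  by (intro continuous_on_halfline continuous_intros indefinite_integral_continuous_1 assms)

lemma solves_state_iff:
  assumes c: "c \<in> L1_loc_nonneg"
  shows "solves_state T f0 D \<eta> c x \<longleftrightarrow> solution c x"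
proof
  assume s: "solves_state T f0 D \<eta> c x"
  have i: "(\<lambda>s. F (x s) (D x s) - c s) absolutely_integrable_on {0..t}" if "0 \<le> t" for t
    using s that unfolding solves_state_def F_def by blast
  have e: "x t = fst \<eta> + integral {0..t} (\<lambda>s. F (x s) (D x s) - c s)" if "0 \<le> t" for t
    using s that set_lebesgue_integral_eq_integral(2)[OF i[OF that]]
    unfolding solves_state_def F_def by simp
  have "continuous_on {0..} (\<lambda>t. fst \<eta> + integral {0..t} (\<lambda>s. F (x s) (D x s) - c s))"
  proof (rule continuous_indefinite)
    fix R :: real 
    show "(\<lambda>s. F (x s) (D x s) - c s) integrable_on {0..R}"
      by (cases "0 \<le> R") (auto intro: integrable_of_absolutely[OF i])
  qed
  then have "continuous_on {0..} x" by (rule continuous_on_eq) (simp add: e)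
  then show "solution c x" using s e unfolding solution_def traj_def solves_state_def by blast
next
  assume s: "solution c x"
  then have t: "traj x" and e: "\<And>t. 0 \<le> t \<Longrightarrow> x t = fst \<eta> + integral {0..t} (\<lambda>s. F (x s) (D x s) - c s)"
    by (auto simp: solution_def)
  have i: "(\<lambda>s. F (x s) (D x s) - c s) absolutely_integrable_on {0..t}" for t
    using c t by (intro rhs_integrable) auto
  have "x t = fst \<eta> + (LINT s:{0..t}|lebesgue. F (x s) (D x s) - c s)" if "0 \<le> t" for t
    using e[OF that] set_lebesgue_integral_eq_integral(2)[OF i] by simp
  then show "solves_state T f0 D \<eta> c x"
    using t i unfolding solves_state_def traj_def F_def by blast
qed

lemma solution_init: "solution c x \<Longrightarrow> x 0 = fst \<eta>"
  by (simp add: solution_def)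

lemma solution_increment:
  assumes c: "c \<in> L1_loc_nonneg" and s: "solution c x" and "0 \<le> s" "s \<le> t"
  shows "x t - x s = integral {s..t} (\<lambda>s. F (x s) (D x s) - c s)"
proof -
  have t: "traj x" using s by (simp add: solution_def)
  have "integral {0..s} (\<lambda>s. F (x s) (D x s) - c s) + integral {s..t} (\<lambda>s. F (x s) (D x s) - c s)
     = integral {0..t} (\<lambda>s. F (x s) (D x s) - c s)"
    using assms t by (intro hk_integral_combine integrable_of_absolutely rhs_integrable) auto
  moreover have "x s = fst \<eta> + integral {0..s} (\<lambda>s. F (x s) (D x s) - c s)"
    "x t = fst \<eta> + integral {0..t} (\<lambda>s. F (x s) (D x s) - c s)"
    using s assms(3,4) unfolding solution_def by (blast intro: order_trans)+
  ultimately show ?thesis by linarith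
qed

lemma solution_increment':
  assumes c: "c \<in> L1_loc_nonneg" and s: "solution c x" and st: "0 \<le> s" "s \<le> t"
  shows "x t - x s = integral {s..t} (\<lambda>s. F (x s) (D x s)) - integral {s..t} c"
  unfolding solution_increment[OF assms] using s c st
  by (intro hk_integral_diff integrable_of_absolutely F_integrable L1_loc_integrable)
    (auto simp: solution_def)

lemma solution_antimono:
  assumes c1: "c1 \<in> L1_loc_nonneg" and c2: "c2 \<in> L1_loc_nonneg"
    and s1: "solution c1 x1" and s2: "solution c2 x2"
    and le: "\<And>t. 0 \<le> t \<Longrightarrow> t \<le> R \<Longrightarrow> c1 t \<le> c2 t" and t: "0 \<le> t" "t \<le> R"
  shows "x2 t \<le> x1 t"
proof (rule comparison[OF _ _ _ _ t])
  show t1: "traj x1" and t2: "traj x2" using s1 s2 by (auto simp: solution_def)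
  show "x2 0 \<le> x1 0" using solution_init[OF s1] solution_init[OF s2] by simp
  fix s t assume st: "0 \<le> s" "s \<le> t" "t \<le> R"
  have i: "integral {s..t} c1 \<le> integral {s..t} c2"
    using st le by (intro integral_le integrable_of_absolutely L1_loc_integrable c1 c2) auto
  have "(x2 t - x2 s) - (x1 t - x1 s) \<le> integral {s..t} (\<lambda>s. F (x2 s) (D x2 s)) - integral {s..t} (\<lambda>s. F (x1 s) (D x1 s))"
    unfolding solution_increment'[OF c2 s2 st(1,2)] solution_increment'[OF c1 s1 st(1,2)] using i by simp
  also have "\<dots> = integral {s..t} (\<lambda>r. F (x2 r) (D x2 r) - F (x1 r) (D x1 r))"
    using t1 t2 st by (intro hk_integral_diff[symmetric] integrable_of_absolutely F_integrable)
  finally show "(x2 t - x1 t) - (x2 s - x1 s) \<le> integral {s..t} (\<lambda>r. F (x2 r) (D x2 r) - F (x1 r) (D x1 r))" by simp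
qed

lemma solution_unique:
  assumes c: "c \<in> L1_loc_nonneg" and s: "solution c x" "solution c y"
  shows "x = y"
proof (rule traj_eqI)
  show "traj x" "traj y" using s by (auto simp: solution_def)
  fix t :: real assume "0 \<le> t"
  then show "x t = y t"
    using solution_antimono[OF c c s(1) s(2) order_refl, of t t] solution_antimono[OF c c s(2) s(1) order_refl, of t t] by simp
qed

definition picard :: "(real \<Rightarrow> real) \<Rightarrow> (real \<Rightarrow> real) \<Rightarrow> real \<Rightarrow> real" where
  "picard c x = glue (\<lambda>t. fst \<eta> + integral {0..t} (\<lambda>s. F (x s) (D x s) - c s))"

lemma traj_picard: "c \<in> L1_loc_nonneg \<Longrightarrow> traj x \<Longrightarrow> traj (picard c x)"
  unfolding picard_def
  by (intro traj_glue continuous_indefinite integrable_of_absolutely rhs_integrable) auto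

lemma solution_picard: "traj x \<Longrightarrow> (\<And>t. 0 \<le> t \<Longrightarrow> picard c x t = x t) \<Longrightarrow> solution c x"
  unfolding solution_def picard_def glue_def by (metis not_less)

lemma F_diff_integral_le:
  assumes x: "traj x" and y: "traj y" and t: "0 \<le> t" and S: "0 \<le> S"
    and le: "\<And>s. 0 \<le> s \<Longrightarrow> s \<le> t \<Longrightarrow> \<bar>x s - y s\<bar> \<le> S * exp (2 * L * s)"
  shows "integral {0..t} (\<lambda>s. \<bar>F (x s) (D x s) - F (y s) (D y s)\<bar>) \<le> S * exp (2 * L * t) / 2"
proof -
  have "integral {0..t} (\<lambda>s. \<bar>F (x s) (D x s) - F (y s) (D y s)\<bar>) \<le> integral {0..t} (\<lambda>s. L * (S * exp (2 * L * s)))"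
  proof (rule integral_le)
    show "(\<lambda>s. \<bar>F (x s) (D x s) - F (y s) (D y s)\<bar>) integrable_on {0..t}"
      using x y by (intro integrable_of_absolutely set_integrable_abs set_integral_diff F_integrable) auto
    show "(\<lambda>s. L * (S * exp (2 * L * s))) integrable_on {0..t}"
      using t S by (intro integral_weight_le)
    fix r assume r: "r \<in> {0..t}"
    have Sr: "0 \<le> S * exp (2 * L * r)" using S by simp
    have "\<bar>D x r - D y r\<bar> \<le> A * (S * exp (2 * L * r))"
    proof (rule D_abs[OF x y])
      fix s assume s: "0 \<le> s" "s \<le> r"
      have "S * exp (2 * L * s) \<le> S * exp (2 * L * r)"
        using S s L_nonneg by (intro mult_left_mono) (auto intro: mult_left_mono)
      then show "\<bar>x s - y s\<bar> \<le> S * exp (2 * L * r)" using le[of s] s r by simp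
    qed (use r in auto)
    then have "C * (\<bar>x r - y r\<bar> + \<bar>D x r - D y r\<bar>) \<le> C * (S * exp (2 * L * r) + A * (S * exp (2 * L * r)))"
      using le[of r] r C_nonneg by (intro mult_left_mono add_mono) auto
    also have "\<dots> \<le> L * (S * exp (2 * L * r))" by (rule CA_le[OF Sr])
    finally show "\<bar>F (x r) (D x r) - F (y r) (D y r)\<bar> \<le> L * (S * exp (2 * L * r))"
      using F_lip order_trans by blast
  qed
  also have "\<dots> \<le> S * exp (2 * L * t) / 2" using t S by (intro integral_weight_le)
  finally show ?thesis .
qed

lemma picard_contract:
  assumes c: "c \<in> L1_loc_nonneg" and x: "traj x" and y: "traj y" and t: "0 \<le> t" and S: "0 \<le> S"
    and le: "\<And>s. 0 \<le> s \<Longrightarrow> s \<le> t \<Longrightarrow> \<bar>x s - y s\<bar> \<le> S * exp (2 * L * s)"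
  shows "\<bar>picard c x t - picard c y t\<bar> \<le> S * exp (2 * L * t) / 2"
proof -
  have "picard c x t - picard c y t = integral {0..t} (\<lambda>s. F (x s) (D x s) - c s) - integral {0..t} (\<lambda>s. F (y s) (D y s) - c s)"
    using t by (simp add: picard_def glue_def)
  also have "\<dots> = integral {0..t} (\<lambda>s. (F (x s) (D x s) - c s) - (F (y s) (D y s) - c s))"
    by (intro hk_integral_diff[symmetric] integrable_of_absolutely rhs_integrable c x y order_refl)
  also have "\<dots> = integral {0..t} (\<lambda>s. F (x s) (D x s) - F (y s) (D y s))" by simp
  finally have "\<bar>picard c x t - picard c y t\<bar> = \<bar>integral {0..t} (\<lambda>s. F (x s) (D x s) - F (y s) (D y s))\<bar>"
    by simp
  also have "\<dots> \<le> integral {0..t} (\<lambda>s. \<bar>F (x s) (D x s) - F (y s) (D y s)\<bar>)"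
    unfolding real_norm_def[symmetric]
    using x y by (intro integral_norm_bound_integral order_refl integrable_of_absolutely set_integral_diff set_integrable_norm F_integrable) auto
  also have "\<dots> \<le> S * exp (2 * L * t) / 2" by (rule F_diff_integral_le[OF x y t S le])
  finally show ?thesis .
qed

lemma solution_exists:
  assumes c: "c \<in> L1_loc_nonneg"
  shows "\<exists>x. solution c x"
proof -
  define X where "X n = (picard c ^^ n) (glue (\<lambda>_. fst \<eta>))" for n
  have X_Suc: "X (Suc n) = picard c (X n)" for n by (simp add: X_def)
  have tX: "traj (X n)" for n
    by (induction n) (auto simp: X_def c intro!: traj_glue traj_picard)
  define d where "d n t = X (Suc n) t - X n t" for n t
  define x where "x t = X 0 t + (\<Sum>n. d n t)" for t
  have sum_d: "X 0 t + (\<Sum>i<n. d i t) = X n t" for n t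
    by (induction n) (auto simp: d_def)
  have unif: "uniform_limit {0..R} X x sequentially" for R
  proof -
    have "bounded ((\<lambda>t. X (Suc 0) t - X 0 t) ` {0..R})"
      by (intro compact_imp_bounded compact_continuous_image continuous_intros traj_cont tX) auto
    then obtain K where K: "\<And>t. 0 \<le> t \<Longrightarrow> t \<le> R \<Longrightarrow> \<bar>X (Suc 0) t - X 0 t\<bar> \<le> K"
      unfolding bounded_iff by fastforce
    define K' where "K' = max 0 K"
    have "0 \<le> K'" and K': "\<And>t. 0 \<le> t \<Longrightarrow> t \<le> R \<Longrightarrow> \<bar>X (Suc 0) t - X 0 t\<bar> \<le> K' * exp (2 * L * t)"
    proof -
      fix t assume t: "0 \<le> t" "t \<le> R"
      have "\<bar>X (Suc 0) t - X 0 t\<bar> \<le> K' * 1" using K[OF t] by (simp add: K'_def)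
      also have "\<dots> \<le> K' * exp (2 * L * t)"
        using t L_nonneg by (intro mult_left_mono) (auto simp: K'_def)
      finally show "\<bar>X (Suc 0) t - X 0 t\<bar> \<le> K' * exp (2 * L * t)" .
    qed (simp add: K'_def)
    have dn: "\<bar>d n t\<bar> \<le> (K' / 2 ^ n) * exp (2 * L * t)" if "0 \<le> t" "t \<le> R" for n t
      using that
    proof (induction n arbitrary: t)
      case 0 then show ?case using K' by (simp add: d_def)
    next
      case (Suc n)
      have "\<bar>picard c (X (Suc n)) t - picard c (X n) t\<bar> \<le> (K' / 2 ^ n) * exp (2 * L * t) / 2"
        using Suc \<open>0 \<le> K'\<close> by (intro picard_contract c tX) (auto simp: d_def)
      then show ?case by (simp add: d_def X_Suc)
    qed
    have "uniform_limit {0..R} (\<lambda>n t. \<Sum>i<n. d i t) (\<lambda>t. \<Sum>n. d n t) sequentially"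
    proof (rule Weierstrass_m_test)
      fix n t assume t: "t \<in> {0..R}"
      have "\<bar>d n t\<bar> \<le> (K' / 2 ^ n) * exp (2 * L * t)" using dn t by auto
      also have "\<dots> \<le> (K' / 2 ^ n) * exp (2 * L * R)"
        using \<open>0 \<le> K'\<close> t L_nonneg by (intro mult_left_mono) (auto intro: mult_left_mono)
      finally show "norm (d n t) \<le> K' * exp (2 * L * R) * (1 / 2) ^ n"
        by (simp add: power_divide)
    qed (intro summable_mult summable_geometric, simp)
    then have "uniform_limit {0..R} (\<lambda>n t. X 0 t + (\<Sum>i<n. d i t)) x sequentially"
      unfolding x_def by (intro uniform_limit_intros)
    then show ?thesis by (simp add: sum_d)
  qed
  have "continuous_on {0..} x"
    by (rule continuous_on_halfline) (rule uniform_limit_theorem[OF _ unif], auto intro!: always_eventually traj_cont tX)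
  moreover have "x t = past t" if "t < 0" for t
  proof -
    have "X n t = past t" for n using tX[of n] that by (simp add: traj_iff)
    then show ?thesis by (simp add: x_def d_def)
  qed
  ultimately have tx: "traj x" by (simp add: traj_iff)
  have "picard c x t = x t" if t: "0 \<le> t" for t
  proof -
    have "(\<lambda>n. X (Suc n) t) \<longlonglongrightarrow> x t"
      using tendsto_uniform_limitI[OF unif[of t], of t] t by (intro LIMSEQ_Suc) auto
    moreover have "(\<lambda>n. X (Suc n) t) \<longlonglongrightarrow> picard c x t"
    proof (rule metric_LIMSEQ_I)
      fix e :: real assume "0 < e"
      define S where "S = e / exp (2 * L * t)"
      have "0 < S" using \<open>0 < e\<close> by (simp add: S_def)
      then have "\<forall>\<^sub>F n in sequentially. \<forall>s\<in>{0..t}. dist (X n s) (x s) < S"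
        using unif[of t] by (simp add: uniform_limit_iff)
      then obtain N where "\<forall>n\<ge>N. \<forall>s\<in>{0..t}. dist (X n s) (x s) < S"
        unfolding eventually_sequentially by blast
      then have N: "\<bar>X n s - x s\<bar> < S" if "n \<ge> N" "0 \<le> s" "s \<le> t" for n s
        using that unfolding dist_real_def by simp
      have "dist (X (Suc n) t) (picard c x t) < e" if "n \<ge> N" for n
      proof -
        have "\<bar>picard c (X n) t - picard c x t\<bar> \<le> S * exp (2 * L * t) / 2"
        proof (rule picard_contract[OF c tX tx t])
          fix s assume s: "0 \<le> s" "s \<le> t"
          have "\<bar>X n s - x s\<bar> \<le> S * 1" using N[OF that s] by simp
          also have "\<dots> \<le> S * exp (2 * L * s)"
            using s L_nonneg \<open>0 < S\<close> by (intro mult_left_mono) auto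
          finally show "\<bar>X n s - x s\<bar> \<le> S * exp (2 * L * s)" .
        qed (use \<open>0 < S\<close> in simp)
        then show ?thesis using \<open>0 < e\<close> by (simp add: S_def X_Suc dist_real_def)
      qed
      then show "\<exists>N. \<forall>n\<ge>N. dist (X (Suc n) t) (picard c x t) < e" by blast
    qed
    ultimately show ?thesis by (rule LIMSEQ_unique[symmetric])
  qed
  then show ?thesis using solution_picard tx by blast
qed

abbreviation st :: "(real \<Rightarrow> real) \<Rightarrow> real \<Rightarrow> real" where "st \<equiv> state T f0 D \<eta>"

lemma solution_st: 
  assumes c: "c \<in> L1_loc_nonneg"
  shows "solution c (st c)"
proof -
  obtain x where x: "solution c x" using solution_exists[OF c] by blast
  have "st c = x" unfolding state_def
    by (rule the_equality) (auto simp: solves_state_iff[OF c] x intro: solution_unique[OF c])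
  then show ?thesis using x by simp
qed

end

lemma integral_le_AE:
  fixes f g :: "real \<Rightarrow> real"
  assumes "f absolutely_integrable_on S" "g absolutely_integrable_on S"
    and "AE r in lebesgue. r \<in> S \<longrightarrow> f r \<le> g r"
  shows "integral S f \<le> integral S g"
  using set_integral_mono_AE[OF assms(1,2)] assms(3)
  unfolding set_lebesgue_integral_eq_integral(2)[OF assms(1)] set_lebesgue_integral_eq_integral(2)[OF assms(2)]
  by auto

lemma integral_nonneg_AE_on:
  fixes f :: "real \<Rightarrow> real"
  assumes "f absolutely_integrable_on S" and "AE r in lebesgue. r \<in> S \<longrightarrow> 0 \<le> f r"
  shows "0 \<le> integral S f"
  using integral_le_AE[OF absolutely_integrable_zero assms] by simp

context memory_system begin

lemma st_traj: "c \<in> L1_loc_nonneg \<Longrightarrow> traj (st c)"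
  using solution_st[of c] by (simp add: solution_def)

lemma st_init: "c \<in> L1_loc_nonneg \<Longrightarrow> st c 0 = fst \<eta>"
  using solution_init[OF solution_st] .

lemmas st_increment = solution_increment'[OF _ solution_st]

lemma st_antimono:
  assumes "c1 \<in> L1_loc_nonneg" "c2 \<in> L1_loc_nonneg" "\<And>s. 0 \<le> s \<Longrightarrow> s \<le> t \<Longrightarrow> c1 s \<le> c2 s" "0 \<le> t"
  shows "st c2 t \<le> st c1 t"
  by (rule solution_antimono[OF assms(1,2) solution_st solution_st, of t]) (use assms in auto)

lemma D_lower_AE:
  assumes x: "traj x"
  shows "AE r in lebesgue. \<forall>B. 0 \<le> r \<longrightarrow> 0 \<le> B \<longrightarrow> (\<forall>s. 0 \<le> s \<longrightarrow> s \<le> r \<longrightarrow> - B \<le> x s) \<longrightarrow> - (A * B) \<le> D x r"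
  using D_past_nonneg
proof eventually_elim
  case (elim r)
  show ?case
  proof (intro allI impI)
    fix B assume B: "0 \<le> r" "0 \<le> B" "\<forall>s. 0 \<le> s \<longrightarrow> s \<le> r \<longrightarrow> - B \<le> x s"
    have "D past r - D x r \<le> A * B"
    proof (rule D_upper[OF traj_past x B(1,2)])
      fix s assume "0 \<le> s" "s \<le> r"
      then show "past s - x s \<le> B" using B(3)[rule_format, of s] by (simp add: past_def)
    qed
    then show "- (A * B) \<le> D x r" using elim B(1) by linarith
  qed
qed

lemma zero_control_integral:
  fixes M s t :: real
  assumes "0 \<le> M" "M \<le> s" "\<And>t. M < t \<Longrightarrow> c t = 0"
  shows "integral {s..t} c = (0::real)"
proof -
  have "integral {s..t} c = integral {s..t} (\<lambda>_. 0)"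
  proof (rule integral_spike[of "{M}"])
    fix x assume "x \<in> {s..t} - {M}"
    then have "M < x" using assms(2) by auto
    then show "0 = c x" using assms(3) by simp
  qed simp
  then show ?thesis by simp
qed

lemma zero_control_nonneg:
  assumes c: "c \<in> L1_loc_nonneg" and "0 \<le> M" and c0: "\<And>t. M < t \<Longrightarrow> c t = 0"
    and pos: "\<And>t. 0 \<le> t \<Longrightarrow> t \<le> M \<Longrightarrow> 0 \<le> st c t" and t: "0 \<le> t"
  shows "0 \<le> st c t"
proof -
  have "bounded ((\<lambda>s. - st c s) ` {0..t})"
    by (intro compact_imp_bounded compact_continuous_image continuous_intros traj_cont st_traj c) auto
  then obtain B where B: "\<And>s. 0 \<le> s \<Longrightarrow> s \<le> t \<Longrightarrow> - st c s \<le> B"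
    unfolding bounded_iff by (metis abs_le_D1 atLeastAtMost_iff image_eqI real_norm_def)
  have "- st c t \<le> 2 * 0 * exp (2 * L * t)"
  proof (rule weighted_gronwall[where u = "\<lambda>s. - st c s" and R = t and B = B])
    fix r S assume r: "0 \<le> r" "r \<le> t" and S: "0 \<le> S" and le: "\<And>s. 0 \<le> s \<Longrightarrow> s \<le> r \<Longrightarrow> - st c s \<le> S * exp (2 * L * s)"
    have nn: "0 \<le> S * exp (2 * L * s)" for s using S by simp
    show "- st c r \<le> 0 + S * exp (2 * L * r) / 2"
    proof (cases "r \<le> M")
      case True then show ?thesis using pos[of r] r nn[of r] by linarith
    next
      case False
      then have M: "M \<le> r" by simp
      have "integral {M..r} (\<lambda>s. - F (st c s) (D (st c) s)) \<le> integral {M..r} (\<lambda>s. L * (S * exp (2 * L * s)))"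
      proof (rule integral_le_AE)
        show "(\<lambda>s. - F (st c s) (D (st c) s)) absolutely_integrable_on {M..r}"
          using F_integrable[OF st_traj[OF c] \<open>0 \<le> M\<close>] by (simp add: set_integrable_def)
        show "(\<lambda>s. L * (S * exp (2 * L * s))) absolutely_integrable_on {M..r}"
          by (intro absolutely_integrable_continuous_real continuous_intros)
        show "AE s in lebesgue. s \<in> {M..r} \<longrightarrow> - F (st c s) (D (st c) s) \<le> L * (S * exp (2 * L * s))"
          using D_lower_AE[OF st_traj[OF c]]
        proof eventually_elim
          case (elim s)
          show ?case
          proof
            assume s: "s \<in> {M..r}"
            have "- (S * exp (2 * L * s)) \<le> st c q" if "0 \<le> q" "q \<le> s" for q
            proof -
              have "S * exp (2 * L * q) \<le> S * exp (2 * L * s)"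
                using S that L_nonneg by (intro mult_left_mono) (auto intro: mult_left_mono)
              then show ?thesis using le[of q] that s by simp
            qed
            then have "- (A * (S * exp (2 * L * s))) \<le> D (st c) s"
              using elim nn[of s] s \<open>0 \<le> M\<close> by simp
            then have "- C * (A * (S * exp (2 * L * s))) \<le> F (st c s) (D (st c) s)"
              using A_ge nn[of s] by (intro F_lower) auto
            moreover have "C * (A * (S * exp (2 * L * s))) \<le> C * (S * exp (2 * L * s) + A * (S * exp (2 * L * s)))"
              using nn[of s] C_nonneg by (intro mult_left_mono) auto
            ultimately show "- F (st c s) (D (st c) s) \<le> L * (S * exp (2 * L * s))"
              using CA_le[OF nn[of s]] by linarith
          qed
        qed
      qed
      also have "\<dots> \<le> S * exp (2 * L * r) / 2" using M S by (intro integral_weight_le)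
      finally have "- integral {M..r} (\<lambda>s. F (st c s) (D (st c) s)) \<le> S * exp (2 * L * r) / 2" by simp
      moreover have "st c r - st c M = integral {M..r} (\<lambda>s. F (st c s) (D (st c) s)) - 0"
        using st_increment[OF c c \<open>0 \<le> M\<close> M] zero_control_integral[OF \<open>0 \<le> M\<close> order_refl c0] by simp
      ultimately show ?thesis using pos[of M] \<open>0 \<le> M\<close> by simp
    qed
  qed (use B L_nonneg t in auto)
  then show ?thesis by simp
qed

lemma zero_control_mono:
  assumes c: "c \<in> L1_loc_nonneg" and "0 \<le> M" and c0: "\<And>t. M < t \<Longrightarrow> c t = 0"
    and pos: "\<And>t. 0 \<le> t \<Longrightarrow> t \<le> M \<Longrightarrow> 0 \<le> st c t" and st: "M \<le> s" "s \<le> t"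
  shows "st c s \<le> st c t"
proof -
  have nn: "0 \<le> st c t" if "0 \<le> t" for t using zero_control_nonneg[OF c \<open>0 \<le> M\<close> c0 pos that] by simp
  have "0 \<le> integral {s..t} (\<lambda>s. F (st c s) (D (st c) s))"
  proof (rule integral_nonneg_AE_on)
    show "(\<lambda>s. F (st c s) (D (st c) s)) absolutely_integrable_on {s..t}"
      using F_integrable[OF st_traj[OF c]] st \<open>0 \<le> M\<close> by simp
    show "AE r in lebesgue. r \<in> {s..t} \<longrightarrow> 0 \<le> F (st c r) (D (st c) r)"
      using D_lower_AE[OF st_traj[OF c]]
    proof eventually_elim
      case (elim r)
      show ?case
      proof
        assume r: "r \<in> {s..t}"
        have "- (A * 0) \<le> D (st c) r" using elim[rule_format, of 0] nn r st \<open>0 \<le> M\<close> by auto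
        then show "0 \<le> F (st c r) (D (st c) r)" using F_lower[of 0] by simp
      qed
    qed
  qed
  then show ?thesis
    using st_increment[OF c c, of s t] zero_control_integral[OF \<open>0 \<le> M\<close> st(1) c0] st \<open>0 \<le> M\<close> by simp
qed

lemma zero_in_L1: "(\<lambda>_. 0) \<in> L1_loc_nonneg"
  by (simp add: L1_loc_nonneg_def)

lemma st_zero_ge: "0 \<le> t \<Longrightarrow> fst \<eta> \<le> st (\<lambda>_. 0) t"
  using zero_control_mono[OF zero_in_L1 order_refl, of 0 t] st_init[OF zero_in_L1] init_pos by (smt (verit))

text \<open>Bounds for the state and for the integral of its drift up to time \<open>R\<close>, for controls of mass at most \<open>K\<close>.
  They do not depend on the memory \<open>D\<close>.\<close>

definition data_bound :: "real \<Rightarrow> real" where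
  "data_bound R = fst \<eta> + f0 0 0 * R + C * I * sqrt R"

definition state_bound :: "real \<Rightarrow> real \<Rightarrow> real" where
  "state_bound R K = 2 * (data_bound R + K) * exp (2 * L * R)"

definition drift_bound :: "real \<Rightarrow> real \<Rightarrow> real" where
  "drift_bound R K = data_bound R + state_bound R K * exp (2 * L * R) / 2"

lemma data_bound_mono: "0 \<le> s \<Longrightarrow> s \<le> t \<Longrightarrow> data_bound s \<le> data_bound t"
  unfolding data_bound_def using f0_nonneg[of 0] C_nonneg I_nonneg
  by (intro add_mono mult_left_mono) auto

lemma data_bound_nonneg: "0 \<le> R \<Longrightarrow> 0 \<le> data_bound R"
  unfolding data_bound_def using f0_nonneg[of 0] C_nonneg I_nonneg init_pos by (intro add_nonneg_nonneg) auto

lemma state_bound_nonneg: "0 \<le> R \<Longrightarrow> 0 \<le> K \<Longrightarrow> 0 \<le> state_bound R K"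
  unfolding state_bound_def using data_bound_nonneg by simp

lemma D_past_abs_integrable: "0 \<le> a \<Longrightarrow> (\<lambda>r. \<bar>D past r\<bar>) absolutely_integrable_on {a..b}"
  by (intro set_integrable_abs D_integrable traj_past)

lemma D_abs_le:
  assumes "traj x" "0 \<le> t" "\<And>s. 0 \<le> s \<Longrightarrow> s \<le> t \<Longrightarrow> \<bar>x s\<bar> \<le> B"
  shows "\<bar>D x t\<bar> \<le> \<bar>D past t\<bar> + A * B"
proof -
  have "\<bar>D x t - D past t\<bar> \<le> A * B"
    using assms by (intro D_abs traj_past) (auto simp: past_def)
  then show ?thesis by linarith
qed

lemma F_integral_le:
  assumes x: "traj x" and t: "0 \<le> t" and S: "0 \<le> S"
    and le: "\<And>s. 0 \<le> s \<Longrightarrow> s \<le> t \<Longrightarrow> \<bar>x s\<bar> \<le> S * exp (2 * L * s)"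
  shows "fst \<eta> + integral {0..t} (\<lambda>s. \<bar>F (x s) (D x s)\<bar>) \<le> data_bound t + S * exp (2 * L * t) / 2"
proof -
  let ?g = "\<lambda>s. (f0 0 0 + C * \<bar>D past s\<bar>) + L * (S * exp (2 * L * s))"
  have i1: "(\<lambda>s. C * \<bar>D past s\<bar>) integrable_on {0..t}"
    by (intro integrable_of_absolutely set_integrable_mult_right D_past_abs_integrable order_refl)
  have i2: "(\<lambda>s. L * (S * exp (2 * L * s))) integrable_on {0..t}" using t S by (intro integral_weight_le)
  have i3: "(\<lambda>s. f0 0 0 + C * \<bar>D past s\<bar>) integrable_on {0..t}"
    by (intro integrable_add i1 integrable_const_ivl)
  have "integral {0..t} (\<lambda>s. \<bar>F (x s) (D x s)\<bar>) \<le> integral {0..t} ?g"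
  proof (rule integral_le)
    show "(\<lambda>s. \<bar>F (x s) (D x s)\<bar>) integrable_on {0..t}"
      using x by (intro integrable_of_absolutely set_integrable_abs F_integrable) auto
    show "?g integrable_on {0..t}" by (rule integrable_add[OF i3 i2])
    fix r assume r: "r \<in> {0..t}"
    have Sr: "0 \<le> S * exp (2 * L * r)" using S by simp
    have "\<bar>D x r\<bar> \<le> \<bar>D past r\<bar> + A * (S * exp (2 * L * r))"
    proof (rule D_abs_le[OF x])
      fix s assume s: "0 \<le> s" "s \<le> r"
      have "S * exp (2 * L * s) \<le> S * exp (2 * L * r)"
        using S s L_nonneg by (intro mult_left_mono) (auto intro: mult_left_mono)
      then show "\<bar>x s\<bar> \<le> S * exp (2 * L * r)" using le[of s] s r by simp
    qed (use r in auto)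
    then have "C * (\<bar>x r\<bar> + \<bar>D x r\<bar>) \<le> C * (S * exp (2 * L * r) + (\<bar>D past r\<bar> + A * (S * exp (2 * L * r))))"
      using le[of r] r C_nonneg by (intro mult_left_mono add_mono) auto
    also have "\<dots> = C * \<bar>D past r\<bar> + C * (S * exp (2 * L * r) + A * (S * exp (2 * L * r)))"
      by (simp add: algebra_simps)
    also have "\<dots> \<le> C * \<bar>D past r\<bar> + L * (S * exp (2 * L * r))" using CA_le[OF Sr] by simp
    finally show "\<bar>F (x r) (D x r)\<bar> \<le> ?g r"
      using F_bound[of "x r" "D x r"] by linarith
  qed
  also have "\<dots> = f0 0 0 * t + C * integral {0..t} (\<lambda>s. \<bar>D past s\<bar>) + integral {0..t} (\<lambda>s. L * (S * exp (2 * L * s)))"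
    using t by (simp add: hk_integral_add[OF i3 i2] hk_integral_add[OF integrable_const_ivl i1])
  also have "\<dots> \<le> f0 0 0 * t + C * (I * sqrt t) + S * exp (2 * L * t) / 2"
    using D_past_le[of 0 t] t S C_nonneg f0_nonneg[of 0] by (intro add_mono mult_left_mono integral_weight_le) auto
  finally show ?thesis by (simp add: data_bound_def)
qed

lemma st_eq:
  assumes "c \<in> L1_loc_nonneg" "0 \<le> t"
  shows "st c t = fst \<eta> + integral {0..t} (\<lambda>s. F (st c s) (D (st c) s)) - integral {0..t} c"
  using st_increment[of c 0 t] st_init[of c] assms by simp

lemma F_integral_abs:
  assumes "traj x" "0 \<le> s"
  shows "\<bar>integral {s..t} (\<lambda>s. F (x s) (D x s))\<bar> \<le> integral {s..t} (\<lambda>s. \<bar>F (x s) (D x s)\<bar>)"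
  unfolding real_norm_def[symmetric]
  using assms by (intro integral_norm_bound_integral order_refl integrable_of_absolutely set_integrable_norm F_integrable) auto

lemma control_integral_mono:
  assumes c: "c \<in> L1_loc_nonneg" "0 \<le> t" "t \<le> R"
  shows "0 \<le> integral {0..t} c" "integral {0..t} c \<le> integral {0..R} c"
proof -
  have i: "c integrable_on {0..b}" for b using c by (intro integrable_of_absolutely L1_loc_integrable) auto
  show "0 \<le> integral {0..t} c" "integral {0..t} c \<le> integral {0..R} c"
    using c by (intro hk_integral_nonneg integral_subset_le i; auto simp: L1_loc_nonneg_def)+
qed

lemma weight_le:
  assumes "0 \<le> S" "0 \<le> s"
  shows "S \<le> S * exp (2 * L * s)"
  using assms L_nonneg by (simp add: mult_le_cancel_left1)

lemma st_abs_le: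
  assumes c: "c \<in> L1_loc_nonneg" and K: "integral {0..R} c \<le> K" and t: "0 \<le> t" "t \<le> R"
  shows "\<bar>st c t\<bar> \<le> state_bound R K"
proof -
  have R: "0 \<le> R" using t by simp
  have K0: "0 \<le> K" using control_integral_mono[OF c R order_refl] K by simp
  have tr: "traj (st c)" by (rule st_traj[OF c])
  have "bounded (st c ` {0..R})"
    by (intro compact_imp_bounded compact_continuous_image traj_cont tr) auto
  then obtain B where B: "\<And>s. 0 \<le> s \<Longrightarrow> s \<le> R \<Longrightarrow> \<bar>st c s\<bar> \<le> B"
    unfolding bounded_iff by (metis atLeastAtMost_iff image_eqI real_norm_def)
  have "\<bar>st c t\<bar> \<le> 2 * (data_bound R + K) * exp (2 * L * t)"
  proof (rule weighted_gronwall[where u = "\<lambda>s. \<bar>st c s\<bar>" and R = R and B = B])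
    fix t S assume t: "0 \<le> t" "t \<le> R" and S: "0 \<le> S" and le: "\<And>s. 0 \<le> s \<Longrightarrow> s \<le> t \<Longrightarrow> \<bar>st c s\<bar> \<le> S * exp (2 * L * s)"
    show "\<bar>st c t\<bar> \<le> data_bound R + K + S * exp (2 * L * t) / 2"
      using st_eq[OF c t(1)] F_integral_abs[OF tr order_refl, of t] F_integral_le[OF tr t(1) S le]
        control_integral_mono[OF c t] K data_bound_mono[OF t] init_pos by linarith
  qed (use B L_nonneg t data_bound_nonneg[OF R] K0 in auto)
  also have "\<dots> \<le> state_bound R K"
    unfolding state_bound_def using data_bound_nonneg[OF R] K0 t L_nonneg by (intro mult_left_mono) (auto intro: mult_left_mono)
  finally show ?thesis .
qed

lemma st_upper:
  assumes c: "c \<in> L1_loc_nonneg" and pos: "\<And>s. 0 \<le> s \<Longrightarrow> s \<le> R \<Longrightarrow> 0 \<le> st c s" and t: "0 \<le> t" "t \<le> R"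
  shows "st c t \<le> state_bound R 0"
proof -
  have R: "0 \<le> R" using t by simp
  have "integral {0..R} (\<lambda>_. 0) \<le> (0::real)" by simp
  from st_abs_le[OF zero_in_L1 this t]
  have "st (\<lambda>_. 0) t \<le> state_bound R 0" by simp
  moreover have "st c t \<le> st (\<lambda>_. 0) t"
    using c t by (intro st_antimono zero_in_L1) (auto simp: L1_loc_nonneg_def)
  ultimately show ?thesis by simp
qed

lemma F_integral_bound:
  assumes x: "traj x" and R: "0 \<le> R" "0 \<le> K" and le: "\<And>s. 0 \<le> s \<Longrightarrow> s \<le> R \<Longrightarrow> \<bar>x s\<bar> \<le> state_bound R K"
  shows "fst \<eta> + integral {0..R} (\<lambda>s. \<bar>F (x s) (D x s)\<bar>) \<le> drift_bound R K"
  unfolding drift_bound_def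
proof (rule F_integral_le[OF x R(1) state_bound_nonneg[OF R]])
  fix s assume "0 \<le> s" "s \<le> R"
  then show "\<bar>x s\<bar> \<le> state_bound R K * exp (2 * L * s)" 
    using le[of s] weight_le[OF state_bound_nonneg[OF R], of s] by simp
qed

lemma control_bound:
  assumes c: "c \<in> L1_loc_nonneg" and R: "0 \<le> R" and pos: "\<And>s. 0 \<le> s \<Longrightarrow> s \<le> R \<Longrightarrow> 0 \<le> st c s"
  shows "integral {0..R} c \<le> drift_bound R 0"
proof -
  have "\<bar>st c s\<bar> \<le> state_bound R 0" if "0 \<le> s" "s \<le> R" for s
    using st_upper[OF c pos that] pos[OF that] by simp
  then have "fst \<eta> + integral {0..R} (\<lambda>s. \<bar>F (st c s) (D (st c) s)\<bar>) \<le> drift_bound R 0"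
    using R by (intro F_integral_bound st_traj c) auto
  then show ?thesis
    using st_eq[OF c R] F_integral_abs[OF st_traj[OF c] order_refl, of R] pos[OF R order_refl] by linarith
qed

definition growth_rate :: "real \<Rightarrow> real" where
  "growth_rate R = f0 0 0 + C * (1 + A) * state_bound R 0 + C * I"

lemma st_window:
  assumes c: "c \<in> L1_loc_nonneg" and pos: "\<And>s. 0 \<le> s \<Longrightarrow> s \<le> R \<Longrightarrow> 0 \<le> st c s"
    and st: "0 \<le> s" "s \<le> t" "t \<le> R" "t - s \<le> 1"
  shows "st c t \<le> st c s + growth_rate R * sqrt (t - s)"
proof -
  have R: "0 \<le> R" using st by simp
  let ?B = "state_bound R 0"
  let ?E = "f0 0 0 + C * (1 + A) * ?B"
  have B: "\<bar>st c s\<bar> \<le> ?B" if "0 \<le> s" "s \<le> R" for s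
    using st_upper[OF c pos that] pos[OF that] by simp
  have E: "0 \<le> ?E" using f0_nonneg[of 0] C_nonneg A_ge state_bound_nonneg[OF R, of 0] by simp
  have i1: "(\<lambda>s. C * \<bar>D past s\<bar>) integrable_on {s..t}"
    using st by (intro integrable_of_absolutely set_integrable_mult_right D_past_abs_integrable)
  have "integral {s..t} (\<lambda>s. F (st c s) (D (st c) s)) \<le> integral {s..t} (\<lambda>r. ?E + C * \<bar>D past r\<bar>)"
  proof (rule integral_le)
    show "(\<lambda>s. F (st c s) (D (st c) s)) integrable_on {s..t}"
      using st by (intro integrable_of_absolutely F_integrable st_traj c)
    show "(\<lambda>r. ?E + C * \<bar>D past r\<bar>) integrable_on {s..t}"
      by (intro integrable_add i1 integrable_const_ivl)
    fix r assume r: "r \<in> {s..t}"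
    have "\<bar>D (st c) r\<bar> \<le> \<bar>D past r\<bar> + A * ?B"
      using r st by (intro D_abs_le st_traj c B) auto
    then have "C * (\<bar>st c r\<bar> + \<bar>D (st c) r\<bar>) \<le> C * (?B + (\<bar>D past r\<bar> + A * ?B))"
      using B[of r] r st C_nonneg by (intro mult_left_mono add_mono) auto
    then show "F (st c r) (D (st c) r) \<le> ?E + C * \<bar>D past r\<bar>"
      using F_bound[of "st c r" "D (st c) r"] by (simp add: algebra_simps)
  qed
  also have "\<dots> = ?E * (t - s) + C * integral {s..t} (\<lambda>r. \<bar>D past r\<bar>)"
    using st by (simp add: hk_integral_add[OF integrable_const_ivl i1])
  also have "\<dots> \<le> ?E * sqrt (t - s) + C * (I * sqrt (t - s))"
  proof (intro add_mono mult_left_mono D_past_le E)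
    have "(t - s)\<^sup>2 \<le> (t - s) * 1" unfolding power2_eq_square using st by (intro mult_left_mono) auto
    then show "t - s \<le> sqrt (t - s)" by (intro real_le_rsqrt) simp
  qed (use st C_nonneg in auto)
  also have "\<dots> = growth_rate R * sqrt (t - s)" by (simp add: growth_rate_def algebra_simps)
  finally have "integral {s..t} (\<lambda>s. F (st c s) (D (st c) s)) \<le> growth_rate R * sqrt (t - s)" .
  moreover have "0 \<le> integral {s..t} c"
    using c st by (intro hk_integral_nonneg integrable_of_absolutely L1_loc_integrable) (auto simp: L1_loc_nonneg_def)
  ultimately show ?thesis using st_increment[OF c c st(1,2)] by linarith
qed

lemma scale_L1:
  assumes "c \<in> L1_loc_nonneg" "0 \<le> k"
  shows "(\<lambda>t. k * c t) \<in> L1_loc_nonneg"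
  using assms by (auto simp: L1_loc_nonneg_def)

lemma st_concave:
  assumes c: "c \<in> L1_loc_nonneg" and pos: "\<And>s. 0 \<le> s \<Longrightarrow> 0 \<le> st c s"
    and \<theta>: "0 \<le> \<theta>" "\<theta> \<le> 1" and t: "0 \<le> t"
  shows "(1 - \<theta>) * st c t + \<theta> * st (\<lambda>_. 0) t \<le> st (\<lambda>t. (1 - \<theta>) * c t) t"
proof -
  let ?c = "\<lambda>t. (1 - \<theta>) * c t" and ?z = "\<lambda>_::real. 0 :: real"
  have c': "?c \<in> L1_loc_nonneg" using scale_L1[OF c, of "1 - \<theta>"] \<theta> by simp
  let ?w = "\<lambda>s. (1 - \<theta>) * st c s + \<theta> * st ?z s"
  have tr: "traj (st c)" "traj (st ?z)" "traj (st ?c)" using st_traj c c' zero_in_L1 by blast+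
  have w: "traj ?w"
    using tr(1,2) by (auto simp: traj_iff algebra_simps intro!: continuous_intros)
  show ?thesis
  proof (rule comparison[OF tr(3) w, of t t])
    show "?w 0 \<le> st ?c 0" using st_init c c' zero_in_L1 by (simp add: algebra_simps)
    fix s r assume sr: "0 \<le> s" "s \<le> r" "r \<le> t"
    let ?i = "integral {s..r}"
    let ?G = "\<lambda>x s. F (x s) (D x s)"
    have iG: "?G x integrable_on {s..r}" if "traj x" for x using that sr by (intro integrable_of_absolutely F_integrable)
    have ic: "c integrable_on {s..r}" using c sr by (intro integrable_of_absolutely L1_loc_integrable)
    have "(?w r - st ?c r) - (?w s - st ?c s) = (1 - \<theta>) * (st c r - st c s) + \<theta> * (st ?z r - st ?z s) - (st ?c r - st ?c s)"
      by (simp add: algebra_simps)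
    also have "\<dots> = (1 - \<theta>) * (?i (?G (st c)) - ?i c) + \<theta> * (?i (?G (st ?z))) - (?i (?G (st ?c)) - (1 - \<theta>) * ?i c)"
      using st_increment[OF c c sr(1,2)] st_increment[OF c' c' sr(1,2)] st_increment[OF zero_in_L1 zero_in_L1 sr(1,2)] by simp
    also have "\<dots> = (1 - \<theta>) * ?i (?G (st c)) + \<theta> * ?i (?G (st ?z)) - ?i (?G (st ?c))"
      by (simp add: algebra_simps)
    also have "\<dots> = ?i (\<lambda>q. (1 - \<theta>) * ?G (st c) q + \<theta> * ?G (st ?z) q - ?G (st ?c) q)"
      using iG tr by (simp add: hk_integral_add hk_integral_diff integrable_add integrable_on_mult_right)
    also have "\<dots> \<le> ?i (\<lambda>q. ?G ?w q - ?G (st ?c) q)"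
    proof (rule integral_le)
      show "(\<lambda>q. (1 - \<theta>) * ?G (st c) q + \<theta> * ?G (st ?z) q - ?G (st ?c) q) integrable_on {s..r}"
        using iG tr by (intro integrable_diff integrable_add integrable_on_mult_right)
      show "(\<lambda>q. ?G ?w q - ?G (st ?c) q) integrable_on {s..r}"
        using iG tr w by (intro integrable_diff)
      fix q assume q: "q \<in> {s..r}"
      then have "0 \<le> q" using sr by simp
      have p: "0 \<le> st c q" "0 \<le> st ?z q" using pos[OF \<open>0 \<le> q\<close>] st_zero_ge[OF \<open>0 \<le> q\<close>] init_pos by auto
      then have "0 \<le> ?w q" using \<theta> by simp
      then show "(1 - \<theta>) * ?G (st c) q + \<theta> * ?G (st ?z) q - ?G (st ?c) q \<le> ?G ?w q - ?G (st ?c) q"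
        using concave[OF p \<theta>, of "D (st c) q" "D (st ?z) q"] p
        by (simp add: F_def D_convex[OF tr(1,2) \<open>0 \<le> q\<close>] max_absorb2)
    qed
    finally show "(?w r - st ?c r) - (?w s - st ?c s) \<le> ?i (\<lambda>q. ?G ?w q - ?G (st ?c) q)" .
  qed (use t in auto)
qed

end

section \<open>Nearly optimal controls\<close>

lemma ext_integral_mono:
  assumes "\<And>t. 0 \<le> t \<Longrightarrow> f t \<le> g t"
  shows "ext_integral f \<le> ext_integral g"
proof -
  have "(\<integral>\<^sup>+ t \<in> {0..}. ennreal (f t) \<partial>lebesgue) \<le> (\<integral>\<^sup>+ t \<in> {0..}. ennreal (g t) \<partial>lebesgue)"
    "(\<integral>\<^sup>+ t \<in> {0..}. ennreal (- g t) \<partial>lebesgue) \<le> (\<integral>\<^sup>+ t \<in> {0..}. ennreal (- f t) \<partial>lebesgue)"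
    using assms by (intro nn_integral_mono; auto simp: indicator_def intro!: ennreal_leI)+
  then show ?thesis
    unfolding ext_integral_def by (intro ereal_minus_mono) (simp_all add: less_eq_ennreal.rep_eq)
qed

lemma ext_integral_eq:
  assumes g: "g absolutely_integrable_on {0..}"
  shows "ext_integral g = ereal (integral {0..} g)"
proof -
  let ?h = "\<lambda>t. indicator {0..} t *\<^sub>R g t"
  have i: "integrable lebesgue ?h" using g by (simp add: set_integrable_def)
  have p: "(\<integral>\<^sup>+ t. ennreal (?h t) \<partial>lebesgue) < \<infinity>" "(\<integral>\<^sup>+ t. ennreal (- ?h t) \<partial>lebesgue) < \<infinity>"
    using i unfolding real_integrable_def by (auto simp: top.not_eq_extremum)
  have e: "(\<integral>\<^sup>+ t \<in> {0..}. ennreal (g t) \<partial>lebesgue) = (\<integral>\<^sup>+ t. ennreal (?h t) \<partial>lebesgue)"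
     "(\<integral>\<^sup>+ t \<in> {0..}. ennreal (- g t) \<partial>lebesgue) = (\<integral>\<^sup>+ t. ennreal (- ?h t) \<partial>lebesgue)"
    by (auto intro!: nn_integral_cong simp: indicator_def)
  have f: "enn2ereal x = ereal (enn2real x)" if "x < \<infinity>" for x
    using that by (cases x) (auto simp: enn2ereal_ennreal)
  have "integral {0..} g = enn2real (\<integral>\<^sup>+ t. ennreal (?h t) \<partial>lebesgue) - enn2real (\<integral>\<^sup>+ t. ennreal (- ?h t) \<partial>lebesgue)"
    using set_lebesgue_integral_eq_integral(2)[OF g] real_lebesgue_integral_def[OF i]
    by (simp add: set_lebesgue_integral_def)
  then show ?thesis unfolding ext_integral_def e f[OF p(1)] f[OF p(2)] by simp
qed

lemma ext_integral_finite_imp_integrable: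
  assumes m: "g \<in> borel_measurable (lebesgue_on {0..})"
    and b: "b absolutely_integrable_on {0..}" and le: "\<And>t. 0 \<le> t \<Longrightarrow> g t \<le> b t"
    and fin: "- \<infinity> < ext_integral g"
  shows "g absolutely_integrable_on {0..}"
proof -
  let ?h = "\<lambda>t. indicator {0..} t *\<^sub>R g t"
  have hm: "?h \<in> borel_measurable lebesgue"
    using m by (simp add: borel_measurable_restrict_space_iff)
  have "(\<integral>\<^sup>+ t. ennreal (?h t) \<partial>lebesgue) \<le> (\<integral>\<^sup>+ t. ennreal (norm (indicator {0..} t *\<^sub>R b t)) \<partial>lebesgue)"
    using le by (intro nn_integral_mono ennreal_leI) (auto simp: indicator_def intro: order_trans[OF le abs_ge_self])
  also have "\<dots> < \<infinity>" using b by (simp add: set_integrable_def integrable_iff_bounded)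
  finally have p: "(\<integral>\<^sup>+ t. ennreal (?h t) \<partial>lebesgue) \<noteq> \<infinity>" by simp
  have e: "(\<integral>\<^sup>+ t \<in> {0..}. ennreal (- g t) \<partial>lebesgue) = (\<integral>\<^sup>+ t. ennreal (- ?h t) \<partial>lebesgue)"
    by (auto intro!: nn_integral_cong simp: indicator_def)
  have "(\<integral>\<^sup>+ t. ennreal (- ?h t) \<partial>lebesgue) \<noteq> \<infinity>"
  proof
    assume "(\<integral>\<^sup>+ t. ennreal (- ?h t) \<partial>lebesgue) = \<infinity>"
    moreover have "(\<integral>\<^sup>+ t \<in> {0..}. ennreal (g t) \<partial>lebesgue) = (\<integral>\<^sup>+ t. ennreal (?h t) \<partial>lebesgue)"
      by (auto intro!: nn_integral_cong simp: indicator_def)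
    ultimately show False
      using fin p unfolding ext_integral_def e
      by (cases "\<integral>\<^sup>+ t. ennreal (?h t) \<partial>lebesgue") (auto simp: enn2ereal_ennreal)
  qed
  then show ?thesis unfolding set_integrable_def real_integrable_def using hm p by simp
qed

locale utility =
  fixes \<rho> :: real and U1 U2 :: "real \<Rightarrow> real" and B1 B2 :: real
  assumes \<rho>_pos: "0 < \<rho>"
    and U1_cont: "continuous_on {0..} U1"
    and U1_bound: "\<And>x. 0 \<le> x \<Longrightarrow> \<bar>U1 x\<bar> \<le> B1"
    and U1_concave: "\<And>x \<theta>. 0 \<le> x \<Longrightarrow> 0 \<le> \<theta> \<Longrightarrow> \<theta> \<le> 1 \<Longrightarrow> (1 - \<theta>) * U1 x + \<theta> * U1 0 \<le> U1 ((1 - \<theta>) * x)"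
    and U2_cont: "continuous_on {0<..} U2"
    and U2_mono: "\<And>x y. 0 < x \<Longrightarrow> x \<le> y \<Longrightarrow> U2 x \<le> U2 y"
    and U2_concave: "concave_on {0<..} U2"
    and U2_bound: "\<And>x. 0 < x \<Longrightarrow> U2 x \<le> B2"
    and U2_sing: "filterlim (\<lambda>x. x * U2 x) at_bot (at_right 0)"
begin

lemma B1_nonneg: "0 \<le> B1"
  using U1_bound[of 0] by simp

lemma exp_integrable: "(\<lambda>t. exp (- \<rho> * t)) absolutely_integrable_on {a..}"
  using has_integral_exp_minus_to_infinity[OF \<rho>_pos, of a]
  by (intro nonnegative_absolutely_integrable_1) auto

lemma exp_integral: "integral {a..} (\<lambda>t. exp (- \<rho> * t)) = exp (- \<rho> * a) / \<rho>"
  using has_integral_exp_minus_to_infinity[OF \<rho>_pos, of a] by (simp add: integral_unique)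

lemma cexp_integrable: "(\<lambda>t. k * exp (- \<rho> * t)) absolutely_integrable_on {a..}"
  by (intro set_integrable_mult_right exp_integrable)

lemma cexp_integral: "integral {a..} (\<lambda>t. k * exp (- \<rho> * t)) = k * exp (- \<rho> * a) / \<rho>"
  using exp_integral[of a] by simp

lemma U2_secant:
  assumes "0 < \<theta>" "\<theta> < 1" "0 < x" "0 < y"
  shows "(1 - \<theta>) * U2 x + \<theta> * U2 y \<le> U2 ((1 - \<theta>) * x + \<theta> * y)"
  using concave_onD[OF U2_concave, of \<theta> x y] assms by simp

lemma U2_incr_antimono:
  assumes "0 < x" "x \<le> y" "0 \<le> h"
  shows "U2 (y + h) - U2 y \<le> U2 (x + h) - U2 x"
proof (cases "x = y \<or> h = 0")
  case False
  then have h: "0 < h" "x < y" using assms by auto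
  define \<theta> where "\<theta> = h / (y - x + h)"
  have \<theta>: "0 < \<theta>" "\<theta> < 1" using h by (auto simp: \<theta>_def)
  have k: "\<theta> * (y - x + h) = h" unfolding \<theta>_def using h by simp
  have e1: "(1 - \<theta>) * x + \<theta> * (y + h) = x + h"
    using k by (simp add: algebra_simps)
  have e2: "(1 - (1 - \<theta>)) * x + (1 - \<theta>) * (y + h) = y"
    using k by (simp add: algebra_simps)
  show ?thesis
    using U2_secant[OF \<theta>, of x "y + h"] U2_secant[of "1 - \<theta>" x "y + h"] \<theta> assms h
    unfolding e1 e2 by (simp add: algebra_simps)
qed auto

lemma U2_steep:
  assumes "0 < r0" "0 \<le> Q"
  obtains r where "0 < r" "r \<le> r0" "Q / r < U2 (2 * r) - U2 r"
proof -
  have "\<exists>r. 0 < r \<and> r \<le> r0 \<and> Q / r < U2 (2 * r) - U2 r"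
  proof (rule ccontr)
    assume "\<not> ?thesis"
    then have H: "U2 (2 * r) - U2 r \<le> Q / r" if "0 < r" "r \<le> r0" for r using that by force
    define d where "d n = r0 / 2 ^ n" for n :: nat
    have d: "0 < d n" "d n \<le> r0" for n
      using assms(1) by (auto simp: d_def divide_le_eq mult_le_cancel_left1)
    have "U2 r0 - 2 * Q / d n \<le> U2 (d n)" for n
    proof (induction n)
      case 0 then show ?case using assms by (simp add: d_def)
    next
      case (Suc n)
      have e: "d n = 2 * d (Suc n)" by (simp add: d_def)
      have "U2 (d n) - U2 (d (Suc n)) \<le> Q / d (Suc n)" using H[OF d] by (simp only: e)
      moreover have "2 * Q / d (Suc n) = 2 * Q / d n + Q / d (Suc n)"
        unfolding e using d[of "Suc n"] by (simp add: field_simps)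
      ultimately show ?case using Suc by linarith
    qed
    then have "d n * (U2 r0 - 2 * Q / d n) \<le> d n * U2 (d n)" for n
      using d[of n] by (intro mult_left_mono) auto
    moreover have "d n * (U2 r0 - 2 * Q / d n) = d n * U2 r0 - 2 * Q" for n
      using d(1)[of n] by (simp add: right_diff_distrib)
    ultimately have "d n * U2 r0 - 2 * Q \<le> d n * U2 (d n)" for n by simp
    moreover have "- (r0 * \<bar>U2 r0\<bar>) \<le> d n * U2 r0" for n
    proof -
      have "d n * (- U2 r0) \<le> d n * \<bar>U2 r0\<bar>" using d[of n] by (intro mult_left_mono) auto
      also have "\<dots> \<le> r0 * \<bar>U2 r0\<bar>" using d[of n] by (intro mult_right_mono) auto
      finally show ?thesis by simp
    qed
    ultimately have low: "- (r0 * \<bar>U2 r0\<bar>) - 2 * Q \<le> d n * U2 (d n)" for n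
      by (meson diff_right_mono order_trans)
    have "d \<longlonglongrightarrow> 0" unfolding d_def
      using LIMSEQ_divide_realpow_zero[of 2 r0] by simp
    moreover have "d n \<noteq> 0" for n using d(1)[of n] by simp
    ultimately have "filterlim d (at_right 0) sequentially"
      using d by (auto simp: filterlim_at intro!: always_eventually)
    then have "filterlim (\<lambda>n. d n * U2 (d n)) at_bot sequentially"
      using filterlim_compose[OF U2_sing] by blast
    then have "\<forall>\<^sub>F n in sequentially. d n * U2 (d n) < - (r0 * \<bar>U2 r0\<bar>) - 2 * Q"
      by (simp add: filterlim_at_bot_dense)
    then obtain n where "d n * U2 (d n) < - (r0 * \<bar>U2 r0\<bar>) - 2 * Q"
      by (auto simp: eventually_sequentially)
    then show False using low[of n] by simp
  qed
  then show ?thesis using that by blast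
qed

end

locale control_system = memory_system + utility
begin

abbreviation "adm \<equiv> admissible T f0 D \<eta>"
abbreviation "pay \<equiv> payoff T \<rho> f0 U1 U2 D \<eta>"
abbreviation "V \<equiv> val T \<rho> f0 U1 U2 D \<eta>"

definition G :: "(real \<Rightarrow> real) \<Rightarrow> real \<Rightarrow> real" where
  "G c t = exp (- \<rho> * t) * (U1 (c t) + U2 (st c t))"

lemma pay_eq: "pay c = ext_integral (G c)"
  by (simp add: payoff_def G_def[abs_def])

lemma adm_iff: "c \<in> adm \<longleftrightarrow> c \<in> L1_loc_nonneg \<and> (\<forall>t\<ge>0. 0 < st c t)"
  by (simp add: admissible_def)

lemma G_measurable:
  assumes "c \<in> adm"
  shows "G c \<in> borel_measurable (lebesgue_on {0..})"
proof -
  have c: "c \<in> L1_loc_nonneg" and pos: "\<And>t. 0 \<le> t \<Longrightarrow> 0 < st c t" using assms by (auto simp: adm_iff)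
  have c0: "\<And>t. 0 \<le> t \<Longrightarrow> 0 \<le> c t" using c by (simp add: L1_loc_nonneg_def)
  let ?h = "\<lambda>t. indicator {0..} t *\<^sub>R c t"
  have hm: "?h \<in> borel_measurable lebesgue"
  proof (rule borel_measurable_LIMSEQ_real)
    fix n :: nat
    have "c absolutely_integrable_on {0..real n}" using c by (intro L1_loc_integrable) auto
    then show "(\<lambda>t. indicator {0..real n} t *\<^sub>R c t) \<in> borel_measurable lebesgue"
      unfolding set_integrable_def by (rule borel_measurable_integrable)
  next
    fix t :: real
    obtain N :: nat where "t \<le> N" using real_arch_simple by blast
    then have "\<forall>\<^sub>F n in sequentially. indicator {0..real n} t *\<^sub>R c t = ?h t"
      unfolding eventually_sequentially by (intro exI[of _ N]) (auto simp: indicator_def)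
    then show "(\<lambda>n. indicator {0..real n} t *\<^sub>R c t) \<longlonglongrightarrow> ?h t"
      by (rule tendsto_eventually)
  qed
  have cu: "continuous_on UNIV (\<lambda>x. U1 (max 0 x))"
    by (rule continuous_on_compose2[OF U1_cont]) (auto intro: continuous_intros)
  have "(\<lambda>t. U1 (max 0 (?h t))) \<in> borel_measurable (lebesgue_on {0..})"
    using borel_measurable_continuous_onI[OF cu] hm
    by (intro measurable_restrict_space1) (rule measurable_compose)
  moreover have "(\<lambda>t. U2 (st c t)) \<in> borel_measurable (lebesgue_on {0..})"
  proof (rule continuous_imp_measurable_on_sets_lebesgue)
    show "continuous_on {0..} (\<lambda>t. U2 (st c t))"
      using st_traj[OF c] pos unfolding traj_def
      by (intro continuous_on_compose2[OF U2_cont]) auto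
  qed simp
  moreover have "(\<lambda>t. exp (- \<rho> * t)) \<in> borel_measurable (lebesgue_on {0..})"
    by (intro continuous_imp_measurable_on_sets_lebesgue continuous_intros) simp
  ultimately have "(\<lambda>t. exp (- \<rho> * t) * (U1 (max 0 (?h t)) + U2 (st c t))) \<in> borel_measurable (lebesgue_on {0..})"
    by (intro borel_measurable_times borel_measurable_add)
  then show ?thesis
    by (rule measurable_cong[THEN iffD1, rotated]) (auto simp: G_def c0 max_absorb2)
qed

lemma G_le:
  assumes "c \<in> adm" "0 \<le> t"
  shows "G c t \<le> (B1 + B2) * exp (- \<rho> * t)"
proof -
  have "0 \<le> c t" "0 < st c t" using assms by (auto simp: adm_iff L1_loc_nonneg_def)
  then have "U1 (c t) + U2 (st c t) \<le> B1 + B2" using U1_bound[of "c t"] U2_bound[of "st c t"] by linarith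
  then show ?thesis unfolding G_def by (simp add: mult.commute)
qed

lemma pay_le:
  assumes "c \<in> adm"
  shows "pay c \<le> ereal ((B1 + B2) / \<rho>)"
proof -
  have "pay c \<le> ext_integral (\<lambda>t. (B1 + B2) * exp (- \<rho> * t))"
    unfolding pay_eq by (intro ext_integral_mono G_le assms)
  also have "\<dots> = ereal ((B1 + B2) / \<rho>)"
    unfolding ext_integral_eq[OF cexp_integrable] cexp_integral by simp
  finally show ?thesis .
qed

lemma G_integrable:
  assumes "c \<in> adm" "- \<infinity> < pay c"
  shows "G c absolutely_integrable_on {0..}"
  by (rule ext_integral_finite_imp_integrable[where b = "\<lambda>t. (B1 + B2) * exp (- \<rho> * t)"])
    (use assms G_measurable G_le cexp_integrable in \<open>simp_all only: pay_eq\<close>)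

lemma zero_adm: "(\<lambda>_. 0) \<in> adm"
  using zero_in_L1 st_zero_ge init_pos by (auto simp: adm_iff intro: less_le_trans)

lemma pay_zero_ge: "ereal ((- B1 + U2 (fst \<eta>)) / \<rho>) \<le> pay (\<lambda>_. 0)"
proof -
  have "ereal ((- B1 + U2 (fst \<eta>)) / \<rho>) = ext_integral (\<lambda>t. (- B1 + U2 (fst \<eta>)) * exp (- \<rho> * t))"
    unfolding ext_integral_eq[OF cexp_integrable] cexp_integral by simp
  also have "\<dots> \<le> pay (\<lambda>_. 0)"
    unfolding pay_eq
  proof (rule ext_integral_mono)
    fix t :: real assume "0 \<le> t"
    then have "- B1 + U2 (fst \<eta>) \<le> U1 0 + U2 (st (\<lambda>_. 0) t)"
      using U2_mono[OF init_pos st_zero_ge] U1_bound[of 0] by force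
    then show "(- B1 + U2 (fst \<eta>)) * exp (- \<rho> * t) \<le> G (\<lambda>_. 0) t"
      unfolding G_def by (simp add: mult.commute)
  qed
  finally show ?thesis .
qed

lemma V_ge: "ereal ((- B1 + U2 (fst \<eta>)) / \<rho>) \<le> V"
  unfolding val_def by (rule order_trans[OF pay_zero_ge]) (intro SUP_upper zero_adm)

lemma V_le: "V \<le> ereal ((B1 + B2) / \<rho>)"
  unfolding val_def by (intro SUP_least pay_le)

lemma V_finite: "\<bar>V\<bar> \<noteq> \<infinity>"
  using V_ge V_le by (cases V) auto

lemma pay_le_V: "c \<in> adm \<Longrightarrow> pay c \<le> V"
  unfolding val_def by (rule SUP_upper)

text \<open>If \<open>U2 (2 * r) - U2 r\<close> exceeds \<open>steepness M / r\<close>, the perturbation \<open>(1 - \<theta>) c\<close> with \<open>\<theta> = 2 * r / fst \<eta>\<close>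
  improves the payoff by more than \<open>r\<close>: the factor \<open>4 * W\<^sup>2\<close> comes from the length \<open>(r / (2 * W))\<^sup>2\<close> of the time
  interval on which the state is at most \<open>r\<close>.\<close>

definition steepness :: "real \<Rightarrow> real" where
  "steepness M = 4 * (max 1 (growth_rate (M + 1)))\<^sup>2 * exp (\<rho> * (M + 1)) * (1 + 2 * (2 * B1 + B2 - U2 (fst \<eta>)) / (fst \<eta> * \<rho>))"

lemma st_lower:
  assumes c: "c \<in> adm" and M: "0 \<le> M"
    and r: "0 < r" "r \<le> fst \<eta> / 4" "r \<le> 1" and steep: "steepness M / r < U2 (2 * r) - U2 r"
    and opt: "V - ereal r \<le> pay c"
    and t0: "0 \<le> t0" "t0 \<le> M"
  shows "r / 2 < st c t0"
proof (rule ccontr)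
  assume "\<not> r / 2 < st c t0"
  then have small: "st c t0 \<le> r / 2" by simp
  define W where "W = max 1 (growth_rate (M + 1))"
  have W: "1 \<le> W" "growth_rate (M + 1) \<le> W" by (auto simp: W_def)
  define \<tau> where "\<tau> = (r / (2 * W))\<^sup>2"
  have "r / (2 * W) \<le> 1" "0 < r / (2 * W)" using r W by (auto simp: divide_le_eq)
  then have \<tau>: "0 < \<tau>" "\<tau> \<le> 1" "sqrt \<tau> = r / (2 * W)"
    unfolding \<tau>_def using zero_less_power[of "r / (2 * W)" 2] power_le_one[of "r / (2 * W)" 2]
    by (auto simp only: real_sqrt_abs abs_of_pos less_imp_le)
  define \<theta> where "\<theta> = 2 * r / fst \<eta>"
  have \<theta>: "0 < \<theta>" "\<theta> \<le> 1 / 2" "\<theta> * fst \<eta> = 2 * r"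
    using r init_pos by (auto simp: \<theta>_def field_simps)
  define \<Delta> where "\<Delta> = U2 (2 * r) - U2 r"
  define Q0 where "Q0 = 2 * B1 + B2 - U2 (fst \<eta>)"
  define c' where "c' = (\<lambda>t. (1 - \<theta>) * c t)"
  have cL: "c \<in> L1_loc_nonneg" and pos: "\<And>t. 0 \<le> t \<Longrightarrow> 0 < st c t" using c by (auto simp: adm_iff)
  have c'L: "c' \<in> L1_loc_nonneg" unfolding c'_def using \<theta> by (intro scale_L1 cL) auto
  have c't: "(1 - \<theta>) * st c t + \<theta> * fst \<eta> \<le> st c' t" if "0 \<le> t" for t
  proof -
    have "(1 - \<theta>) * st c t + \<theta> * fst \<eta> \<le> (1 - \<theta>) * st c t + \<theta> * st (\<lambda>_. 0) t"
      using st_zero_ge[OF that] \<theta>(1) by (intro add_left_mono mult_left_mono) auto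
    also have "\<dots> \<le> st c' t" unfolding c'_def
      using pos \<theta> that by (intro st_concave cL) (auto intro: less_imp_le)
    finally show ?thesis .
  qed
  have mid: "0 < (1 - \<theta>) * st c t + \<theta> * fst \<eta>" if "0 \<le> t" for t
    using pos[OF that] \<theta> r(1) by (intro add_pos_pos) auto
  have c'adm: "c' \<in> adm" using c'L c't mid by (auto simp: adm_iff intro: less_le_trans)
  have window: "st c t \<le> r" if t: "t \<in> {t0..t0 + \<tau>}" for t
  proof -
    have "st c t \<le> st c t0 + growth_rate (M + 1) * sqrt (t - t0)"
      using t t0 \<tau> pos by (intro st_window[OF cL]) (auto intro: less_imp_le)
    also have "\<dots> \<le> r / 2 + W * sqrt \<tau>"
      using t W small by (intro add_mono mult_mono) auto
    also have "\<dots> = r" using \<tau> W by simp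
    finally show ?thesis .
  qed
  have U1': "U1 (c t) - 2 * B1 * \<theta> \<le> U1 (c' t)" if "0 \<le> t" for t
  proof -
    have c0: "0 \<le> c t" using cL that by (simp add: L1_loc_nonneg_def)
    have "\<theta> * (U1 (c t) - U1 0) \<le> \<theta> * (2 * B1)"
      using U1_bound[OF c0] U1_bound[of 0] \<theta> by (intro mult_left_mono) auto
    then show ?thesis using U1_concave[OF c0, of \<theta>] \<theta> by (simp add: c'_def algebra_simps)
  qed
  have U2': "U2 (st c t) - \<theta> * (B2 - U2 (fst \<eta>)) \<le> U2 (st c' t)" if "0 \<le> t" for t
  proof -
    have "\<theta> * (U2 (st c t) - U2 (fst \<eta>)) \<le> \<theta> * (B2 - U2 (fst \<eta>))"
      using U2_bound[OF pos[OF that]] \<theta> by (intro mult_left_mono) auto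
    then have "U2 (st c t) - \<theta> * (B2 - U2 (fst \<eta>)) \<le> (1 - \<theta>) * U2 (st c t) + \<theta> * U2 (fst \<eta>)"
      by (simp add: algebra_simps)
    also have "\<dots> \<le> U2 ((1 - \<theta>) * st c t + \<theta> * fst \<eta>)"
      using U2_secant[of \<theta> "st c t" "fst \<eta>"] \<theta> pos[OF that] init_pos by simp
    also have "\<dots> \<le> U2 (st c' t)" using c't[OF that] mid[OF that] by (intro U2_mono)
    finally show ?thesis .
  qed
  have U2'': "U2 (st c t) + \<Delta> \<le> U2 (st c' t)" if t: "t \<in> {t0..t0 + \<tau>}" for t
  proof -
    have t': "0 \<le> t" using t t0 by simp
    have "\<theta> * st c t \<le> \<theta> * r" using window[OF t] \<theta> by simp
    also have "\<dots> \<le> 1 * r" using \<theta> r by (intro mult_right_mono) auto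
    finally have "st c t + r \<le> (1 - \<theta>) * st c t + \<theta> * fst \<eta>"
      using \<theta> by (simp add: algebra_simps)
    then have "U2 (st c t + r) \<le> U2 (st c' t)"
      using c't[OF t'] pos[OF t'] r by (intro U2_mono) auto
    moreover have "\<Delta> \<le> U2 (st c t + r) - U2 (st c t)"
      using U2_incr_antimono[OF pos[OF t'] window[OF t], of r] r by (simp add: \<Delta>_def)
    ultimately show ?thesis by simp
  qed
  have Q0: "0 \<le> Q0" using U2_bound[OF init_pos] B1_nonneg by (simp add: Q0_def)
  have \<Delta>: "0 \<le> \<Delta>" using r by (auto simp: \<Delta>_def intro!: U2_mono)
  let ?E = "exp (- \<rho> * (M + 1))"
  define g where "g t = G c t + - (\<theta> * Q0) * exp (- \<rho> * t) + (if t \<in> {t0..t0 + \<tau>} then \<Delta> * ?E else 0)" for t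
  have gle: "g t \<le> G c' t" if t: "0 \<le> t" for t
  proof -
    have *: "exp (- \<rho> * t) * (U1 (c t) + U2 (st c t) - \<theta> * Q0 + (if t \<in> {t0..t0 + \<tau>} then \<Delta> else 0)) \<le> G c' t"
      unfolding G_def
    proof (intro mult_left_mono)
      show "U1 (c t) + U2 (st c t) - \<theta> * Q0 + (if t \<in> {t0..t0 + \<tau>} then \<Delta> else 0) \<le> U1 (c' t) + U2 (st c' t)"
      proof (cases "t \<in> {t0..t0 + \<tau>}")
        case True
        have "0 \<le> \<theta> * (B2 - U2 (fst \<eta>))" using U2_bound[OF init_pos] \<theta> by simp
        then show ?thesis unfolding if_P[OF True] using U1'[OF t] U2''[OF True] by (simp add: Q0_def algebra_simps)
      next
        case False
        show ?thesis unfolding if_not_P[OF False] using U1'[OF t] U2'[OF t] by (simp add: Q0_def algebra_simps)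
      qed
    qed simp
    have "?E \<le> exp (- \<rho> * t)" if "t \<in> {t0..t0 + \<tau>}"
      using that t0 \<tau> \<rho>_pos by simp
    then have "(if t \<in> {t0..t0 + \<tau>} then \<Delta> * ?E else 0) \<le> exp (- \<rho> * t) * (if t \<in> {t0..t0 + \<tau>} then \<Delta> else 0)"
      using \<Delta> by (auto simp: mult.commute intro: mult_left_mono)
    then have "g t \<le> exp (- \<rho> * t) * (U1 (c t) + U2 (st c t) - \<theta> * Q0 + (if t \<in> {t0..t0 + \<tau>} then \<Delta> else 0))"
      by (simp add: g_def G_def algebra_simps)
    with * show ?thesis by linarith
  qed
  have "- \<infinity> < V - ereal r" using V_finite by (cases V) auto
  then have Gi: "G c absolutely_integrable_on {0..}" using opt c by (intro G_integrable) auto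
  have step: "((\<lambda>t. if t \<in> {t0..t0 + \<tau>} then \<Delta> * ?E else 0) has_integral (\<tau> * (\<Delta> * ?E))) {0..}"
  proof -
    have "((\<lambda>_. \<Delta> * ?E) has_integral \<tau> * (\<Delta> * ?E)) {t0..t0 + \<tau>}"
      using has_integral_const_real[of "\<Delta> * ?E" t0 "t0 + \<tau>"] \<tau>(1) by simp
    then show ?thesis using t0 by (subst has_integral_restrict) auto
  qed
  have stepa: "(\<lambda>t. if t \<in> {t0..t0 + \<tau>} then \<Delta> * ?E else 0) absolutely_integrable_on {0..}"
    using step \<Delta> by (intro nonnegative_absolutely_integrable_1) auto
  have expa: "(\<lambda>t. - (\<theta> * Q0) * exp (- \<rho> * t)) absolutely_integrable_on {0..}"
    by (intro set_integrable_mult_right exp_integrable)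
  have ga: "g absolutely_integrable_on {0..}"
    unfolding g_def by (intro set_integral_add Gi expa stepa)
  have "integral {0..} g = integral {0..} (G c) + integral {0..} (\<lambda>t. - (\<theta> * Q0) * exp (- \<rho> * t))
      + integral {0..} (\<lambda>t. if t \<in> {t0..t0 + \<tau>} then \<Delta> * ?E else 0)"
    unfolding g_def
    by (simp only: hk_integral_add integrable_add integrable_of_absolutely[OF Gi] integrable_of_absolutely[OF expa] integrable_of_absolutely[OF stepa])
  also have "\<dots> = integral {0..} (G c) - \<theta> * Q0 / \<rho> + \<tau> * (\<Delta> * ?E)"
    unfolding cexp_integral integral_unique[OF step] by simp
  finally have "integral {0..} g = integral {0..} (G c) - \<theta> * Q0 / \<rho> + \<tau> * (\<Delta> * ?E)" .
  then have "pay c - ereal (\<theta> * Q0 / \<rho>) + ereal (\<tau> * (\<Delta> * ?E)) = ext_integral g"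
    by (simp add: pay_eq ext_integral_eq[OF Gi] ext_integral_eq[OF ga])
  also have "\<dots> \<le> pay c'" unfolding pay_eq by (intro ext_integral_mono gle)
  also have "\<dots> \<le> V" by (rule pay_le_V[OF c'adm])
  finally have "pay c - ereal (\<theta> * Q0 / \<rho>) + ereal (\<tau> * (\<Delta> * ?E)) \<le> V" .
  then have "\<tau> * (\<Delta> * ?E) \<le> r + \<theta> * Q0 / \<rho>"
    using opt V_finite by (cases V; simp add: pay_eq ext_integral_eq[OF Gi])
  also have "\<dots> = r * (1 + 2 * Q0 / (fst \<eta> * \<rho>))"
    using init_pos \<rho>_pos by (simp add: \<theta>_def field_simps)
  finally have 1: "\<tau> * (\<Delta> * ?E) \<le> r * (1 + 2 * Q0 / (fst \<eta> * \<rho>))" .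
  have "\<tau> * (\<Delta> * ?E) = (r\<^sup>2 * \<Delta>) / (4 * W\<^sup>2 * exp (\<rho> * (M + 1)))"
  proof -
    define X where "X = exp (\<rho> * (M + 1))"
    have "0 < X" and E: "?E = 1 / X"
      by (simp_all only: X_def exp_minus mult_minus_left inverse_eq_divide exp_gt_zero)
    then show ?thesis unfolding E X_def[symmetric] \<tau>_def using W
      by (simp add: field_simps power2_eq_square)
  qed
  with 1 have "(r\<^sup>2 * \<Delta>) / (4 * W\<^sup>2 * exp (\<rho> * (M + 1))) \<le> r * (1 + 2 * Q0 / (fst \<eta> * \<rho>))" by simp
  moreover have "0 < 4 * W\<^sup>2 * exp (\<rho> * (M + 1))" using W by simp
  ultimately have "r\<^sup>2 * \<Delta> \<le> r * steepness M"
    unfolding steepness_def W_def[symmetric] Q0_def[symmetric] by (simp add: divide_le_eq mult_ac)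
  then have "r * (r * \<Delta>) \<le> r * steepness M" by (simp add: power2_eq_square mult_ac)
  then have "r * \<Delta> \<le> steepness M" using r by simp
  then have "\<Delta> \<le> steepness M / r" using r by (simp add: field_simps)
  then show False using steep by (simp add: \<Delta>_def)
qed

end

section \<open>Transfer between two memories\<close>

lemma absolutely_integrable_if:
  assumes "f absolutely_integrable_on (S \<inter> S')"
  shows "(\<lambda>t. if t \<in> S then f t else 0) absolutely_integrable_on S'"
proof -
  have "(\<lambda>t. indicator S' t *\<^sub>R (if t \<in> S then f t else 0)) = (\<lambda>t. indicator (S \<inter> S') t *\<^sub>R f t)"
    by (auto simp: indicator_def)
  then show ?thesis using assms by (simp add: set_integrable_def)
qed

lemma truncate_L1:
  assumes "c \<in> L1_loc_nonneg"
  shows "truncate_strategy M c \<in> L1_loc_nonneg"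
proof -
  have "c absolutely_integrable_on {0..min M R}" for R
    using assms by (cases "0 \<le> min M R") (auto simp: L1_loc_nonneg_def)
  then have "(\<lambda>t. if t \<in> {0..M} then c t else 0) absolutely_integrable_on {0..R}" for R
    by (intro absolutely_integrable_if) simp
  then show ?thesis using assms by (simp add: L1_loc_nonneg_def truncate_strategy_def[abs_def])
qed

text \<open>The memories are compared only on trajectories whose variation on \<open>[0, R]\<close>, including the value at \<open>0\<close>,
  is at most \<open>K\<close>.\<close>

definition (in delay_system) close :: "real \<Rightarrow> real \<Rightarrow> real \<Rightarrow> memory \<Rightarrow> memory \<Rightarrow> bool" where
  "close R K \<omega> D1 D2 \<longleftrightarrow> (\<forall>v y. v absolutely_integrable_on {0..R} \<longrightarrow> fst \<eta> + integral {0..R} (\<lambda>s. \<bar>v s\<bar>) \<le> K \<longrightarrow>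
     traj y \<longrightarrow> (\<forall>t. 0 \<le> t \<longrightarrow> t \<le> R \<longrightarrow> y t = fst \<eta> + integral {0..t} v) \<longrightarrow>
     integral {0..R} (\<lambda>s. \<bar>D1 y s - D2 y s\<bar>) \<le> \<omega>)"

lemma (in delay_system) close_sym: "close R K \<omega> D1 D2 \<Longrightarrow> close R K \<omega> D2 D1"
  unfolding close_def by (simp add: abs_minus_commute)

locale two_memories = M1: memory_system T C f0 \<eta> A I D1 + M2: memory_system T C f0 \<eta> A I D2
  for T C f0 \<eta> A I D1 D2
begin

lemma stability:
  assumes c: "c \<in> L1_loc_nonneg" and t: "0 \<le> t" "t \<le> R"
  shows "\<bar>M1.st c t - M2.st c t\<bar> \<le> 2 * (C * integral {0..R} (\<lambda>s. \<bar>D1 (M2.st c) s - D2 (M2.st c) s\<bar>)) * exp (2 * M1.L * t)"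
proof -
  let ?x = "M1.st c" and ?y = "M2.st c"
  let ?d = "\<lambda>s. C * \<bar>D1 ?y s - D2 ?y s\<bar>"
  have tr: "M1.traj ?x" "M1.traj ?y" using M1.st_traj[OF c] M2.st_traj[OF c] .
  have ida: "?d absolutely_integrable_on {0..b}" for b
    using tr by (intro set_integrable_mult_right set_integrable_abs set_integral_diff M1.D_integrable M2.D_integrable) auto
  then have id: "?d integrable_on {0..b}" for b by (rule integrable_of_absolutely)
  define e where "e = integral {0..R} ?d"
  have e: "e = C * integral {0..R} (\<lambda>s. \<bar>D1 ?y s - D2 ?y s\<bar>)" by (simp add: e_def)
  have e0: "0 \<le> e" unfolding e_def using M1.C_nonneg by (intro hk_integral_nonneg id) auto
  have "bounded ((\<lambda>s. ?x s - ?y s) ` {0..R})"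
    by (intro compact_imp_bounded compact_continuous_image continuous_intros M1.traj_cont tr) auto
  then obtain B where B: "\<And>s. 0 \<le> s \<Longrightarrow> s \<le> R \<Longrightarrow> \<bar>?x s - ?y s\<bar> \<le> B"
    unfolding bounded_iff by (metis (no_types, lifting) atLeastAtMost_iff image_eqI real_norm_def)
  have "\<bar>?x t - ?y t\<bar> \<le> 2 * e * exp (2 * M1.L * t)"
  proof (rule weighted_gronwall[where u = "\<lambda>s. \<bar>?x s - ?y s\<bar>" and R = R and B = B])
    fix t S assume t: "0 \<le> t" "t \<le> R" and S: "0 \<le> S" and le: "\<And>s. 0 \<le> s \<Longrightarrow> s \<le> t \<Longrightarrow> \<bar>?x s - ?y s\<bar> \<le> S * exp (2 * M1.L * s)"
    let ?F1 = "\<lambda>s. M1.F (?x s) (D1 ?x s)" and ?F2 = "\<lambda>s. M1.F (?y s) (D2 ?y s)" and ?F3 = "\<lambda>s. M1.F (?y s) (D1 ?y s)"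
    have i: "?F1 absolutely_integrable_on {0..t}" "?F2 absolutely_integrable_on {0..t}" "?F3 absolutely_integrable_on {0..t}"
      using M1.F_integrable[OF tr(1)] M1.F_integrable[OF tr(2)] M2.F_integrable[OF tr(2)] by auto
    have "?x t - ?y t = integral {0..t} ?F1 - integral {0..t} ?F2"
      using M1.st_eq[OF c t(1)] M2.st_eq[OF c t(1)] by simp
    also have "\<dots> = integral {0..t} (\<lambda>s. ?F1 s - ?F2 s)"
      by (intro hk_integral_diff[symmetric] integrable_of_absolutely i)
    finally have "\<bar>?x t - ?y t\<bar> = norm (integral {0..t} (\<lambda>s. ?F1 s - ?F2 s))" by simp
    also have "\<dots> \<le> integral {0..t} (\<lambda>s. \<bar>?F1 s - ?F3 s\<bar> + ?d s)"
    proof (rule integral_norm_bound_integral)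
      show "(\<lambda>s. ?F1 s - ?F2 s) integrable_on {0..t}" by (intro integrable_of_absolutely set_integral_diff i)
      show "(\<lambda>s. \<bar>?F1 s - ?F3 s\<bar> + ?d s) integrable_on {0..t}"
        by (intro integrable_of_absolutely set_integral_add set_integrable_abs set_integral_diff i ida)
      fix s
      show "norm (?F1 s - ?F2 s) \<le> \<bar>?F1 s - ?F3 s\<bar> + ?d s"
        using M1.F_lip[of "?y s" "D1 ?y s" "?y s" "D2 ?y s"] by simp
    qed
    also have "\<dots> = integral {0..t} (\<lambda>s. \<bar>?F1 s - ?F3 s\<bar>) + integral {0..t} ?d"
      by (intro hk_integral_add id integrable_of_absolutely set_integrable_abs set_integral_diff i)
    also have "\<dots> \<le> S * exp (2 * M1.L * t) / 2 + e"
      unfolding e_def using M1.C_nonneg t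
      by (intro add_mono M1.F_diff_integral_le[OF tr t(1) S le] integral_subset_le id) auto
    finally show "\<bar>?x t - ?y t\<bar> \<le> e + S * exp (2 * M1.L * t) / 2" by simp
  qed (use B M1.L_nonneg t e0 in auto)
  then show ?thesis unfolding e .
qed

lemma st_close:
  assumes cl: "M1.close R (M1.drift_bound R K + K) \<omega> D1 D2"
    and c: "c \<in> L1_loc_nonneg" and K: "integral {0..R} c \<le> K" and t: "0 \<le> t" "t \<le> R"
  shows "\<bar>M1.st c t - M2.st c t\<bar> \<le> 2 * (C * \<omega>) * exp (2 * M1.L * R)"
proof -
  let ?y = "M2.st c"
  let ?v = "\<lambda>s. M1.F (?y s) (D2 ?y s) - c s"
  have R: "0 \<le> R" using t by simp
  have tr: "M1.traj ?y" by (rule M2.st_traj[OF c])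
  have K0: "0 \<le> K" using M1.control_integral_mono[OF c R order_refl] K by simp
  have ic: "c integrable_on {0..s}" for s using c by (intro integrable_of_absolutely M1.L1_loc_integrable) auto
  have iF: "(\<lambda>s. M1.F (?y s) (D2 ?y s)) absolutely_integrable_on {0..s}" for s using M2.F_integrable[OF tr] by simp
  have v: "?v absolutely_integrable_on {0..s}" for s by (intro M2.rhs_integrable c tr) simp
  have "integral {0..R} (\<lambda>s. \<bar>?v s\<bar>) \<le> integral {0..R} (\<lambda>s. \<bar>M1.F (?y s) (D2 ?y s)\<bar> + c s)"
  proof (rule integral_le)
    fix s assume "s \<in> {0..R}"
    then have "0 \<le> c s" using c by (simp add: L1_loc_nonneg_def)
    then show "\<bar>?v s\<bar> \<le> \<bar>M1.F (?y s) (D2 ?y s)\<bar> + c s" by linarith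
  qed (intro integrable_of_absolutely set_integrable_abs v, intro integrable_add ic integrable_of_absolutely set_integrable_abs iF)
  also have "\<dots> = integral {0..R} (\<lambda>s. \<bar>M1.F (?y s) (D2 ?y s)\<bar>) + integral {0..R} c"
    by (intro hk_integral_add ic integrable_of_absolutely set_integrable_abs iF)
  finally have "fst \<eta> + integral {0..R} (\<lambda>s. \<bar>?v s\<bar>) \<le> M1.drift_bound R K + K"
    using M2.F_integral_bound[OF tr R K0 M2.st_abs_le[OF c K]] K by linarith
  moreover have "?y s = fst \<eta> + integral {0..s} ?v" if "0 \<le> s" for s
    using M2.st_eq[OF c that] hk_integral_diff[OF integrable_of_absolutely[OF iF] ic, of s] by simp
  ultimately have "integral {0..R} (\<lambda>s. \<bar>D1 ?y s - D2 ?y s\<bar>) \<le> \<omega>"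
    using cl v tr unfolding M1.close_def by blast
  then have a: "2 * (C * integral {0..R} (\<lambda>s. \<bar>D1 ?y s - D2 ?y s\<bar>)) \<le> 2 * (C * \<omega>)"
    using M1.C_nonneg by (simp add: mult_left_mono)
  have "0 \<le> integral {0..R} (\<lambda>s. \<bar>D1 ?y s - D2 ?y s\<bar>)"
    by (intro hk_integral_nonneg integrable_of_absolutely set_integrable_abs set_integral_diff M1.D_integrable M2.D_integrable tr) auto
  then have b: "0 \<le> 2 * (C * \<omega>)" using a M1.C_nonneg by (smt (verit) mult_nonneg_nonneg)
  have "exp (2 * M1.L * t) \<le> exp (2 * M1.L * R)" using M1.L_nonneg t by (simp add: mult_left_mono)
  then have "2 * (C * integral {0..R} (\<lambda>s. \<bar>D1 ?y s - D2 ?y s\<bar>)) * exp (2 * M1.L * t) \<le> 2 * (C * \<omega>) * exp (2 * M1.L * R)"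
    by (rule mult_mono[OF a _ b]) simp
  then show ?thesis using stability[OF c t] by linarith
qed

end

locale two_controls = two_memories T C f0 \<eta> A I D1 D2 + utility \<rho> U1 U2 B1 B2
  for T C f0 \<eta> A I D1 D2 \<rho> U1 U2 B1 B2
begin

sublocale C1: control_system T C f0 \<eta> A I D1 \<rho> U1 U2 B1 B2 ..
sublocale C2: control_system T C f0 \<eta> A I D2 \<rho> U1 U2 B1 B2 ..

lemma transfer:
  assumes M: "0 \<le> M" "M \<le> R"
    and r: "0 < r" "r \<le> fst \<eta> / 4" "r \<le> 1" "C1.steepness M / r < U2 (2 * r) - U2 r"
    and cl: "M1.close R (M1.drift_bound R (M1.drift_bound M 0) + M1.drift_bound M 0) \<omega> D1 D2"
    and w: "2 * (C * \<omega>) * exp (2 * M1.L * R) \<le> w" "w \<le> r / 4" "U2 (r / 2) - U2 (r / 2 - w) \<le> \<epsilon>1"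
    and \<epsilon>: "\<epsilon>1 / \<rho> + 2 * B1 * exp (- \<rho> * M) / \<rho> + (B2 - U2 (r / 4)) * exp (- \<rho> * R) / \<rho> \<le> \<epsilon>"
    and c: "c \<in> C1.adm" and opt: "C1.V - ereal r \<le> C1.pay c"
  shows "truncate_strategy M c \<in> C2.adm" "C1.pay c - ereal \<epsilon> \<le> C2.pay (truncate_strategy M c)"
proof -
  define cM where "cM = truncate_strategy M c"
  have cL: "c \<in> L1_loc_nonneg" and pos: "\<And>t. 0 \<le> t \<Longrightarrow> 0 < M1.st c t" using c by (auto simp: C1.adm_iff)
  have cML: "cM \<in> L1_loc_nonneg" unfolding cM_def by (rule truncate_L1[OF cL])
  have cM0: "cM t = 0" if "M < t" for t using that by (simp add: cM_def truncate_strategy_def)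
  have cMeq: "cM t = c t" if "0 \<le> t" "t \<le> M" for t using that by (simp add: cM_def truncate_strategy_def)
  have R: "0 \<le> R" using M by simp
  define K where "K = M1.drift_bound M 0"
  have "integral {0..R} cM = integral {0..M} cM + integral {M..R} cM"
    using M cML by (intro hk_integral_combine[symmetric] integrable_of_absolutely M1.L1_loc_integrable) auto
  also have "integral {M..R} cM = 0" by (rule M1.zero_control_integral[OF M(1) order_refl cM0])
  also have "integral {0..M} cM = integral {0..M} c" by (rule integral_cong) (simp add: cMeq)
  also have "\<dots> \<le> K" unfolding K_def using pos by (intro M1.control_bound cL M) (auto intro: less_imp_le)
  finally have KM: "integral {0..R} cM \<le> K" by simp
  have xge: "M1.st c t \<le> M1.st cM t" if "0 \<le> t" for t
    using cL that by (intro M1.st_antimono cML) (auto simp: cM_def truncate_strategy_def L1_loc_nonneg_def)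
  have xlow: "r / 2 \<le> M1.st cM t" if "0 \<le> t" for t
  proof -
    have low: "r / 2 \<le> M1.st cM s" if "0 \<le> s" "s \<le> M" for s
      using C1.st_lower[OF c M(1) r opt that] xge[OF that(1)] by linarith
    show ?thesis
    proof (cases "t \<le> M")
      case True then show ?thesis using low that by simp
    next
      case False
      have "M1.st cM M \<le> M1.st cM t"
      proof (rule M1.zero_control_mono[OF cML M(1) cM0])
        fix s assume "0 \<le> s" "s \<le> M"
        then show "0 \<le> M1.st cM s" using low[of s] r by simp
      qed (use False in auto)
      then show ?thesis using low[OF M(1)] by simp
    qed
  qed
  have close: "\<bar>M1.st cM t - M2.st cM t\<bar> \<le> w" if "0 \<le> t" "t \<le> R" for t
    using st_close[OF cl[folded K_def] cML KM that] w(1) by linarith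
  have w0: "0 \<le> w" using close[of 0] R by auto
  have ylow: "r / 4 \<le> M2.st cM t" if "0 \<le> t" for t
  proof -
    have low: "r / 4 \<le> M2.st cM s" if "0 \<le> s" "s \<le> R" for s
      using close[OF that] xlow[OF that(1)] w(2) by linarith
    show ?thesis
    proof (cases "t \<le> R")
      case True then show ?thesis using low that by simp
    next
      case False
      have "M2.st cM M \<le> M2.st cM t"
      proof (rule M2.zero_control_mono[OF cML M(1) cM0])
        fix s assume "0 \<le> s" "s \<le> M"
        then show "0 \<le> M2.st cM s" using low[of s] r M by simp
      qed (use False M in auto)
      then show ?thesis using low[OF M] by simp
    qed
  qed
  show "truncate_strategy M c \<in> C2.adm"
    unfolding cM_def[symmetric] C2.adm_iff
  proof (intro conjI allI impI cML)
    fix t :: real assume "0 \<le> t"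
    then show "0 < M2.st cM t" using ylow[of t] r(1) by linarith
  qed
  have "- \<infinity> < C1.V - ereal r" using C1.V_finite by (cases C1.V) auto
  then have Gi: "C1.G c absolutely_integrable_on {0..}" using opt c by (intro C1.G_integrable) auto
  let ?E = "\<lambda>t. exp (- \<rho> * t)"
  let ?h1 = "\<lambda>t. - \<epsilon>1 * ?E t" and ?h2 = "\<lambda>t. if t \<in> {M..} then - (2 * B1) * ?E t else 0"
    and ?h3 = "\<lambda>t. if t \<in> {R..} then - (B2 - U2 (r / 4)) * ?E t else 0"
  define g where "g t = C1.G c t + (?h1 t + (?h2 t + ?h3 t))" for t
  have Ms: "{M..} \<inter> {0..} = {M..}" "{R..} \<inter> {0..} = {R..}" using M by auto
  have ia: "?h1 absolutely_integrable_on {0..}" "?h2 absolutely_integrable_on {0..}" "?h3 absolutely_integrable_on {0..}"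
  proof -
    show "?h2 absolutely_integrable_on {0..}" "?h3 absolutely_integrable_on {0..}"
      by (intro absolutely_integrable_if; simp only: cexp_integrable Ms)+
  qed (rule cexp_integrable)
  have ga: "g absolutely_integrable_on {0..}" unfolding g_def by (intro set_integral_add Gi ia)
  have "integral {0..} g = integral {0..} (C1.G c) + (integral {0..} ?h1 + (integral {0..} ?h2 + integral {0..} ?h3))"
    unfolding g_def
    by (simp only: hk_integral_add integrable_add ia[THEN integrable_of_absolutely] Gi[THEN integrable_of_absolutely])
  also have "integral {0..} ?h1 = - \<epsilon>1 * exp (- \<rho> * 0) / \<rho>" by (rule cexp_integral)
  also have "integral {0..} ?h2 = - (2 * B1) * exp (- \<rho> * M) / \<rho>"
    by (simp only: hk_integral_restrict_Int Ms cexp_integral)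
  also have "integral {0..} ?h3 = - (B2 - U2 (r / 4)) * exp (- \<rho> * R) / \<rho>"
    by (simp only: hk_integral_restrict_Int Ms cexp_integral)
  finally have Ig: "integral {0..} (C1.G c) - \<epsilon> \<le> integral {0..} g"
    using \<epsilon> unfolding mult_minus_left minus_divide_left[symmetric] by simp
  have e1: "0 \<le> \<epsilon>1" using w r w0 U2_mono[of "r / 2 - w" "r / 2"] by simp
  have gle: "g t \<le> C2.G cM t" if t: "0 \<le> t" for t
  proof -
    let ?x = "M1.st cM t" and ?y = "M2.st cM t"
    have c0: "0 \<le> c t" using cL t by (simp add: L1_loc_nonneg_def)
    have u1: "U1 (c t) + (if t \<in> {M..} then - (2 * B1) else 0) \<le> U1 (cM t)"
    proof (cases "t < M")
      case True then show ?thesis using cMeq[of t] t by simp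
    next
      case False
      have "0 \<le> cM t" using cML t by (simp add: L1_loc_nonneg_def)
      then show ?thesis using U1_bound[OF c0] U1_bound[of "cM t"] False by simp
    qed
    have u2: "U2 (M1.st c t) - \<epsilon>1 + (if t \<in> {R..} then - (B2 - U2 (r / 4)) else 0) \<le> U2 ?y"
    proof (cases "t < R")
      case True
      have "U2 (M1.st c t) \<le> U2 ?x" using pos[OF t] xge[OF t] by (intro U2_mono)
      also have "U2 ?x - U2 (?x - w) \<le> U2 (r / 2) - U2 (r / 2 - w)"
        using U2_incr_antimono[of "r / 2 - w" "?x - w" w] xlow[OF t] w r w0 by simp
      then have "U2 ?x \<le> U2 (?x - w) + \<epsilon>1" using w(3) by linarith
      also have "U2 (?x - w) \<le> U2 ?y"
        using xlow[OF t] w r close[OF t] True by (intro U2_mono) auto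
      finally show ?thesis using True by simp
    next
      case False
      have "U2 (r / 4) \<le> U2 ?y" using ylow[OF t] r by (intro U2_mono) auto
      then show ?thesis using U2_bound[OF pos[OF t]] e1 False by simp
    qed
    have "g t = ?E t * ((U1 (c t) + (if t \<in> {M..} then - (2 * B1) else 0)) + (U2 (M1.st c t) - \<epsilon>1 + (if t \<in> {R..} then - (B2 - U2 (r / 4)) else 0)))"
      by (simp add: g_def C1.G_def algebra_simps)
    also have "\<dots> \<le> ?E t * (U1 (cM t) + U2 ?y)"
      by (intro mult_left_mono add_mono u1 u2) simp
    finally show ?thesis by (simp add: C2.G_def)
  qed
  have "C1.pay c - ereal \<epsilon> = ereal (integral {0..} (C1.G c) - \<epsilon>)"
    by (simp add: C1.pay_eq ext_integral_eq[OF Gi])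
  also have "\<dots> \<le> ext_integral g" using Ig by (simp add: ext_integral_eq[OF ga])
  also have "\<dots> \<le> C2.pay cM" unfolding C2.pay_eq by (intro ext_integral_mono gle)
  finally show "C1.pay c - ereal \<epsilon> \<le> C2.pay (truncate_strategy M c)" by (simp add: cM_def)
qed

end

context control_system begin

lemma steepness_nonneg: "0 \<le> steepness M"
  unfolding steepness_def using U2_bound[OF init_pos] B1_nonneg init_pos \<rho>_pos by simp

lemma small_tail:
  assumes "0 < e"
  obtains R where "a \<le> R" "k * exp (- \<rho> * R) / \<rho> \<le> e"
proof -
  have "((\<lambda>t. k * exp (- \<rho> * t) / \<rho>) \<longlongrightarrow> k * 0 / \<rho>) at_top"
    using \<rho>_pos by (intro tendsto_intros filterlim_compose[OF exp_at_bot] filterlim_tendsto_neg_mult_at_bot[OF tendsto_const _ filterlim_ident]) auto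
  then have "\<forall>\<^sub>F t in at_top. k * exp (- \<rho> * t) / \<rho> < e"
    using assms by (intro order_tendstoD(2)) auto
  then have "\<forall>\<^sub>F t in at_top. k * exp (- \<rho> * t) / \<rho> < e \<and> a \<le> t"
    using eventually_ge_at_top[of a] by eventually_elim simp
  then obtain R where "k * exp (- \<rho> * R) / \<rho> < e \<and> a \<le> R"
    by (auto simp: eventually_at_top_linorder)
  then show ?thesis using that by force
qed

lemma uniform_transfer:
  assumes \<epsilon>: "0 < \<epsilon>"
  obtains M r R K \<omega> where "0 \<le> M" "0 < r" "r \<le> \<epsilon>" "0 \<le> R" "0 \<le> K" "0 < \<omega>"
    "\<And>D1 D2 c. \<lbrakk>memory_system T C f0 \<eta> A I D1; memory_system T C f0 \<eta> A I D2; close R K \<omega> D1 D2;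
       c \<in> admissible T f0 D1 \<eta>; val T \<rho> f0 U1 U2 D1 \<eta> - ereal r \<le> payoff T \<rho> f0 U1 U2 D1 \<eta> c\<rbrakk>
     \<Longrightarrow> truncate_strategy M c \<in> admissible T f0 D2 \<eta> \<and>
        payoff T \<rho> f0 U1 U2 D1 \<eta> c - ereal \<epsilon> \<le> payoff T \<rho> f0 U1 U2 D2 \<eta> (truncate_strategy M c)"
proof -
  obtain M where M: "0 \<le> M" "2 * B1 * exp (- \<rho> * M) / \<rho> \<le> \<epsilon> / 3"
    using small_tail[of "\<epsilon> / 3" 0 "2 * B1"] \<epsilon> by auto
  have "0 < min (min (fst \<eta> / 4) 1) \<epsilon>" using init_pos \<epsilon> by simp
  then obtain r where r: "0 < r" "r \<le> min (min (fst \<eta> / 4) 1) \<epsilon>" "steepness M / r < U2 (2 * r) - U2 r"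
    using U2_steep[OF _ steepness_nonneg] by blast
  obtain R where R: "M \<le> R" "(B2 - U2 (r / 4)) * exp (- \<rho> * R) / \<rho> \<le> \<epsilon> / 3"
    using small_tail[of "\<epsilon> / 3" M "B2 - U2 (r / 4)"] \<epsilon> by auto
  define \<epsilon>1 where "\<epsilon>1 = \<epsilon> * \<rho> / 3"
  have "0 < \<epsilon>1" using \<epsilon> \<rho>_pos by (simp add: \<epsilon>1_def)
  have "isCont U2 (r / 2)"
    using U2_cont r by (simp add: continuous_on_eq_continuous_at)
  then obtain d where d: "0 < d" "\<And>x. \<bar>x - r / 2\<bar> < d \<Longrightarrow> \<bar>U2 x - U2 (r / 2)\<bar> < \<epsilon>1"
    using \<open>0 < \<epsilon>1\<close> unfolding continuous_at_eps_delta dist_real_def by metis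
  define w where "w = min (d / 2) (r / 4)"
  have w: "0 < w" "w \<le> r / 4" "U2 (r / 2) - U2 (r / 2 - w) \<le> \<epsilon>1"
  proof -
    show "0 < w" "w \<le> r / 4" using d(1) r(1) by (auto simp: w_def)
    then have "\<bar>(r / 2 - w) - r / 2\<bar> < d" using d(1) by (auto simp: w_def)
    then show "U2 (r / 2) - U2 (r / 2 - w) \<le> \<epsilon>1" using d(2)[of "r / 2 - w"] by linarith
  qed
  define \<omega> where "\<omega> = w / (2 * C * exp (2 * L * R) + 1)"
  have den: "0 < 2 * C * exp (2 * L * R) + 1" using C_nonneg by (simp add: add_nonneg_pos)
  have "0 < \<omega>" using w den by (simp add: \<omega>_def)
  have "2 * (C * \<omega>) * exp (2 * L * R) \<le> (2 * C * exp (2 * L * R) + 1) * \<omega>"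
    using \<open>0 < \<omega>\<close> by (simp add: algebra_simps)
  also have "\<dots> = w" using den by (simp add: \<omega>_def)
  finally have w': "2 * (C * \<omega>) * exp (2 * L * R) \<le> w" .
  have sum: "\<epsilon>1 / \<rho> + 2 * B1 * exp (- \<rho> * M) / \<rho> + (B2 - U2 (r / 4)) * exp (- \<rho> * R) / \<rho> \<le> \<epsilon>"
  proof -
    have "\<epsilon>1 / \<rho> = \<epsilon> / 3" using \<rho>_pos by (simp add: \<epsilon>1_def)
    then show ?thesis using M(2) R(2) by linarith
  qed
  let ?K = "drift_bound R (drift_bound M 0) + drift_bound M 0"
  have vn: "0 \<le> drift_bound b k" if "0 \<le> b" "0 \<le> k" for b k
    unfolding drift_bound_def using that data_bound_nonneg state_bound_nonneg by simp
  show ?thesis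
  proof (rule that[of M r R ?K \<omega>])
    show "0 \<le> ?K" using vn M R by simp
    fix D1 D2 c
    assume m: "memory_system T C f0 \<eta> A I D1" "memory_system T C f0 \<eta> A I D2" and cl: "close R ?K \<omega> D1 D2"
      and c: "c \<in> admissible T f0 D1 \<eta>" "val T \<rho> f0 U1 U2 D1 \<eta> - ereal r \<le> payoff T \<rho> f0 U1 U2 D1 \<eta> c"
    interpret X: two_controls T C f0 \<eta> A I D1 D2 \<rho> U1 U2 B1 B2
      using m utility_axioms by (simp add: two_controls_def two_memories_def)
    show "truncate_strategy M c \<in> admissible T f0 D2 \<eta> \<and>
        payoff T \<rho> f0 U1 U2 D1 \<eta> c - ereal \<epsilon> \<le> payoff T \<rho> f0 U1 U2 D2 \<eta> (truncate_strategy M c)"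
      using X.transfer[OF M(1) R(1) r(1) _ _ r(3) cl w' w(2,3) sum c] r(2) by simp
  qed (use M r R \<open>0 < \<omega>\<close> in auto)
qed

end

section \<open>Kernel memories and the pointwise delay\<close>

lemma AE_lebesgue_translate:
  fixes P :: "real \<Rightarrow> bool"
  assumes "AE x in lebesgue. P x"
  shows "AE x in lebesgue. P (c + x)"
proof -
  obtain N where N: "{x. \<not> P x} \<subseteq> N" "N \<in> null_sets lebesgue"
    using assms by (auto simp: eventually_ae_filter)
  have "{x. \<not> P (c + x)} \<subseteq> (+) (- c) ` N"
  proof
    fix x assume "x \<in> {x. \<not> P (c + x)}"
    then have "c + x \<in> N" using N by auto
    then have "(- c) + (c + x) \<in> (+) (- c) ` N" by (rule imageI)
    then show "x \<in> (+) (- c) ` N" by simp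
  qed
  moreover have "(+) (- c) ` N \<in> null_sets lebesgue"
    using N(2) negligible_translation[of N "- c"] by (simp add: negligible_iff_null_sets)
  ultimately show ?thesis by (auto simp: eventually_ae_filter)
qed

lemma absolutely_integrable_shift:
  fixes f :: "real \<Rightarrow> real"
  assumes "f absolutely_integrable_on {a + c..b + c}"
  shows "(\<lambda>x. f (c + x)) absolutely_integrable_on {a..b}"
  using assms integrable_on_shift_Icc_real[of f c a b] integrable_on_shift_Icc_real[of "\<lambda>x. norm (f x)" c a b]
  by (simp add: absolutely_integrable_on_def o_def)

lemma integral_shift:
  fixes f :: "real \<Rightarrow> real"
  shows "integral {a..b} (\<lambda>x. f (c + x)) = integral {a + c..b + c} f"
  using integral_shift_Icc_real[of a b f c] by (simp add: o_def)

lemma absolutely_integrable_borel_version: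
  fixes p :: "real \<Rightarrow> real"
  assumes p: "p absolutely_integrable_on {a..b}"
  shows "\<exists>q\<in>borel_measurable borel. (AE t in lebesgue. t \<in> {a..b} \<longrightarrow> p t = q t) \<and>
    (\<forall>c d. q absolutely_integrable_on {c..d})"
proof -
  let ?z = "\<lambda>t. indicator {a..b} t *\<^sub>R p t"
  have iz: "integrable lebesgue ?z" using p by (simp add: set_integrable_def)
  obtain q0 where q0: "q0 \<in> borel_measurable lborel" "AE t in lborel. ?z t = q0 t"
    using completion_ex_borel_measurable_real[OF borel_measurable_integrable[OF iz]] by blast
  define q where "q t = indicator {a..b} t * q0 t" for t
  have qm: "q \<in> borel_measurable borel" using q0(1) unfolding q_def by simp
  have ae: "AE t in lebesgue. ?z t = q t"
    using AE_completion[OF q0(2)]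
  proof eventually_elim
    case (elim t)
    then show ?case by (cases "t \<in> {a..b}") (auto simp: q_def)
  qed
  have "integrable lebesgue q"
  proof (rule integrable_cong_AE_imp[OF iz])
    show "q \<in> borel_measurable lebesgue" using qm by (simp add: measurable_completion)
    show "AE t in lebesgue. ?z t = q t" by (rule ae)
  qed
  then have "q absolutely_integrable_on UNIV" by (simp add: set_integrable_def)
  then have "q absolutely_integrable_on {c..d}" for c d by (rule set_integrable_subset) auto
  moreover have "AE t in lebesgue. t \<in> {a..b} \<longrightarrow> p t = q t"
    using ae by eventually_elim (auto simp: q_def)
  ultimately show ?thesis using qm by blast
qed

lemma L1_approx_continuous:
  fixes p :: "real \<Rightarrow> real"
  assumes p: "p absolutely_integrable_on {a..b}" and \<delta>: "0 < \<delta>"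
  obtains h where "continuous_on UNIV h" "integral {a..b} (\<lambda>t. \<bar>p t - h t\<bar>) < \<delta>"
proof -
  define cl where "cl k x = max (- k) (min k x)" for k x :: real
  have pm: "p \<in> borel_measurable (lebesgue_on {a..b})"
    by (rule absolutely_integrable_imp_borel_measurable[OF p]) simp
  have ip: "(\<lambda>t. \<bar>p t\<bar>) integrable_on {a..b}"
    using p by (intro integrable_of_absolutely set_integrable_abs)
  have cl_int: "(\<lambda>t. \<bar>p t - cl k (p t)\<bar>) integrable_on {a..b}" if "0 \<le> k" for k
  proof (rule measurable_bounded_by_integrable_imp_integrable[OF _ ip])
    show "(\<lambda>t. \<bar>p t - cl k (p t)\<bar>) \<in> borel_measurable (lebesgue_on {a..b})"
      unfolding cl_def using pm by measurable
  qed (use that in \<open>auto simp: cl_def\<close>)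
  have "(\<lambda>n. integral {a..b} (\<lambda>t. \<bar>p t - cl (real n) (p t)\<bar>)) \<longlonglongrightarrow> integral {a..b} (\<lambda>_. 0)"
  proof (rule dominated_convergence(2)[OF cl_int ip])
    fix t
    obtain N :: nat where N: "\<bar>p t\<bar> \<le> N" using real_arch_simple by blast
    have "\<forall>\<^sub>F n in sequentially. \<bar>p t - cl (real n) (p t)\<bar> = 0"
      unfolding eventually_sequentially using N by (intro exI[of _ N]) (auto simp: cl_def)
    then show "(\<lambda>n. \<bar>p t - cl (real n) (p t)\<bar>) \<longlonglongrightarrow> 0" by (rule tendsto_eventually)
  qed (auto simp: cl_def)
  then have "\<forall>\<^sub>F n in sequentially. integral {a..b} (\<lambda>t. \<bar>p t - cl (real n) (p t)\<bar>) < \<delta> / 2"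
    using \<delta> by (intro order_tendstoD(2)) auto
  then obtain n :: nat where n: "integral {a..b} (\<lambda>t. \<bar>p t - cl (real n) (p t)\<bar>) < \<delta> / 2"
    by (auto simp: eventually_sequentially)
  define k where "k = real n"
  have "p measurable_on {a..b}" using pm by (simp add: measurable_on_iff_borel_measurable)
  then obtain N g where N: "negligible N" and g: "\<And>n. continuous_on UNIV (g n)"
    and lim: "\<And>t. t \<notin> N \<Longrightarrow> (\<lambda>n. g n t) \<longlonglongrightarrow> (if t \<in> {a..b} then p t else 0)"
    unfolding measurable_on_def by blast
  have gm: "g m \<in> borel_measurable (lebesgue_on {a..b})" for m
    by (rule continuous_imp_measurable_on_sets_lebesgue) (auto intro: continuous_on_subset[OF g])
  have d_int: "(\<lambda>t. \<bar>cl k (p t) - cl k (g m t)\<bar>) integrable_on {a..b}" for m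
  proof (rule measurable_bounded_by_integrable_imp_integrable[where g="\<lambda>_. 2 * k"])
    show "(\<lambda>t. \<bar>cl k (p t) - cl k (g m t)\<bar>) \<in> borel_measurable (lebesgue_on {a..b})"
      unfolding cl_def using pm gm by measurable
    show "(\<lambda>_. 2 * k) integrable_on {a..b}" by (rule integrable_const_ivl)
  qed (auto simp: cl_def k_def)
  have d_int': "(\<lambda>t. if t \<in> N then 0 else \<bar>cl k (p t) - cl k (g m t)\<bar>) integrable_on {a..b}" for m
    by (rule integrable_spike[OF d_int N]) simp
  have "(\<lambda>m. integral {a..b} (\<lambda>t. if t \<in> N then 0 else \<bar>cl k (p t) - cl k (g m t)\<bar>)) \<longlonglongrightarrow> integral {a..b} (\<lambda>_. 0)"
  proof (rule dominated_convergence(2)[OF d_int'])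
    show "(\<lambda>_. 2 * k) integrable_on {a..b}" by (rule integrable_const_ivl)
    fix t assume t: "t \<in> {a..b}"
    show "(\<lambda>m. if t \<in> N then 0 else \<bar>cl k (p t) - cl k (g m t)\<bar>) \<longlonglongrightarrow> 0"
    proof (cases "t \<in> N")
      case False
      then have "(\<lambda>m. \<bar>cl k (p t) - cl k (g m t)\<bar>) \<longlonglongrightarrow> \<bar>cl k (p t) - cl k (p t)\<bar>"
        unfolding cl_def using lim[OF False] t by (intro tendsto_intros) auto
      then show ?thesis using False by simp
    qed simp
  qed (auto simp: cl_def k_def)
  then have "\<forall>\<^sub>F m in sequentially. integral {a..b} (\<lambda>t. if t \<in> N then 0 else \<bar>cl k (p t) - cl k (g m t)\<bar>) < \<delta> / 2"
    using \<delta> by (intro order_tendstoD(2)) auto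
  then obtain m where "integral {a..b} (\<lambda>t. if t \<in> N then 0 else \<bar>cl k (p t) - cl k (g m t)\<bar>) < \<delta> / 2"
    by (auto simp: eventually_sequentially)
  then have m: "integral {a..b} (\<lambda>t. \<bar>cl k (p t) - cl k (g m t)\<bar>) < \<delta> / 2"
    by (subst integral_spike[OF N, where g="\<lambda>t. if t \<in> N then 0 else \<bar>cl k (p t) - cl k (g m t)\<bar>"]) auto
  let ?h = "\<lambda>t. cl k (g m t)"
  have "integral {a..b} (\<lambda>t. \<bar>p t - ?h t\<bar>) \<le> integral {a..b} (\<lambda>t. \<bar>p t - cl k (p t)\<bar> + \<bar>cl k (p t) - ?h t\<bar>)"
  proof (rule integral_le)
    show "(\<lambda>t. \<bar>p t - ?h t\<bar>) integrable_on {a..b}"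
    proof (rule measurable_bounded_by_integrable_imp_integrable[where g="\<lambda>t. \<bar>p t - cl k (p t)\<bar> + \<bar>cl k (p t) - ?h t\<bar>"])
      show "(\<lambda>t. \<bar>p t - ?h t\<bar>) \<in> borel_measurable (lebesgue_on {a..b})"
        unfolding cl_def using pm gm by measurable
      show "(\<lambda>t. \<bar>p t - cl k (p t)\<bar> + \<bar>cl k (p t) - ?h t\<bar>) integrable_on {a..b}"
        by (intro integrable_add cl_int d_int) (simp add: k_def)
    qed auto
    show "(\<lambda>t. \<bar>p t - cl k (p t)\<bar> + \<bar>cl k (p t) - ?h t\<bar>) integrable_on {a..b}"
      by (intro integrable_add cl_int d_int) (simp add: k_def)
  qed auto
  also have "\<dots> = integral {a..b} (\<lambda>t. \<bar>p t - cl k (p t)\<bar>) + integral {a..b} (\<lambda>t. \<bar>cl k (p t) - ?h t\<bar>)"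
    by (intro hk_integral_add cl_int d_int) (simp add: k_def)
  also have "\<dots> < \<delta>" using n m by (simp add: k_def)
  finally have "integral {a..b} (\<lambda>t. \<bar>p t - ?h t\<bar>) < \<delta>" .
  moreover have "continuous_on UNIV ?h" unfolding cl_def by (intro continuous_intros g)
  ultimately show ?thesis using that by blast
qed

lemma mono_translation_integral:
  fixes m :: "real \<Rightarrow> real"
  assumes m: "mono m" and bd: "\<And>t. 0 \<le> m t" "\<And>t. m t \<le> k" and pq: "p \<le> q" and ab: "a \<le> b"
  shows "integral {a..b} (\<lambda>s. \<bar>m (q + s) - m (p + s)\<bar>) \<le> k * (q - p)"
proof -
  have im: "m integrable_on {c..d}" for c d
    using m by (intro integrable_on_mono_on) (auto simp: mono_on_def mono_def)
  have ims: "(\<lambda>s. m (c + s)) integrable_on {a..b}" for c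
    using im integrable_on_shift_Icc_real[of m c a b] by (simp add: o_def)
  have "integral {a..b} (\<lambda>s. \<bar>m (q + s) - m (p + s)\<bar>) = integral {a..b} (\<lambda>s. m (q + s) - m (p + s))"
    using m pq by (intro integral_cong) (simp add: mono_def)
  also have "\<dots> = integral {a + q..b + q} m - integral {a + p..b + p} m"
    by (simp add: hk_integral_diff ims integral_shift)
  also have "\<dots> = integral {b + p..b + q} m - integral {a + p..a + q} m"
  proof -
    have "integral {a + p..a + q} m + integral {a + q..b + q} m = integral {a + p..b + q} m"
      using pq ab by (intro hk_integral_combine im) auto
    moreover have "integral {a + p..b + p} m + integral {b + p..b + q} m = integral {a + p..b + q} m"
      using pq ab by (intro hk_integral_combine im) auto
    ultimately show ?thesis by linarith
  qed
  also have "\<dots> \<le> integral {b + p..b + q} (\<lambda>_. k)"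
  proof -
    have "0 \<le> integral {a + p..a + q} m" using bd by (intro hk_integral_nonneg im) auto
    moreover have "integral {b + p..b + q} m \<le> integral {b + p..b + q} (\<lambda>_. k)" using bd by (intro integral_le im) auto
    ultimately show ?thesis by linarith
  qed
  finally show ?thesis using pq by (simp add: mult.commute)
qed

locale nonneg_kernel =
  fixes T :: real and a :: "real \<Rightarrow> real" and A :: real
  assumes T_pos: "0 < T" and a_cont: "continuous_on {-T..0} a"
    and a_nonneg: "\<And>\<xi>. \<xi> \<in> {-T..0} \<Longrightarrow> 0 \<le> a \<xi>"
    and a_mass: "integral {-T..0} a \<le> A"
begin

lemma smear_bound:
  fixes h :: "real \<Rightarrow> real \<Rightarrow> real"
  assumes h: "(\<lambda>(s, \<xi>). h s \<xi>) \<in> borel_measurable (borel \<Otimes>\<^sub>M borel)"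
    and hi: "\<And>\<xi>. \<xi> \<in> {-T..0} \<Longrightarrow> (\<lambda>s. h s \<xi>) absolutely_integrable_on {p..q}"
    and hb: "\<And>\<xi>. \<xi> \<in> {-T..0} \<Longrightarrow> integral {p..q} (\<lambda>s. \<bar>h s \<xi>\<bar>) \<le> \<beta> \<xi>"
    and \<beta>: "continuous_on {-T..0} \<beta>"
  shows "(\<lambda>s. LINT \<xi>:{-T..0}|lebesgue. a \<xi> * h s \<xi>) absolutely_integrable_on {p..q}"
    and "integral {p..q} (\<lambda>s. \<bar>LINT \<xi>:{-T..0}|lebesgue. a \<xi> * h s \<xi>\<bar>) \<le> integral {-T..0} (\<lambda>\<xi>. a \<xi> * \<beta> \<xi>)"
proof -
  define a' where "a' \<xi> = indicator {-T..0} \<xi> * a \<xi>" for \<xi>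
  have a'm [measurable]: "a' \<in> borel_measurable borel"
    using borel_measurable_continuous_on_indicator[OF _ a_cont] by (simp add: a'_def[abs_def])
  have a'0: "0 \<le> a' \<xi>" for \<xi> using a_nonneg by (simp add: a'_def indicator_def)
  have hm [measurable]: "case_prod h \<in> borel_measurable (borel \<Otimes>\<^sub>M borel)" using h by (simp add: case_prod_beta')
  define f where "f = (\<lambda>(s, \<xi>). indicator {p..q} s * (a' \<xi> * h s \<xi>))"
  have fb [measurable]: "f \<in> borel_measurable (borel \<Otimes>\<^sub>M borel)"
    unfolding f_def by measurable
  have fm: "f \<in> borel_measurable (lborel \<Otimes>\<^sub>M lborel)" by measurable
  let ?B = "integral {-T..0} (\<lambda>\<xi>. a \<xi> * \<beta> \<xi>)"
  have ab: "(\<lambda>\<xi>. a \<xi> * \<beta> \<xi>) absolutely_integrable_on {-T..0}"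
    by (intro absolutely_integrable_continuous_real continuous_intros a_cont \<beta>)
  have \<beta>0: "0 \<le> \<beta> \<xi>" if "\<xi> \<in> {-T..0}" for \<xi>
    using hb[OF that] hk_integral_nonneg[OF integrable_of_absolutely[OF set_integrable_abs[OF hi[OF that]]]] by simp
  have B: "(\<integral>\<^sup>+ \<xi>. ennreal (indicator {-T..0} \<xi> * (a \<xi> * \<beta> \<xi>)) \<partial>lborel) = ennreal ?B"
  proof -
    have "(\<integral>\<^sup>+ \<xi>. ennreal (indicator {-T..0} \<xi> * (a \<xi> * \<beta> \<xi>)) \<partial>lebesgue) = ennreal (LINT \<xi>|lebesgue. indicator {-T..0} \<xi> * (a \<xi> * \<beta> \<xi>))"
      using ab a_nonneg \<beta>0 by (intro nn_integral_eq_integral) (auto simp: set_integrable_def indicator_def)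
    also have "(LINT \<xi>|lebesgue. indicator {-T..0} \<xi> * (a \<xi> * \<beta> \<xi>)) = ?B"
      using set_lebesgue_integral_eq_integral(2)[OF ab] by (simp add: set_lebesgue_integral_def)
    finally show ?thesis by (simp add: nn_integral_completion)
  qed
  have inner: "(\<integral>\<^sup>+ s. ennreal (norm (f (s, \<xi>))) \<partial>lborel) \<le> ennreal (indicator {-T..0} \<xi> * (a \<xi> * \<beta> \<xi>))" for \<xi>
  proof (cases "\<xi> \<in> {-T..0}")
    case True
    have i: "integrable lebesgue (\<lambda>s. indicator {p..q} s *\<^sub>R \<bar>h s \<xi>\<bar>)"
      using set_integrable_abs[OF hi[OF True]] by (simp add: set_integrable_def)
    have "(\<integral>\<^sup>+ s. ennreal (norm (f (s, \<xi>))) \<partial>lborel) = (\<integral>\<^sup>+ s. ennreal (a \<xi> * (indicator {p..q} s *\<^sub>R \<bar>h s \<xi>\<bar>)) \<partial>lebesgue)"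
      using True a_nonneg[OF True]
      by (simp add: nn_integral_completion f_def a'_def abs_mult mult.left_commute)
    also have "\<dots> = ennreal (LINT s|lebesgue. a \<xi> * (indicator {p..q} s *\<^sub>R \<bar>h s \<xi>\<bar>))"
      using i a_nonneg[OF True] by (intro nn_integral_eq_integral integrable_mult_right) auto
    also have "(LINT s|lebesgue. a \<xi> * (indicator {p..q} s *\<^sub>R \<bar>h s \<xi>\<bar>)) = a \<xi> * integral {p..q} (\<lambda>s. \<bar>h s \<xi>\<bar>)"
      using set_lebesgue_integral_eq_integral(2)[OF set_integrable_abs[OF hi[OF True]]]
      by (simp add: set_lebesgue_integral_def)
    also have "\<dots> \<le> a \<xi> * \<beta> \<xi>" using hb[OF True] a_nonneg[OF True] by (rule mult_left_mono)
    finally show ?thesis using True by (simp add: ennreal_leI)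
  qed (simp add: f_def a'_def)
  have nn: "(\<integral>\<^sup>+ z. ennreal (norm (f z)) \<partial>(lborel \<Otimes>\<^sub>M lborel)) \<le> ennreal ?B"
  proof -
    have "(\<integral>\<^sup>+ z. ennreal (norm (f z)) \<partial>(lborel \<Otimes>\<^sub>M lborel)) = (\<integral>\<^sup>+ \<xi>. (\<integral>\<^sup>+ s. ennreal (norm (f (s, \<xi>))) \<partial>lborel) \<partial>lborel)"
      by (intro lborel_pair.nn_integral_snd[symmetric]) measurable
    also have "\<dots> \<le> ennreal ?B" unfolding B[symmetric] by (intro nn_integral_mono inner)
    finally show ?thesis .
  qed
  have fi: "integrable (lborel \<Otimes>\<^sub>M lborel) f"
    by (rule integrableI_bounded[OF fm]) (use nn in \<open>auto intro: le_less_trans\<close>)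
  define g where "g s = (LINT \<xi>|lborel. f (s, \<xi>))" for s
  have gi: "integrable lborel g" unfolding g_def by (rule lborel_pair.integrable_fst'[OF fi])
  have g_eq: "g s = indicator {p..q} s *\<^sub>R (LINT \<xi>:{-T..0}|lebesgue. a \<xi> * h s \<xi>)" for s
  proof -
    have "g s = indicator {p..q} s * (LINT \<xi>|lborel. a' \<xi> * h s \<xi>)"
      by (simp add: g_def f_def)
    also have "(LINT \<xi>|lborel. a' \<xi> * h s \<xi>) = (LINT \<xi>|lebesgue. a' \<xi> * h s \<xi>)"
      by (rule integral_completion[symmetric]) measurable
    also have "\<dots> = (LINT \<xi>:{-T..0}|lebesgue. a \<xi> * h s \<xi>)"
      by (simp add: set_lebesgue_integral_def a'_def mult.assoc)
    finally show ?thesis by simp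
  qed
  have gi': "integrable lebesgue g" using gi by (simp add: integrable_completion)
  then show ai: "(\<lambda>s. LINT \<xi>:{-T..0}|lebesgue. a \<xi> * h s \<xi>) absolutely_integrable_on {p..q}"
    unfolding set_integrable_def g_eq[symmetric] .
  have "integral {p..q} (\<lambda>s. \<bar>LINT \<xi>:{-T..0}|lebesgue. a \<xi> * h s \<xi>\<bar>) = (LINT s:{p..q}|lebesgue. \<bar>LINT \<xi>:{-T..0}|lebesgue. a \<xi> * h s \<xi>\<bar>)"
    by (rule set_lebesgue_integral_eq_integral(2)[symmetric, OF set_integrable_abs[OF ai]])
  also have "\<dots> = (LINT s|lebesgue. \<bar>g s\<bar>)"
    unfolding set_lebesgue_integral_def g_eq by (intro Bochner_Integration.integral_cong) (auto simp: indicator_def)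
  also have "\<dots> \<le> ?B"
  proof -
    have "ennreal (LINT s|lebesgue. \<bar>g s\<bar>) = (\<integral>\<^sup>+ s. ennreal \<bar>g s\<bar> \<partial>lebesgue)"
      using gi' by (intro nn_integral_eq_integral[symmetric]) auto
    also have "\<dots> = (\<integral>\<^sup>+ s. ennreal (norm (g s)) \<partial>lborel)" by (simp add: nn_integral_completion)
    also have "\<dots> \<le> (\<integral>\<^sup>+ s. (\<integral>\<^sup>+ \<xi>. ennreal (norm (f (s, \<xi>))) \<partial>lborel) \<partial>lborel)"
    proof (rule nn_integral_mono)
      fix s
      show "ennreal (norm (g s)) \<le> (\<integral>\<^sup>+ \<xi>. ennreal (norm (f (s, \<xi>))) \<partial>lborel)"
        unfolding g_def using integral_norm_bound_ennreal[of lborel "\<lambda>\<xi>. f (s, \<xi>)"]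
        by (cases "integrable lborel (\<lambda>\<xi>. f (s, \<xi>))") (auto simp: not_integrable_integral_eq)
    qed
    also have "\<dots> = (\<integral>\<^sup>+ z. ennreal (norm (f z)) \<partial>(lborel \<Otimes>\<^sub>M lborel))"
      by (intro lborel.nn_integral_fst) measurable
    finally have "ennreal (LINT s|lebesgue. \<bar>g s\<bar>) \<le> ennreal ?B" using nn by simp
    moreover have "0 \<le> ?B"
      using a_nonneg \<beta>0 by (intro hk_integral_nonneg integrable_of_absolutely[OF ab]) auto
    ultimately show ?thesis by simp
  qed
  finally show "integral {p..q} (\<lambda>s. \<bar>LINT \<xi>:{-T..0}|lebesgue. a \<xi> * h s \<xi>\<bar>) \<le> ?B" .
qed

end

lemma integral_cong_AE_on:
  fixes f g :: "real \<Rightarrow> real"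
  assumes "f absolutely_integrable_on S" "g absolutely_integrable_on S"
    and "AE r in lebesgue. r \<in> S \<longrightarrow> f r = g r"
  shows "integral S f = integral S g"
proof (rule antisym)
  show "integral S f \<le> integral S g"
    using assms(3) by (intro integral_le_AE assms(1,2)) (auto elim: eventually_mono)
  show "integral S g \<le> integral S f"
    using assms(3) by (intro integral_le_AE assms(1,2)) (auto elim: eventually_mono)
qed

lemma mono_translation_integral_abs:
  fixes m :: "real \<Rightarrow> real"
  assumes "mono m" "\<And>t. 0 \<le> m t" "\<And>t. m t \<le> k" "a \<le> b"
  shows "integral {a..b} (\<lambda>s. \<bar>m (q + s) - m (p + s)\<bar>) \<le> k * \<bar>q - p\<bar>"
  using mono_translation_integral[OF assms(1-3), of p q a b] mono_translation_integral[OF assms(1-3), of q p a b] assms(4)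
  by (cases "p \<le> q") (auto simp: abs_minus_commute)

lemma AE_lebesgue_neq: "AE t in lebesgue. t \<noteq> (x :: real)"
  using AE_completion[OF AE_lborel_singleton[of x]] .

locale delay_data = delay_system +
  assumes data: "\<eta> \<in> H_plusplus T"
begin

definition past_energy :: real where "past_energy = integral UNIV (\<lambda>t. (past t)\<^sup>2)"

lemma
  assumes S: "S \<in> sets lebesgue"
  shows past_sq_integrable: "(\<lambda>t. (past t)\<^sup>2) absolutely_integrable_on S"
    and past_absolutely_integrable: "past absolutely_integrable_on S"
proof -
  let ?I = "{-T..0}"
  have sq: "(\<lambda>t. (snd \<eta> t)\<^sup>2) absolutely_integrable_on ?I" and m: "set_borel_measurable lebesgue ?I (snd \<eta>)"
    using data by (auto simp: H_plusplus_def L2_def)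
  have z: "AE t in lebesgue. t \<noteq> (0::real)" by (rule AE_lebesgue_neq)
  have m': "(\<lambda>t. indicator ?I t *\<^sub>R snd \<eta> t) \<in> borel_measurable lebesgue"
    using m by (simp add: set_borel_measurable_def)
  have peq: "past = (\<lambda>t. indicator {..<0} t * (indicator ?I t *\<^sub>R snd \<eta> t))"
    by (auto simp: past_def indicator_def)
  have pm: "past \<in> borel_measurable lebesgue"
    unfolding peq by (intro borel_measurable_times borel_measurable_indicator m') auto
  have i2: "integrable lebesgue (\<lambda>t. (past t)\<^sup>2)"
  proof (rule integrable_cong_AE_imp)
    show "integrable lebesgue (\<lambda>t. indicator ?I t *\<^sub>R (snd \<eta> t)\<^sup>2)" using sq by (simp add: set_integrable_def)
    show "(\<lambda>t. (past t)\<^sup>2) \<in> borel_measurable lebesgue" using pm by measurable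
    show "AE t in lebesgue. indicator ?I t *\<^sub>R (snd \<eta> t)\<^sup>2 = (past t)\<^sup>2"
      using z by eventually_elim (auto simp: past_def indicator_def)
  qed
  have "integrable lebesgue (\<lambda>t. indicator ?I t *\<^sub>R (1::real))"
    using absolutely_integrable_continuous_real[OF continuous_on_const, of "-T" 0 "1::real"]
    by (simp add: set_integrable_def)
  then have b: "integrable lebesgue (\<lambda>t. indicator ?I t *\<^sub>R (1::real) + (past t)\<^sup>2)"
    using i2 by (rule Bochner_Integration.integrable_add)
  have i1: "integrable lebesgue past"
  proof (rule Bochner_Integration.integrable_bound[OF b pm], rule AE_I2)
    fix t
    have "\<bar>past t\<bar> \<le> 1 + (past t)\<^sup>2"
      using zero_le_power2[of "\<bar>past t\<bar> - 1"] zero_le_power2[of "past t"] by (auto simp: power2_eq_square algebra_simps)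
    then show "norm (past t) \<le> norm (indicator ?I t *\<^sub>R (1::real) + (past t)\<^sup>2)"
      by (auto simp: past_def indicator_def)
  qed
  show "(\<lambda>t. (past t)\<^sup>2) absolutely_integrable_on S"
    unfolding set_integrable_def by (rule integrable_mult_indicator[OF S i2])
  show "past absolutely_integrable_on S"
    unfolding set_integrable_def by (rule integrable_mult_indicator[OF S i1])
qed

lemma past_nonneg_AE: "AE t in lebesgue. 0 \<le> past t"
proof -
  have "AE t in lebesgue. t \<in> {-T..0} \<longrightarrow> 0 \<le> snd \<eta> t"
    using data by (auto simp: H_plusplus_def)
  then show ?thesis by eventually_elim (auto simp: past_def)
qed

lemma past_energy_nonneg: "0 \<le> past_energy"
  unfolding past_energy_def by (intro hk_integral_nonneg integrable_of_absolutely[OF past_sq_integrable]) auto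

lemma traj_absolutely_integrable:
  assumes "traj x"
  shows "x absolutely_integrable_on {c..d}"
proof -
  have "x absolutely_integrable_on ({0..} \<inter> {c..d})"
    using traj_cont[OF assms, of "max 0 c" d] 
    by (cases "0 \<le> c") (auto simp: Int_atLeastAtMostR2 max_def intro!: absolutely_integrable_continuous_real)
  then have "(\<lambda>t. past t + (if t \<in> {0..} then x t else 0)) absolutely_integrable_on {c..d}"
    by (intro set_integral_add absolutely_integrable_if past_absolutely_integrable) auto
  moreover have "(\<lambda>t. past t + (if t \<in> {0..} then x t else 0)) = x"
    using assms by (auto simp: traj_iff past_def)
  ultimately show ?thesis by simp
qed

text \<open>From \<open>2 \<bar>x\<bar> \<le> l x\<^sup>2 + 1 / l\<close> with \<open>l = sqrt (q - p)\<close>.\<close>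

lemma past_window:
  assumes "p \<le> q"
  shows "integral {p..q} (\<lambda>s. \<bar>past (\<xi> + s)\<bar>) \<le> (past_energy + 1) / 2 * sqrt (q - p)"
proof (cases "p = q")
  case False
  then have pq: "0 < q - p" using assms by simp
  define l where "l = sqrt (q - p)"
  have l: "0 < l" "l * l = q - p" using pq by (auto simp: l_def)
  have i: "(\<lambda>s. \<bar>past (\<xi> + s)\<bar>) integrable_on {p..q}"
    by (intro integrable_of_absolutely set_integrable_abs absolutely_integrable_shift past_absolutely_integrable) auto
  have i2: "(\<lambda>s. (past (\<xi> + s))\<^sup>2) integrable_on {p..q}"
    by (rule integrable_of_absolutely[OF absolutely_integrable_shift[where f = "\<lambda>s. (past s)\<^sup>2"]], rule past_sq_integrable) auto
  have "integral {p..q} (\<lambda>s. \<bar>past (\<xi> + s)\<bar>) \<le> integral {p..q} (\<lambda>s. l / 2 * (past (\<xi> + s))\<^sup>2 + 1 / (2 * l))"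
  proof (rule integral_le[OF i])
    show "(\<lambda>s. l / 2 * (past (\<xi> + s))\<^sup>2 + 1 / (2 * l)) integrable_on {p..q}"
      by (intro integrable_add integrable_on_mult_right i2 integrable_const_ivl)
    fix s
    let ?x = "\<bar>past (\<xi> + s)\<bar>"
    have "2 * l * ?x \<le> l * l * (?x * ?x) + 1"
      using zero_le_power2[of "l * ?x - 1"] by (simp add: power2_eq_square algebra_simps)
    then have "2 * l * ?x / (2 * l) \<le> (l * l * (?x * ?x) + 1) / (2 * l)"
      using l by (intro divide_right_mono) auto
    then show "?x \<le> l / 2 * (past (\<xi> + s))\<^sup>2 + 1 / (2 * l)"
      using l(1) by (simp add: add_divide_distrib power2_eq_square)
  qed
  also have "\<dots> = integral {p..q} (\<lambda>s. l / 2 * (past (\<xi> + s))\<^sup>2) + integral {p..q} (\<lambda>_. 1 / (2 * l))"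
    by (intro hk_integral_add integrable_on_mult_right i2 integrable_const_ivl)
  also have "\<dots> = l / 2 * integral {p..q} (\<lambda>s. (past (\<xi> + s))\<^sup>2) + (q - p) / (2 * l)"
    using assms by simp
  also have "integral {p..q} (\<lambda>s. (past (\<xi> + s))\<^sup>2) = integral {p + \<xi>..q + \<xi>} (\<lambda>s. (past s)\<^sup>2)"
    by (rule integral_shift)
  also have "l / 2 * \<dots> \<le> l / 2 * past_energy"
    unfolding past_energy_def using l
    by (intro mult_left_mono integral_subset_le integrable_of_absolutely[OF past_sq_integrable]) auto
  also have "(q - p) / (2 * l) = l / 2" using l by (simp flip: l(2))
  finally show ?thesis by (simp add: l_def[symmetric] field_simps)
qed simp

lemma point_memory_system:
  assumes A: "1 \<le> A"
  shows "memory_system T C f0 \<eta> A (A * ((past_energy + 1) / 2)) (point_memory T)"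
proof
  have D: "point_memory T x = (\<lambda>t. x (- T / 2 + t))" for x by (auto simp: point_memory_def)
  show "1 \<le> A" "0 \<le> A * ((past_energy + 1) / 2)" using A past_energy_nonneg by auto
  fix x y t B \<theta>
  show "point_memory T x absolutely_integrable_on {p..q}" if "traj x" for p q
    unfolding D by (intro absolutely_integrable_shift traj_absolutely_integrable that)
  show "point_memory T x t - point_memory T y t \<le> A * B"
    if "traj x" "traj y" "0 \<le> t" "0 \<le> B" "\<And>s. 0 \<le> s \<Longrightarrow> s \<le> t \<Longrightarrow> x s - y s \<le> B"
  proof -
    have "x (t - T / 2) - y (t - T / 2) \<le> B"
    proof (cases "0 \<le> t - T / 2")
      case False
      then show ?thesis using that(1,2,4) by (simp add: traj_iff)
    qed (use that(5)[of "t - T / 2"] T_pos in auto)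
    also have "1 * B \<le> A * B" using A that(4) by (intro mult_right_mono) auto
    finally show ?thesis by (simp add: point_memory_def)
  qed
  show "point_memory T (\<lambda>s. (1 - \<theta>) * x s + \<theta> * y s) t = (1 - \<theta>) * point_memory T x t + \<theta> * point_memory T y t"
    by (simp add: point_memory_def)
  show "AE t in lebesgue. 0 \<le> t \<longrightarrow> 0 \<le> point_memory T past t"
    using AE_lebesgue_translate[OF past_nonneg_AE, of "- T / 2"] unfolding D by eventually_elim simp
  fix s t :: real assume "0 \<le> s" "s \<le> t"
  have "integral {s..t} (\<lambda>r. \<bar>point_memory T past r\<bar>) \<le> 1 * ((past_energy + 1) / 2 * sqrt (t - s))"
    unfolding D using past_window[OF \<open>s \<le> t\<close>, of "- T / 2"] by simp
  also have "\<dots> \<le> A * ((past_energy + 1) / 2 * sqrt (t - s))"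
    using A past_energy_nonneg \<open>s \<le> t\<close> by (intro mult_right_mono) auto
  finally show "integral {s..t} (\<lambda>r. \<bar>point_memory T past r\<bar>) \<le> A * ((past_energy + 1) / 2) * sqrt (t - s)" by simp
qed

end

context nonneg_kernel begin

abbreviation "KM \<equiv> kernel_memory T a"

lemma kernel_integrable:
  assumes "x absolutely_integrable_on {s - T..s}"
  shows "(\<lambda>\<xi>. a \<xi> * x (s + \<xi>)) absolutely_integrable_on {-T..0}"
proof (rule absolutely_integrable_bounded_measurable_product_real)
  show "a \<in> borel_measurable (lebesgue_on {-T..0})"
    by (intro continuous_imp_measurable_on_sets_lebesgue a_cont) auto
  show "bounded (a ` {-T..0})"
    by (intro compact_imp_bounded compact_continuous_image a_cont) auto
  show "(\<lambda>\<xi>. x (s + \<xi>)) absolutely_integrable_on {-T..0}"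
    using assms by (intro absolutely_integrable_shift) (simp add: add.commute)
qed auto

lemma a_integrable: "a absolutely_integrable_on {-T..0}"
  by (intro absolutely_integrable_continuous_real a_cont)

lemma KM_eq:
  assumes "x absolutely_integrable_on {s - T..s}"
  shows "KM x s = integral {-T..0} (\<lambda>\<xi>. a \<xi> * x (s + \<xi>))"
  unfolding kernel_memory_def by (rule set_lebesgue_integral_eq_integral(2)[OF kernel_integrable[OF assms]])

lemma KM_cong:
  assumes x: "x absolutely_integrable_on {s - T..s}" and y: "y absolutely_integrable_on {s - T..s}"
    and ae: "AE t in lebesgue. t \<in> {s - T..s} \<longrightarrow> x t = y t"
  shows "KM x s = KM y s"
  unfolding KM_eq[OF x] KM_eq[OF y]
proof (rule integral_cong_AE_on[OF kernel_integrable[OF x] kernel_integrable[OF y]])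
  show "AE \<xi> in lebesgue. \<xi> \<in> {-T..0} \<longrightarrow> a \<xi> * x (s + \<xi>) = a \<xi> * y (s + \<xi>)"
    using AE_lebesgue_translate[OF ae, of s] by eventually_elim auto
qed

lemma KM_add:
  assumes x: "x absolutely_integrable_on {s - T..s}" and y: "y absolutely_integrable_on {s - T..s}"
  shows "KM (\<lambda>t. x t + y t) s = KM x s + KM y s"
proof -
  have "KM (\<lambda>t. x t + y t) s = integral {-T..0} (\<lambda>\<xi>. a \<xi> * x (s + \<xi>) + a \<xi> * y (s + \<xi>))"
    by (simp add: KM_eq[OF set_integral_add(1)[OF x y]] distrib_left)
  also have "\<dots> = KM x s + KM y s" unfolding KM_eq[OF x] KM_eq[OF y]
    by (intro hk_integral_add integrable_of_absolutely kernel_integrable x y)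
  finally show ?thesis .
qed

lemma KM_scale: "KM (\<lambda>t. c * x t) s = c * KM x s"
proof -
  have "KM (\<lambda>t. c * x t) s = (LINT \<xi>:{-T..0}|lebesgue. c * (a \<xi> * x (s + \<xi>)))"
    by (simp add: kernel_memory_def mult.left_commute)
  then show ?thesis by (simp add: kernel_memory_def)
qed

lemma mass_mult_le: "0 \<le> B \<Longrightarrow> integral {-T..0} (\<lambda>\<xi>. a \<xi> * B) \<le> A * B"
  using a_mass by (simp add: mult_right_mono)

lemma KM_L1_bound:
  assumes x: "\<And>c d. x absolutely_integrable_on {c..d}" and pq: "0 \<le> p"
    and b: "\<And>\<xi>. \<xi> \<in> {-T..0} \<Longrightarrow> integral {p..q} (\<lambda>s. \<bar>x (\<xi> + s)\<bar>) \<le> b"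
  shows "KM x absolutely_integrable_on {p..q}" "integral {p..q} (\<lambda>s. \<bar>KM x s\<bar>) \<le> integral {-T..0} (\<lambda>\<xi>. a \<xi> * b)"
proof -
  obtain y where ym: "y \<in> borel_measurable borel" and ae: "AE t in lebesgue. t \<in> {p - T..q} \<longrightarrow> x t = y t"
    and yi: "\<And>c d. y absolutely_integrable_on {c..d}"
    using absolutely_integrable_borel_version[OF x[of "p - T" q]] by blast
  have eq: "KM x s = KM y s" if "s \<in> {p..q}" for s
  proof (rule KM_cong[OF x yi])
    show "AE t in lebesgue. t \<in> {s - T..s} \<longrightarrow> x t = y t"
      using ae by eventually_elim (use that in auto)
  qed
  have hb: "integral {p..q} (\<lambda>s. \<bar>y (s + \<xi>)\<bar>) \<le> b" if \<xi>: "\<xi> \<in> {-T..0}" for \<xi>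
  proof -
    have "integral {p..q} (\<lambda>s. \<bar>y (\<xi> + s)\<bar>) = integral {p..q} (\<lambda>s. \<bar>x (\<xi> + s)\<bar>)"
    proof (rule integral_cong_AE_on)
      show "(\<lambda>s. \<bar>y (\<xi> + s)\<bar>) absolutely_integrable_on {p..q}" "(\<lambda>s. \<bar>x (\<xi> + s)\<bar>) absolutely_integrable_on {p..q}"
        by (intro set_integrable_abs absolutely_integrable_shift x yi)+
      show "AE s in lebesgue. s \<in> {p..q} \<longrightarrow> \<bar>y (\<xi> + s)\<bar> = \<bar>x (\<xi> + s)\<bar>"
        using AE_lebesgue_translate[OF ae, of \<xi>] by eventually_elim (use \<xi> in auto)
    qed
    then show ?thesis using b[OF \<xi>] by (simp add: add.commute)
  qed
  have hi: "(\<lambda>s. y (s + \<xi>)) absolutely_integrable_on {p..q}" for \<xi>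
    using absolutely_integrable_shift[OF yi, of p q \<xi>] by (simp add: add.commute)
  have hm: "(\<lambda>(s, \<xi>). y (s + \<xi>)) \<in> borel_measurable (borel \<Otimes>\<^sub>M borel)"
    using ym by measurable
  note sb = smear_bound[OF hm hi hb continuous_on_const, folded kernel_memory_def]
  show "KM x absolutely_integrable_on {p..q}"
    using sb(1) by (rule set_integrable_cong[THEN iffD1, rotated 3]) (auto simp: eq)
  have "integral {p..q} (\<lambda>s. \<bar>KM x s\<bar>) = integral {p..q} (\<lambda>s. \<bar>KM y s\<bar>)"
    by (intro integral_cong) (simp add: eq)
  then show "integral {p..q} (\<lambda>s. \<bar>KM x s\<bar>) \<le> integral {-T..0} (\<lambda>\<xi>. a \<xi> * b)" using sb(2) by simp
qed

lemma KM_memory_system: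
  assumes d: "delay_data T C f0 \<eta>" and A: "1 \<le> A"
  shows "memory_system T C f0 \<eta> A (A * ((delay_data.past_energy T \<eta> + 1) / 2)) KM"
proof -
  interpret delay_data T C f0 \<eta> by (rule d)
  show ?thesis
  proof
    show "1 \<le> A" "0 \<le> A * ((past_energy + 1) / 2)" using A past_energy_nonneg by auto
    fix x y t B \<theta>
    show "KM x absolutely_integrable_on {p..q}" if x: "traj x" and "0 \<le> p" for p q
    proof (rule KM_L1_bound(1)[OF traj_absolutely_integrable[OF x] \<open>0 \<le> p\<close>])
      fix \<xi> assume "\<xi> \<in> {-T..0}"
      show "integral {p..q} (\<lambda>s. \<bar>x (\<xi> + s)\<bar>) \<le> integral {p - T..q} (\<lambda>s. \<bar>x s\<bar>)"
        unfolding integral_shift[of p q "\<lambda>s. \<bar>x s\<bar>"] using \<open>\<xi> \<in> {-T..0}\<close>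
        by (intro integral_subset_le integrable_of_absolutely set_integrable_abs traj_absolutely_integrable x) auto
    qed
    show "KM x t - KM y t \<le> A * B"
      if x: "traj x" and y: "traj y" and t: "0 \<le> t" and B: "0 \<le> B" and le: "\<And>s. 0 \<le> s \<Longrightarrow> s \<le> t \<Longrightarrow> x s - y s \<le> B"
    proof -
      have ix: "x absolutely_integrable_on {t - T..t}" and iy: "y absolutely_integrable_on {t - T..t}"
        using x y by (auto intro: traj_absolutely_integrable)
      have "KM x t - KM y t = integral {-T..0} (\<lambda>\<xi>. a \<xi> * x (t + \<xi>) - a \<xi> * y (t + \<xi>))"
        unfolding KM_eq[OF ix] KM_eq[OF iy]
        by (intro hk_integral_diff[symmetric] integrable_of_absolutely kernel_integrable ix iy)
      also have "\<dots> \<le> integral {-T..0} (\<lambda>\<xi>. a \<xi> * B)"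
      proof (rule integral_le)
        show "(\<lambda>\<xi>. a \<xi> * x (t + \<xi>) - a \<xi> * y (t + \<xi>)) integrable_on {-T..0}"
          by (intro integrable_of_absolutely set_integral_diff kernel_integrable ix iy)
        show "(\<lambda>\<xi>. a \<xi> * B) integrable_on {-T..0}"
          using a_integrable by (intro integrable_of_absolutely set_integrable_mult_left) auto
        fix \<xi> assume \<xi>: "\<xi> \<in> {-T..0}"
        have "x (t + \<xi>) - y (t + \<xi>) \<le> B"
        proof (cases "0 \<le> t + \<xi>")
          case False
          then show ?thesis using x y B by (simp add: traj_iff)
        qed (use le[of "t + \<xi>"] \<xi> in auto)
        then have "a \<xi> * (x (t + \<xi>) - y (t + \<xi>)) \<le> a \<xi> * B"
          using a_nonneg[OF \<xi>] by (rule mult_left_mono)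
        then show "a \<xi> * x (t + \<xi>) - a \<xi> * y (t + \<xi>) \<le> a \<xi> * B" by (simp add: right_diff_distrib)
      qed
      also have "\<dots> \<le> A * B" by (rule mass_mult_le[OF B])
      finally show ?thesis .
    qed
    show "KM (\<lambda>s. (1 - \<theta>) * x s + \<theta> * y s) t = (1 - \<theta>) * KM x t + \<theta> * KM y t"
      if x: "traj x" and y: "traj y"
      by (subst KM_add[OF set_integrable_mult_right set_integrable_mult_right])
        (auto simp: KM_scale intro: traj_absolutely_integrable[OF x] traj_absolutely_integrable[OF y])
    show "AE t in lebesgue. 0 \<le> t \<longrightarrow> 0 \<le> KM past t"
    proof (rule AE_I2, rule impI)
      fix t :: real
      have i: "past absolutely_integrable_on {t - T..t}" by (rule past_absolutely_integrable) simp
      show "0 \<le> KM past t" unfolding KM_eq[OF i]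
      proof (rule integral_nonneg_AE_on[OF kernel_integrable[OF i]])
        show "AE \<xi> in lebesgue. \<xi> \<in> {-T..0} \<longrightarrow> 0 \<le> a \<xi> * past (t + \<xi>)"
          using AE_lebesgue_translate[OF past_nonneg_AE, of t] by eventually_elim (auto intro!: mult_nonneg_nonneg a_nonneg)
      qed
    qed
    fix s t :: real assume st: "0 \<le> s" "s \<le> t"
    have "integral {s..t} (\<lambda>r. \<bar>KM past r\<bar>) \<le> integral {-T..0} (\<lambda>\<xi>. a \<xi> * ((past_energy + 1) / 2 * sqrt (t - s)))"
      by (intro KM_L1_bound(2) past_absolutely_integrable past_window st) auto
    also have "\<dots> \<le> A * ((past_energy + 1) / 2 * sqrt (t - s))"
      using past_energy_nonneg st by (intro mass_mult_le) auto
    finally show "integral {s..t} (\<lambda>r. \<bar>KM past r\<bar>) \<le> A * ((past_energy + 1) / 2) * sqrt (t - s)" by simp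
  qed
qed

text \<open>For monotone functions the \<open>L\<^sup>1\<close> distance to a translate telescopes, so the bound depends only on the
  total variation.\<close>

lemma KM_monotone_diff:
  fixes P N :: "real \<Rightarrow> real"
  assumes mono: "mono P" "mono N" and nn: "\<And>t. 0 \<le> P t" "\<And>t. 0 \<le> N t"
    and bd: "\<And>t. P t \<le> kP" "\<And>t. N t \<le> kN" and R: "0 \<le> R"
  shows "(\<lambda>s. KM (\<lambda>t. P t - N t) s - (P (s - T / 2) - N (s - T / 2))) absolutely_integrable_on {0..R}"
    "integral {0..R} (\<lambda>s. \<bar>KM (\<lambda>t. P t - N t) s - (P (s - T / 2) - N (s - T / 2))\<bar>)
      \<le> (kP + kN) * (integral {-T..0} (\<lambda>\<xi>. a \<xi> * \<bar>\<xi> + T / 2\<bar>) + \<bar>integral {-T..0} a - 1\<bar> * R)"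
proof -
  let ?b = "\<lambda>t. P t - N t"
  have mi: "m absolutely_integrable_on {c..d}" if "mono m" for m :: "real \<Rightarrow> real" and c d
    using that integrable_mono_on[of c d m]
    by (auto simp: mono_on_def mono_def set_integrable_def integrable_restrict_space)
  have bi: "?b absolutely_integrable_on {c..d}" for c d by (intro set_integral_diff mi mono)
  have bs: "(\<lambda>s. ?b (s - T / 2)) absolutely_integrable_on {c..d}" for c d
    using absolutely_integrable_shift[OF bi, of c d "- T / 2"] by simp
  have [measurable]: "P \<in> borel_measurable borel" "N \<in> borel_measurable borel"
    using mono by (auto intro: borel_measurable_mono)
  define h where "h s \<xi> = ?b (s + \<xi>) - ?b (s - T / 2)" for s \<xi>
  have hm: "(\<lambda>(s, \<xi>). h s \<xi>) \<in> borel_measurable (borel \<Otimes>\<^sub>M borel)"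
    unfolding h_def by measurable
  have hi: "(\<lambda>s. h s \<xi>) absolutely_integrable_on {0..R}" for \<xi>
    unfolding h_def using absolutely_integrable_shift[OF bi, of 0 R \<xi>]
    by (intro set_integral_diff(1)[OF _ bs]) (simp add: add.commute)
  have hb: "integral {0..R} (\<lambda>s. \<bar>h s \<xi>\<bar>) \<le> (kP + kN) * \<bar>\<xi> + T / 2\<bar>" for \<xi>
  proof -
    have im: "(\<lambda>s. \<bar>m (\<xi> + s) - m (- T / 2 + s)\<bar>) integrable_on {0..R}" if "mono m" for m :: "real \<Rightarrow> real"
      by (intro integrable_of_absolutely set_integrable_abs set_integral_diff absolutely_integrable_shift mi that)
    have "integral {0..R} (\<lambda>s. \<bar>h s \<xi>\<bar>) \<le> integral {0..R} (\<lambda>s. \<bar>P (\<xi> + s) - P (- T / 2 + s)\<bar> + \<bar>N (\<xi> + s) - N (- T / 2 + s)\<bar>)"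
    proof (rule integral_le)
      show "(\<lambda>s. \<bar>h s \<xi>\<bar>) integrable_on {0..R}"
        by (intro integrable_of_absolutely set_integrable_abs hi)
    qed (use im mono in \<open>auto simp: h_def add.commute intro!: integrable_add\<close>)
    also have "\<dots> = integral {0..R} (\<lambda>s. \<bar>P (\<xi> + s) - P (- T / 2 + s)\<bar>) + integral {0..R} (\<lambda>s. \<bar>N (\<xi> + s) - N (- T / 2 + s)\<bar>)"
      by (intro hk_integral_add im mono)
    also have "\<dots> \<le> kP * \<bar>\<xi> - - T / 2\<bar> + kN * \<bar>\<xi> - - T / 2\<bar>"
      by (intro add_mono mono_translation_integral_abs mono nn bd R)
    finally show ?thesis by (simp add: distrib_right)
  qed
  have cont: "continuous_on {-T..0} (\<lambda>\<xi>. (kP + kN) * \<bar>\<xi> + T / 2\<bar>)" by (intro continuous_intros)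
  note sb = smear_bound[OF hm hi hb cont]
  let ?\<mu> = "integral {-T..0} a - 1"
  have eq: "KM ?b s - ?b (s - T / 2) = (LINT \<xi>:{-T..0}|lebesgue. a \<xi> * h s \<xi>) + ?\<mu> * ?b (s - T / 2)" for s
  proof -
    have "(LINT \<xi>:{-T..0}|lebesgue. a \<xi> * h s \<xi>) = (LINT \<xi>:{-T..0}|lebesgue. a \<xi> * ?b (s + \<xi>) - a \<xi> * ?b (s - T / 2))"
      unfolding h_def by (simp only: right_diff_distrib)
    also have "\<dots> = KM ?b s - (LINT \<xi>:{-T..0}|lebesgue. a \<xi> * ?b (s - T / 2))"
      unfolding kernel_memory_def
      by (intro set_integral_diff(2) kernel_integrable bi) (use a_integrable in auto)
    also have "(LINT \<xi>:{-T..0}|lebesgue. a \<xi> * ?b (s - T / 2)) = integral {-T..0} a * ?b (s - T / 2)"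
      using set_lebesgue_integral_eq_integral(2)[OF a_integrable] by simp
    finally show ?thesis by (simp add: algebra_simps)
  qed
  have i2: "(\<lambda>s. ?\<mu> * ?b (s - T / 2)) absolutely_integrable_on {0..R}"
    by (intro set_integrable_mult_right bs)
  show "(\<lambda>s. KM ?b s - ?b (s - T / 2)) absolutely_integrable_on {0..R}"
    unfolding eq by (intro set_integral_add(1) sb(1) i2)
  have i1: "(\<lambda>s. \<bar>LINT \<xi>:{-T..0}|lebesgue. a \<xi> * h s \<xi>\<bar>) integrable_on {0..R}"
    by (intro integrable_of_absolutely set_integrable_abs sb(1))
  have "integral {0..R} (\<lambda>s. \<bar>KM ?b s - ?b (s - T / 2)\<bar>)
     \<le> integral {0..R} (\<lambda>s. \<bar>LINT \<xi>:{-T..0}|lebesgue. a \<xi> * h s \<xi>\<bar> + \<bar>?\<mu>\<bar> * (kP + kN))"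
  proof (rule integral_le)
    show "(\<lambda>s. \<bar>KM ?b s - ?b (s - T / 2)\<bar>) integrable_on {0..R}"
      unfolding eq by (intro integrable_of_absolutely set_integrable_abs set_integral_add(1) sb(1) i2)
    show "(\<lambda>s. \<bar>LINT \<xi>:{-T..0}|lebesgue. a \<xi> * h s \<xi>\<bar> + \<bar>?\<mu>\<bar> * (kP + kN)) integrable_on {0..R}"
      by (intro integrable_add i1 integrable_const_ivl)
    fix s
    have "\<bar>?b (s - T / 2)\<bar> \<le> kP + kN"
      using nn[of "s - T / 2"] bd[of "s - T / 2"] by linarith
    then have "\<bar>?\<mu> * ?b (s - T / 2)\<bar> \<le> \<bar>?\<mu>\<bar> * (kP + kN)" unfolding abs_mult by (rule mult_left_mono) simp
    then show "\<bar>KM ?b s - ?b (s - T / 2)\<bar> \<le> \<bar>LINT \<xi>:{-T..0}|lebesgue. a \<xi> * h s \<xi>\<bar> + \<bar>?\<mu>\<bar> * (kP + kN)"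
      unfolding eq by linarith
  qed
  also have "\<dots> = integral {0..R} (\<lambda>s. \<bar>LINT \<xi>:{-T..0}|lebesgue. a \<xi> * h s \<xi>\<bar>) + \<bar>?\<mu>\<bar> * (kP + kN) * R"
    using R by (simp add: hk_integral_add[OF i1 integrable_const_ivl])
  also have "\<dots> \<le> integral {-T..0} (\<lambda>\<xi>. a \<xi> * ((kP + kN) * \<bar>\<xi> + T / 2\<bar>)) + \<bar>?\<mu>\<bar> * (kP + kN) * R"
    using sb(2) by simp
  also have "integral {-T..0} (\<lambda>\<xi>. a \<xi> * ((kP + kN) * \<bar>\<xi> + T / 2\<bar>)) = (kP + kN) * integral {-T..0} (\<lambda>\<xi>. a \<xi> * \<bar>\<xi> + T / 2\<bar>)"
    by (simp only: mult.left_commute[of "a _" "kP + kN"] integral_mult_right)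
  finally show "integral {0..R} (\<lambda>s. \<bar>KM ?b s - ?b (s - T / 2)\<bar>)
      \<le> (kP + kN) * (integral {-T..0} (\<lambda>\<xi>. a \<xi> * \<bar>\<xi> + T / 2\<bar>) + \<bar>?\<mu>\<bar> * R)"
    by (simp add: algebra_simps)
qed

end

context delay_data begin

lemma past_memory_tendsto:
  assumes ker: "\<And>k. nonneg_kernel T (a k) A"
    and conv: "\<And>\<phi>. continuous_on {-T..0} \<phi> \<Longrightarrow> (\<lambda>k. LINT \<xi>:{-T..0}|lebesgue. a k \<xi> * \<phi> \<xi>) \<longlonglongrightarrow> \<phi> (- T / 2)"
    and A: "1 \<le> A" and R: "0 \<le> R"
  shows "(\<lambda>k. integral {0..R} (\<lambda>s. \<bar>kernel_memory T (a k) past s - past (s - T / 2)\<bar>)) \<longlonglongrightarrow> 0"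
proof (rule LIMSEQ_I)
  fix e :: real assume "0 < e"
  define \<delta> where "\<delta> = e / (A + 2)"
  have \<delta>: "0 < \<delta>" using \<open>0 < e\<close> A by (simp add: \<delta>_def)
  have pi: "past absolutely_integrable_on {c..d}" for c d by (rule past_absolutely_integrable) simp
  obtain h where hc: "continuous_on UNIV h" and h: "integral {-T..R} (\<lambda>t. \<bar>past t - h t\<bar>) < \<delta>"
    using L1_approx_continuous[OF pi \<delta>] by blast
  have hi: "h absolutely_integrable_on {c..d}" for c d
    by (intro absolutely_integrable_continuous_real continuous_on_subset[OF hc]) auto
  define w where "w t = (if t \<in> {-T..R} then past t - h t else 0)" for t
  have wi: "w absolutely_integrable_on {c..d}" for c d
    unfolding w_def by (intro absolutely_integrable_if) (simp add: Int_atLeastAtMost, intro set_integral_diff pi hi)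
  have w1: "integral {0..R} (\<lambda>s. \<bar>w (\<xi> + s)\<bar>) \<le> \<delta>" if "\<xi> \<in> {-T..0}" for \<xi>
  proof -
    have "integral {0..R} (\<lambda>s. \<bar>w (\<xi> + s)\<bar>) = integral {0 + \<xi>..R + \<xi>} (\<lambda>s. \<bar>w s\<bar>)"
      by (rule integral_shift)
    also have "\<dots> \<le> integral {-T..R} (\<lambda>s. \<bar>w s\<bar>)"
      using that by (intro integral_subset_le integrable_of_absolutely set_integrable_abs wi) auto
    also have "\<dots> = integral {-T..R} (\<lambda>t. \<bar>past t - h t\<bar>)"
      by (intro integral_cong) (simp add: w_def)
    finally show ?thesis using h by simp
  qed
  let ?KM = "\<lambda>k. kernel_memory T (a k)"
  have hKi: "?KM k h absolutely_integrable_on {0..R}" and wK: "?KM k w absolutely_integrable_on {0..R}"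
    "integral {0..R} (\<lambda>s. \<bar>?KM k w s\<bar>) \<le> A * \<delta>" and pK: "?KM k past absolutely_integrable_on {0..R}" for k
  proof -
    interpret nonneg_kernel T "a k" A by (rule ker)
    have bound: "integral {0..R} (\<lambda>s. \<bar>x (\<xi> + s)\<bar>) \<le> integral {-T..R} (\<lambda>s. \<bar>x s\<bar>)"
      if "\<xi> \<in> {-T..0}" "\<And>c d. x absolutely_integrable_on {c..d}" for x :: "real \<Rightarrow> real" and \<xi>
      unfolding integral_shift[of 0 R "\<lambda>s. \<bar>x s\<bar>"] using that
      by (intro integral_subset_le integrable_of_absolutely set_integrable_abs) auto
    show "?KM k h absolutely_integrable_on {0..R}" by (rule KM_L1_bound(1)[OF hi order_refl bound[OF _ hi]])
    show "?KM k past absolutely_integrable_on {0..R}" by (rule KM_L1_bound(1)[OF pi order_refl bound[OF _ pi]])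
    show "?KM k w absolutely_integrable_on {0..R}" by (rule KM_L1_bound(1)[OF wi order_refl w1])
    show "integral {0..R} (\<lambda>s. \<bar>?KM k w s\<bar>) \<le> A * \<delta>"
      using KM_L1_bound(2)[OF wi order_refl w1] mass_mult_le[of \<delta>] \<delta> by linarith
  qed
  have hs: "(\<lambda>s. h (s - T / 2)) absolutely_integrable_on {0..R}"
    using absolutely_integrable_shift[OF hi, of 0 R "- T / 2"] by simp
  have ps: "(\<lambda>s. past (s - T / 2)) absolutely_integrable_on {0..R}"
    using absolutely_integrable_shift[OF pi, of 0 R "- T / 2"] by simp
  have "bounded (h ` {-T..R})"
    by (intro compact_imp_bounded compact_continuous_image continuous_on_subset[OF hc]) auto
  then obtain H where H: "\<And>t. t \<in> {-T..R} \<Longrightarrow> \<bar>h t\<bar> \<le> H" unfolding bounded_iff by (metis image_eqI real_norm_def)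
  have H0: "0 \<le> H" using H[of 0] T_pos R by auto
  have "(\<lambda>k. integral {0..R} (\<lambda>s. \<bar>?KM k h s - h (s - T / 2)\<bar>)) \<longlonglongrightarrow> integral {0..R} (\<lambda>_. 0)"
  proof (rule dominated_convergence(2)[where h = "\<lambda>_. A * H + H"])
    show "(\<lambda>s. \<bar>?KM k h s - h (s - T / 2)\<bar>) integrable_on {0..R}" for k
      by (intro integrable_of_absolutely set_integrable_abs set_integral_diff hKi hs)
    show "(\<lambda>_. A * H + H) integrable_on {0..R}" by (rule integrable_const_ivl)
    fix s assume s: "s \<in> {0..R}"
    show "norm \<bar>?KM k h s - h (s - T / 2)\<bar> \<le> A * H + H" for k
    proof -
      interpret nonneg_kernel T "a k" A by (rule ker)
      have "\<bar>?KM k h s\<bar> \<le> integral {-T..0} (\<lambda>\<xi>. a k \<xi> * H)"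
        unfolding KM_eq[OF hi] real_norm_def[symmetric]
      proof (rule integral_norm_bound_integral)
        show "(\<lambda>\<xi>. a k \<xi> * h (s + \<xi>)) integrable_on {-T..0}"
          by (intro integrable_of_absolutely kernel_integrable hi)
        show "(\<lambda>\<xi>. a k \<xi> * H) integrable_on {-T..0}"
          using a_integrable by (intro integrable_of_absolutely set_integrable_mult_left) auto
        fix \<xi> assume \<xi>: "\<xi> \<in> {-T..0}"
        then have "\<bar>h (s + \<xi>)\<bar> \<le> H" using s by (intro H) auto
        then show "norm (a k \<xi> * h (s + \<xi>)) \<le> a k \<xi> * H"
          using a_nonneg[OF \<xi>] by (simp add: abs_mult mult_left_mono)
      qed
      also have "\<dots> \<le> A * H" by (rule mass_mult_le[OF H0])
      finally have "\<bar>?KM k h s\<bar> \<le> A * H" .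
      moreover have "\<bar>h (s - T / 2)\<bar> \<le> H" using s T_pos by (intro H) auto
      ultimately show ?thesis by simp
    qed
    have "continuous_on {-T..0} (\<lambda>\<xi>. h (s + \<xi>))"
      by (intro continuous_on_compose2[OF hc] continuous_intros) auto
    from conv[OF this] have "(\<lambda>k. ?KM k h s) \<longlonglongrightarrow> h (s - T / 2)" by (simp add: kernel_memory_def)
    then have "(\<lambda>k. \<bar>?KM k h s - h (s - T / 2)\<bar>) \<longlonglongrightarrow> \<bar>h (s - T / 2) - h (s - T / 2)\<bar>"
      by (intro tendsto_intros)
    then show "(\<lambda>k. \<bar>?KM k h s - h (s - T / 2)\<bar>) \<longlonglongrightarrow> 0" by simp
  qed
  then have "\<forall>\<^sub>F k in sequentially. integral {0..R} (\<lambda>s. \<bar>?KM k h s - h (s - T / 2)\<bar>) < \<delta>"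
    using \<delta> by (intro order_tendstoD(2)) auto
  then obtain k0 where k0: "\<And>k. k \<ge> k0 \<Longrightarrow> integral {0..R} (\<lambda>s. \<bar>?KM k h s - h (s - T / 2)\<bar>) < \<delta>"
    by (auto simp: eventually_sequentially)
  have "norm (integral {0..R} (\<lambda>s. \<bar>?KM k past s - past (s - T / 2)\<bar>) - 0) < e" if k: "k \<ge> k0" for k
  proof -
    interpret nonneg_kernel T "a k" A by (rule ker)
    let ?f1 = "\<lambda>s. \<bar>?KM k w s\<bar>" and ?f2 = "\<lambda>s. \<bar>?KM k h s - h (s - T / 2)\<bar>" and ?f3 = "\<lambda>s. \<bar>w (- T / 2 + s)\<bar>"
    have i: "?f1 integrable_on {0..R}" "?f2 integrable_on {0..R}" "?f3 integrable_on {0..R}"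
      by (intro integrable_of_absolutely set_integrable_abs set_integral_diff absolutely_integrable_shift wi wK(1) hKi hs)+
    have split: "?KM k past s = ?KM k w s + ?KM k h s" if s: "s \<in> {0..R}" for s
    proof -
      have "?KM k past s = ?KM k (\<lambda>t. w t + h t) s"
        using s by (intro KM_cong pi set_integral_add wi hi AE_I2) (auto simp: w_def)
      then show ?thesis by (simp add: KM_add[OF wi hi])
    qed
    have "integral {0..R} (\<lambda>s. \<bar>?KM k past s - past (s - T / 2)\<bar>) \<le> integral {0..R} (\<lambda>s. ?f1 s + (?f2 s + ?f3 s))"
    proof (rule integral_le)
      show "(\<lambda>s. \<bar>?KM k past s - past (s - T / 2)\<bar>) integrable_on {0..R}"
        by (intro integrable_of_absolutely set_integrable_abs set_integral_diff pK ps)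
      show "(\<lambda>s. ?f1 s + (?f2 s + ?f3 s)) integrable_on {0..R}" by (intro integrable_add i)
      fix s assume s: "s \<in> {0..R}"
      have "w (- T / 2 + s) = past (s - T / 2) - h (s - T / 2)"
        using s T_pos by (simp add: w_def)
      then show "\<bar>?KM k past s - past (s - T / 2)\<bar> \<le> ?f1 s + (?f2 s + ?f3 s)"
        using split[OF s] by linarith
    qed
    also have "\<dots> = integral {0..R} ?f1 + (integral {0..R} ?f2 + integral {0..R} ?f3)"
      by (simp only: hk_integral_add integrable_add i)
    also have "\<dots> < A * \<delta> + (\<delta> + \<delta>)"
      using wK(2)[of k] k0[OF k] w1[of "- T / 2"] T_pos by auto
    also have "\<dots> = (A + 2) * \<delta>" by (simp add: algebra_simps)
    also have "\<dots> = e" using A by (simp add: \<delta>_def)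
    finally have "integral {0..R} (\<lambda>s. \<bar>?KM k past s - past (s - T / 2)\<bar>) < e" .
    moreover have "0 \<le> integral {0..R} (\<lambda>s. \<bar>?KM k past s - past (s - T / 2)\<bar>)"
      by (intro hk_integral_nonneg integrable_of_absolutely set_integrable_abs set_integral_diff pK ps) auto
    ultimately show ?thesis by simp
  qed
  then show "\<exists>k0. \<forall>k\<ge>k0. norm (integral {0..R} (\<lambda>s. \<bar>?KM k past s - past (s - T / 2)\<bar>) - 0) < e" by blast
qed

lemma eventually_close:
  assumes ker: "\<And>k. nonneg_kernel T (a k) A"
    and conv: "\<And>\<phi>. continuous_on {-T..0} \<phi> \<Longrightarrow> (\<lambda>k. LINT \<xi>:{-T..0}|lebesgue. a k \<xi> * \<phi> \<xi>) \<longlonglongrightarrow> \<phi> (- T / 2)"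
    and A: "1 \<le> A" and R: "0 \<le> R" and K: "0 \<le> K" and \<omega>: "0 < \<omega>"
  shows "\<forall>\<^sub>F k in sequentially. close R K \<omega> (kernel_memory T (a k)) (point_memory T)"
proof -
  let ?KM = "\<lambda>k. kernel_memory T (a k)"
  define e where "e k = integral {-T..0} (\<lambda>\<xi>. a k \<xi> * \<bar>\<xi> + T / 2\<bar>) + \<bar>integral {-T..0} (a k) - 1\<bar> * R" for k
  define g where "g k = integral {0..R} (\<lambda>s. \<bar>?KM k past s - past (s - T / 2)\<bar>)" for k
  have hk: "(LINT \<xi>:{-T..0}|lebesgue. a k \<xi> * \<phi> \<xi>) = integral {-T..0} (\<lambda>\<xi>. a k \<xi> * \<phi> \<xi>)"
    if "continuous_on {-T..0} \<phi>" for \<phi> k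
  proof -
    interpret nonneg_kernel T "a k" A by (rule ker)
    show ?thesis
      by (intro set_lebesgue_integral_eq_integral(2) absolutely_integrable_continuous_real continuous_intros a_cont that)
  qed
  have "(\<lambda>k. integral {-T..0} (\<lambda>\<xi>. a k \<xi> * \<bar>\<xi> + T / 2\<bar>)) \<longlonglongrightarrow> \<bar>- T / 2 + T / 2\<bar>"
  proof -
    have c: "continuous_on {-T..0} (\<lambda>\<xi>. \<bar>\<xi> + T / 2\<bar>)" by (intro continuous_intros)
    show ?thesis using conv[OF c] unfolding hk[OF c] .
  qed
  moreover have "(\<lambda>k. integral {-T..0} (\<lambda>\<xi>. a k \<xi> * 1)) \<longlonglongrightarrow> 1"
    using conv[OF continuous_on_const[of _ 1]] unfolding hk[OF continuous_on_const] .
  then have "(\<lambda>k. integral {-T..0} (a k)) \<longlonglongrightarrow> 1" by simp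
  ultimately have "e \<longlonglongrightarrow> \<bar>- T / 2 + T / 2\<bar> + \<bar>1 - 1\<bar> * R"
    unfolding e_def by (intro tendsto_intros)
  then have e: "e \<longlonglongrightarrow> 0" by simp
  have "g \<longlonglongrightarrow> 0" unfolding g_def by (rule past_memory_tendsto[OF ker conv A R])
  then have "(\<lambda>k. g k + K * e k) \<longlonglongrightarrow> 0 + K * 0" by (intro tendsto_intros e)
  then have "\<forall>\<^sub>F k in sequentially. g k + K * e k < \<omega>" using \<omega> by (intro order_tendstoD(2)) auto
  then show ?thesis
  proof eventually_elim
    case (elim k)
    interpret nonneg_kernel T "a k" A by (rule ker)
    interpret S: memory_system T C f0 \<eta> A "A * ((past_energy + 1) / 2)" "?KM k"
      by (rule KM_memory_system[OF delay_data_axioms A])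
    show ?case unfolding close_def
    proof (intro allI impI)
      fix v y
      assume v: "v absolutely_integrable_on {0..R}" and vK: "fst \<eta> + integral {0..R} (\<lambda>s. \<bar>v s\<bar>) \<le> K"
        and y: "traj y" and yv: "\<forall>t. 0 \<le> t \<longrightarrow> t \<le> R \<longrightarrow> y t = fst \<eta> + integral {0..t} v"
      define vp where "vp s = (\<bar>v s\<bar> + v s) / 2" for s
      define vn where "vn s = (\<bar>v s\<bar> - v s) / 2" for s
      have nn: "0 \<le> vp s" "0 \<le> vn s" for s by (auto simp: vp_def vn_def)
      have i: "vp integrable_on {0..t}" "vn integrable_on {0..t}" if "t \<le> R" for t
      proof -
        have "v absolutely_integrable_on {0..t}"
          using v by (rule set_integrable_subset) (use that in auto)
        then show "vp integrable_on {0..t}" "vn integrable_on {0..t}"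
          unfolding vp_def vn_def
          by (intro integrable_of_absolutely set_integrable_divide set_integral_add set_integral_diff set_integrable_abs; assumption)+
      qed
      define up where "up u c t = (if t < 0 then 0 else c + integral {0..min t R} u)" for u and c t :: real
      have up: "mono (up u c)" "\<And>t. 0 \<le> up u c t" "\<And>t. up u c t \<le> c + integral {0..R} u"
        if u: "\<And>s. 0 \<le> u s" "\<And>t. t \<le> R \<Longrightarrow> u integrable_on {0..t}" and c: "0 \<le> c" for u c
      proof -
        have m: "integral {0..min s R} u \<le> integral {0..min t R} u" if "s \<le> t" for s t
          using that by (intro integral_subset_le u(2)) (auto simp: u(1))
        have n: "0 \<le> integral {0..min t R} u" for t
          by (intro hk_integral_nonneg u) auto
        show "mono (up u c)"
          using m n c by (auto simp: mono_def up_def intro: add_nonneg_nonneg)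
        show "0 \<le> up u c t" for t using n c by (simp add: up_def)
        show "up u c t \<le> c + integral {0..R} u" for t
          using integral_subset_le[of "{0..min t R}" "{0..R}" u] u(2)[of "min t R"] u(2)[of R] u(1) n[of R] c by (auto simp: up_def)
      qed
      define P where "P = up vp (fst \<eta>)"
      define N where "N = up vn 0"
      note P = up[of vp "fst \<eta>", OF nn(1) i(1) less_imp_le[OF init_pos], folded P_def]
      note N = up[of vn 0, OF nn(2) i(2) order_refl, folded N_def]
      let ?b = "\<lambda>t. P t - N t"
      have sum: "(fst \<eta> + integral {0..R} vp) + (0 + integral {0..R} vn) \<le> K"
      proof -
        have "integral {0..R} vp + integral {0..R} vn = integral {0..R} (\<lambda>s. vp s + vn s)"
          by (rule hk_integral_add[symmetric]) (auto intro: i)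
        also have "(\<lambda>s. vp s + vn s) = (\<lambda>s. \<bar>v s\<bar>)" by (auto simp: vp_def vn_def field_simps)
        finally show ?thesis using vK by simp
      qed
      have yb: "y t = past t + ?b t" if "t \<le> R" for t
      proof (cases "t < 0")
        case True then show ?thesis using y by (simp add: traj_iff P_def N_def up_def)
      next
        case False
        have "integral {0..t} vp - integral {0..t} vn = integral {0..t} (\<lambda>s. vp s - vn s)"
          using that by (intro hk_integral_diff[symmetric] i)
        also have "(\<lambda>s. vp s - vn s) = v" by (auto simp: vp_def vn_def field_simps)
        finally show ?thesis using False that yv by (simp add: P_def N_def up_def past_def)
      qed
      have pi: "past absolutely_integrable_on {c..d}" for c d by (rule past_absolutely_integrable) simp
      have mi: "m absolutely_integrable_on {c..d}" if "mono m" for m :: "real \<Rightarrow> real" and c d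
        using that integrable_mono_on[of c d m]
        by (auto simp: mono_on_def mono_def set_integrable_def integrable_restrict_space)
      have bi: "?b absolutely_integrable_on {c..d}" for c d by (intro set_integral_diff mi P N)
      note md = KM_monotone_diff[OF P(1) N(1) P(2) N(2) P(3) N(3) R]
      have split: "?KM k y s = ?KM k past s + ?KM k ?b s" if s: "s \<in> {0..R}" for s
      proof -
        have "?KM k y s = ?KM k (\<lambda>t. past t + ?b t) s"
          using s by (intro KM_cong pi set_integral_add bi AE_I2 traj_absolutely_integrable[OF y]) (auto simp: yb)
        also have "\<dots> = ?KM k past s + ?KM k ?b s" by (rule KM_add[OF pi bi])
        finally show ?thesis .
      qed
      have ig: "(\<lambda>s. \<bar>?KM k past s - past (s - T / 2)\<bar>) integrable_on {0..R}"
        using absolutely_integrable_shift[OF pi, of 0 R "- T / 2"]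
        by (intro integrable_of_absolutely set_integrable_abs set_integral_diff S.D_integrable traj_past) auto
      have ib: "(\<lambda>s. \<bar>?KM k ?b s - ?b (s - T / 2)\<bar>) integrable_on {0..R}"
        by (intro integrable_of_absolutely set_integrable_abs md(1))
      have "integral {0..R} (\<lambda>s. \<bar>?KM k y s - point_memory T y s\<bar>)
         \<le> integral {0..R} (\<lambda>s. \<bar>?KM k past s - past (s - T / 2)\<bar> + \<bar>?KM k ?b s - ?b (s - T / 2)\<bar>)"
      proof (rule integral_le)
        show "(\<lambda>s. \<bar>?KM k y s - point_memory T y s\<bar>) integrable_on {0..R}"
          using absolutely_integrable_shift[OF traj_absolutely_integrable[OF y], of 0 R "- T / 2"]
          by (intro integrable_of_absolutely set_integrable_abs set_integral_diff S.D_integrable y)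
            (auto simp: point_memory_def)
        show "(\<lambda>s. \<bar>?KM k past s - past (s - T / 2)\<bar> + \<bar>?KM k ?b s - ?b (s - T / 2)\<bar>) integrable_on {0..R}"
          by (intro integrable_add ig ib)
        fix s assume s: "s \<in> {0..R}"
        have "y (s - T / 2) = past (s - T / 2) + ?b (s - T / 2)" using s T_pos by (intro yb) auto
        then show "\<bar>?KM k y s - point_memory T y s\<bar> \<le> \<bar>?KM k past s - past (s - T / 2)\<bar> + \<bar>?KM k ?b s - ?b (s - T / 2)\<bar>"
          unfolding split[OF s] point_memory_def by linarith
      qed
      also have "\<dots> = g k + integral {0..R} (\<lambda>s. \<bar>?KM k ?b s - ?b (s - T / 2)\<bar>)"
        unfolding g_def by (rule hk_integral_add[OF ig ib])
      also have "\<dots> \<le> g k + ((fst \<eta> + integral {0..R} vp) + (0 + integral {0..R} vn)) * e k"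
        using md(2) by (simp add: e_def)
      also have "\<dots> \<le> g k + K * e k"
      proof (intro add_left_mono mult_right_mono sum)
        show "0 \<le> e k" unfolding e_def using R a_nonneg
          by (intro add_nonneg_nonneg hk_integral_nonneg mult_nonneg_nonneg
              integrable_of_absolutely absolutely_integrable_continuous_real continuous_intros a_cont) auto
      qed
      finally show "integral {0..R} (\<lambda>s. \<bar>?KM k y s - point_memory T y s\<bar>) \<le> \<omega>" using elim by simp
    qed
  qed
qed

end

lemma (in control_system) near_optimal:
  assumes "0 < r"
  obtains c where "c \<in> adm" "V - ereal r \<le> pay c"
proof -
  have "V - ereal r < V" using V_finite assms by (cases V) auto
  then have "V - ereal r < (SUP c\<in>adm. pay c)" by (simp add: val_def)
  then obtain c where "c \<in> adm" "V - ereal r < pay c" unfolding less_SUP_iff by blast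
  then show ?thesis using that by force
qed

section \<open>Convergence of the value functions\<close>

lemma concave_at_zero:
  fixes U :: "real \<Rightarrow> real"
  assumes cont: "continuous_on {0..} U"
    and d1: "\<And>x. 0 < x \<Longrightarrow> U field_differentiable at x"
    and d2: "\<And>x. 0 < x \<Longrightarrow> deriv U field_differentiable at x"
    and neg: "\<And>x. 0 < x \<Longrightarrow> deriv (deriv U) x < 0"
    and x: "0 \<le> x" and \<theta>: "0 \<le> \<theta>" "\<theta> \<le> 1"
  shows "(1 - \<theta>) * U x + \<theta> * U 0 \<le> U ((1 - \<theta>) * x)"
proof (cases "x = 0 \<or> \<theta> = 0 \<or> \<theta> = 1")
  case False
  then have p: "0 < x" "0 < \<theta>" "\<theta> < 1" using x \<theta> by auto
  define y where "y = (1 - \<theta>) * x"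
  have y: "0 < y" "y < x" using p by (auto simp: y_def mult_less_cancel_right2)
  have diff: "U differentiable (at z)" if "0 < z" for z
    using d1[OF that] field_differentiable_imp_differentiable by blast
  obtain l1 z1 where 1: "0 < z1" "z1 < y" "DERIV U z1 :> l1" "U y - U 0 = (y - 0) * l1"
    using MVT[OF y(1) continuous_on_subset[OF cont], of] diff by (auto intro: less_trans)
  have "continuous_on {y..x} U" by (rule continuous_on_subset[OF cont]) (use y in auto)
  then obtain l2 z2 where 2: "y < z2" "z2 < x" "DERIV U z2 :> l2" "U x - U y = (x - y) * l2"
    using MVT[OF y(2)] diff y(1) by (metis less_trans)
  have "deriv U z2 < deriv U z1"
  proof (rule DERIV_neg_imp_decreasing[where f = "deriv U" and a = z1 and b = z2])
    show "z1 < z2" using 1 2 by simp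
    fix z assume "z1 \<le> z" "z \<le> z2"
    then have "0 < z" using 1 by simp
    then show "\<exists>l. DERIV (deriv U) z :> l \<and> l < 0"
      using d2 neg by (meson DERIV_deriv_iff_field_differentiable)
  qed
  then have "l2 \<le> l1" using 1(3) 2(3) by (simp add: DERIV_imp_deriv)
  moreover have "0 \<le> \<theta> * (1 - \<theta>) * x" using p by simp
  ultimately have le: "\<theta> * (1 - \<theta>) * x * l2 \<le> \<theta> * (1 - \<theta>) * x * l1" by (rule mult_left_mono)
  have e: "(1 - \<theta>) * (U x - U y) = \<theta> * (1 - \<theta>) * x * l2" "\<theta> * (U y - U 0) = \<theta> * (1 - \<theta>) * x * l1"
    unfolding 1(4) 2(4) by (auto simp: y_def algebra_simps)
  have "(1 - \<theta>) * (U x - U y) \<le> \<theta> * (U y - U 0)" unfolding e by (rule le)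
  then show ?thesis unfolding y_def[symmetric] by (simp add: algebra_simps)
qed (auto simp: algebra_simps)

theorem proposition4p6:
  fixes T \<rho> Cf0 :: real
    and f0 :: "real \<Rightarrow> real \<Rightarrow> real"
    and U1 U2 :: "real \<Rightarrow> real"
    and a :: "nat \<Rightarrow> real \<Rightarrow> real"
    and \<eta> :: "real \<times> (real \<Rightarrow> real)"
  assumes "T > 0" and "\<rho> > 0"
    and "concave_on ({0..} \<times> UNIV) (\<lambda>(x, y). f0 x y)"
    and "\<And>x. 0 \<le> x \<Longrightarrow> mono (f0 x)"
    and "Cf0-lipschitz_on ({0..} \<times> UNIV) (\<lambda>(x, y). f0 x y)"
    and "\<And>y. 0 < y \<Longrightarrow> 0 < f0 0 y"
    and "\<And>x. 0 \<le> x \<Longrightarrow> 0 \<le> f0 x 0"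
    and "continuous_on {0..} U1"
    and "\<And>x. 0 < x \<Longrightarrow> U1 field_differentiable at x"
    and "\<And>x. 0 < x \<Longrightarrow> deriv U1 field_differentiable at x"
    and "continuous_on {0<..} (deriv (deriv U1))"
    and "bounded (U1 ` {0..})"
    and "\<And>x. 0 < x \<Longrightarrow> 0 < deriv U1 x"
    and "filterlim (deriv U1) at_top (at_right 0)"
    and "\<And>x. 0 < x \<Longrightarrow> deriv (deriv U1) x < 0"
    and "continuous_on {0<..} U2"
    and "mono_on {0<..} U2"
    and "concave_on {0<..} U2"
    and "bdd_above (U2 ` {0<..})"
    and "ext_integral (\<lambda>t. exp (- \<rho> * t) * U2 (exp (- Cf0 * t))) > -\<infinity>"
    and "\<And>k. a k \<in> W12 T"
    and "\<And>k \<xi>. \<xi> \<in> {-T..0} \<Longrightarrow> 0 \<le> a k \<xi>"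
    and "\<And>k. a k (-T) = 0"
    and "\<And>k. L2_norm T (a k) \<le> 1 \<or> L1_norm T (a k) \<le> 1"
    and "\<And>k \<delta>. 0 < \<delta> \<Longrightarrow> \<delta> \<le> T \<Longrightarrow> 0 < (LINT \<xi>:{-\<delta>..0}|lebesgue. a k \<xi>)"
    and "\<And>\<phi>. continuous_on {-T..0} \<phi> \<Longrightarrow>
            (\<lambda>k. LINT \<xi>:{-T..0}|lebesgue. a k \<xi> * \<phi> \<xi>) \<longlonglongrightarrow> \<phi> (- T / 2)"
    and "\<eta> \<in> H_plusplus T"
    and "filterlim (\<lambda>x. x * U2 x) at_bot (at_right 0)"
  shows "(\<lambda>k. val T \<rho> f0 U1 U2 (kernel_memory T (a k)) \<eta>)
            \<longlonglongrightarrow> val T \<rho> f0 U1 U2 (point_memory T) \<eta> \<and>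
    (\<forall>cstar. (\<forall>k. optimal_feedback_strategy T \<rho> f0 U1 U2 (kernel_memory T (a k)) \<eta> (cstar k)) \<longrightarrow>
      (\<forall>\<epsilon>>0. \<exists>M\<ge>0. \<exists>k.
         truncate_strategy M (cstar k) \<in> admissible T f0 (point_memory T) \<eta> \<and>
         payoff T \<rho> f0 U1 U2 (point_memory T) \<eta> (truncate_strategy M (cstar k))
           > val T \<rho> f0 U1 U2 (point_memory T) \<eta> - ereal \<epsilon>))"
proof -
  note conv = assms(26)
  have a_cont: "continuous_on {-T..0} (a k)" for k using assms(21)[of k] by (simp add: W12_def)
  have mass: "(LINT \<xi>:{-T..0}|lebesgue. a k \<xi> * 1) = integral {-T..0} (a k)" for k
    using set_lebesgue_integral_eq_integral(2)[OF absolutely_integrable_continuous_real[OF a_cont]] by simp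
  have "(\<lambda>k. integral {-T..0} (a k)) \<longlonglongrightarrow> 1"
    using conv[of "\<lambda>_. 1"] by (simp only: mass continuous_on_const)
  then have "Bseq (\<lambda>k. integral {-T..0} (a k))" using convergent_imp_Bseq convergentI by blast
  then obtain A0 where A0: "\<And>k. \<bar>integral {-T..0} (a k)\<bar> \<le> A0" unfolding Bseq_def by auto
  define A where "A = max 1 A0"
  have A: "1 \<le> A" by (simp add: A_def)
  have ker: "nonneg_kernel T (a k) A" for k
  proof
    show "integral {-T..0} (a k) \<le> A" using A0[of k] by (simp add: A_def)
  qed (use assms(1,22) a_cont in auto)
  interpret data: delay_data T Cf0 f0 \<eta>
  proof
    show "0 \<le> Cf0" using assms(5) by (rule lipschitz_on_nonneg)
    show "\<bar>f0 x y - f0 x' y'\<bar> \<le> Cf0 * (\<bar>x - x'\<bar> + \<bar>y - y'\<bar>)" if "0 \<le> x" "0 \<le> x'" for x x' y y'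
    proof -
      have "\<bar>f0 x y - f0 x' y'\<bar> \<le> Cf0 * dist (x, y) (x', y')"
        using lipschitz_onD[OF assms(5), of "(x, y)" "(x', y')"] that by (simp add: dist_real_def)
      also have "\<dots> \<le> Cf0 * (\<bar>x - x'\<bar> + \<bar>y - y'\<bar>)"
        using lipschitz_on_nonneg[OF assms(5)] sqrt_sum_squares_le_sum_abs[of "x - x'" "y - y'"]
        by (intro mult_left_mono) (auto simp: dist_Pair_Pair dist_real_def)
      finally show ?thesis .
    qed
    show "(1 - \<theta>) * f0 x y + \<theta> * f0 x' y' \<le> f0 ((1 - \<theta>) * x + \<theta> * x') ((1 - \<theta>) * y + \<theta> * y')"
      if "0 \<le> x" "0 \<le> x'" "0 \<le> \<theta>" "\<theta> \<le> 1" for x x' y y' \<theta>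
      using concave_onD[OF assms(3), of \<theta> "(x, y)" "(x', y')"] that by simp
    show "f0 x y \<le> f0 x y'" if "0 \<le> x" "y \<le> y'" for x y y' using assms(4)[OF that(1)] that(2) by (rule monoD)
    show "0 < fst \<eta>" using assms(27) by (auto simp: H_plusplus_def)
  qed (use assms in auto)
  obtain B1 where B1: "\<And>x. 0 \<le> x \<Longrightarrow> \<bar>U1 x\<bar> \<le> B1" using assms(12) by (auto simp: bounded_iff)
  obtain B2 where B2: "\<And>x. 0 < x \<Longrightarrow> U2 x \<le> B2" using assms(19) by (auto simp: bdd_above_def)
  interpret ut: utility \<rho> U1 U2 B1 B2
  proof
    show "(1 - \<theta>) * U1 x + \<theta> * U1 0 \<le> U1 ((1 - \<theta>) * x)" if "0 \<le> x" "0 \<le> \<theta>" "\<theta> \<le> 1" for x \<theta>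
      using concave_at_zero[OF assms(8,9,10,15) that] .
    show "U2 x \<le> U2 y" if "0 < x" "x \<le> y" for x y
      using assms(17) that by (auto simp: mono_on_def)
  qed (use assms B1 B2 in auto)
  let ?Dp = "point_memory T" and ?D = "\<lambda>k. kernel_memory T (a k)"
  let ?I = "A * ((data.past_energy + 1) / 2)"
  let ?Vp = "val T \<rho> f0 U1 U2 ?Dp \<eta>" and ?V = "\<lambda>k. val T \<rho> f0 U1 U2 (?D k) \<eta>"
  have m0: "memory_system T Cf0 f0 \<eta> A ?I ?Dp" by (rule data.point_memory_system[OF A])
  have mk: "memory_system T Cf0 f0 \<eta> A ?I (?D k)" for k
    by (rule nonneg_kernel.KM_memory_system[OF ker data.delay_data_axioms A])
  interpret P: control_system T Cf0 f0 \<eta> A ?I ?Dp \<rho> U1 U2 B1 B2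
    using m0 ut.utility_axioms by (rule control_system.intro)
  have ck: "control_system T Cf0 f0 \<eta> A ?I (?D k) \<rho> U1 U2 B1 B2" for k
    using mk ut.utility_axioms by (rule control_system.intro)
  have key: "\<exists>M\<ge>0. \<forall>\<^sub>F k in sequentially. ?V k \<le> ?Vp + ereal \<epsilon> \<and> ?Vp \<le> ?V k + ereal \<epsilon> \<and>
      (\<forall>c. c \<in> admissible T f0 (?D k) \<eta> \<and> payoff T \<rho> f0 U1 U2 (?D k) \<eta> c = ?V k \<longrightarrow>
        truncate_strategy M c \<in> admissible T f0 ?Dp \<eta> \<and>
        ?V k - ereal \<epsilon> \<le> payoff T \<rho> f0 U1 U2 ?Dp \<eta> (truncate_strategy M c))"
    if \<epsilon>: "0 < \<epsilon>" for \<epsilon>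
  proof -
    have "0 < \<epsilon> / 2" using \<epsilon> by simp
    then show ?thesis
    proof (rule P.uniform_transfer)
    fix M r R K \<omega> assume par: "0 \<le> M" "0 < r" "r \<le> \<epsilon> / 2" "0 \<le> R" "0 \<le> K" "0 < \<omega>"
      and tr: "\<And>D1 D2 c. \<lbrakk>memory_system T Cf0 f0 \<eta> A ?I D1; memory_system T Cf0 f0 \<eta> A ?I D2; data.close R K \<omega> D1 D2;
       c \<in> admissible T f0 D1 \<eta>; val T \<rho> f0 U1 U2 D1 \<eta> - ereal r \<le> payoff T \<rho> f0 U1 U2 D1 \<eta> c\<rbrakk>
     \<Longrightarrow> truncate_strategy M c \<in> admissible T f0 D2 \<eta> \<and>
        payoff T \<rho> f0 U1 U2 D1 \<eta> c - ereal (\<epsilon> / 2) \<le> payoff T \<rho> f0 U1 U2 D2 \<eta> (truncate_strategy M c)"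
    have le: "val T \<rho> f0 U1 U2 D1 \<eta> \<le> val T \<rho> f0 U1 U2 D2 \<eta> + ereal \<epsilon>"
      if m: "memory_system T Cf0 f0 \<eta> A ?I D1" "memory_system T Cf0 f0 \<eta> A ?I D2" and cl: "data.close R K \<omega> D1 D2" for D1 D2
    proof -
      interpret X: control_system T Cf0 f0 \<eta> A ?I D1 \<rho> U1 U2 B1 B2
        using m(1) ut.utility_axioms by (rule control_system.intro)
      interpret Y: control_system T Cf0 f0 \<eta> A ?I D2 \<rho> U1 U2 B1 B2
        using m(2) ut.utility_axioms by (rule control_system.intro)
      obtain c where c: "c \<in> X.adm" "X.V - ereal r \<le> X.pay c" using X.near_optimal[OF par(2)] by blast
      have "X.pay c - ereal (\<epsilon> / 2) \<le> Y.V"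
        using tr[OF m cl c] Y.pay_le_V order_trans by blast
      then show ?thesis
        using c(2) par(3) X.V_finite Y.V_finite
        by (cases X.V; cases Y.V; cases "X.pay c") auto
    qed
    have "\<forall>\<^sub>F k in sequentially. data.close R K \<omega> (?D k) ?Dp"
      by (rule data.eventually_close[OF ker conv A par(4,5,6)])
    then have "\<forall>\<^sub>F k in sequentially. ?V k \<le> ?Vp + ereal \<epsilon> \<and> ?Vp \<le> ?V k + ereal \<epsilon> \<and>
      (\<forall>c. c \<in> admissible T f0 (?D k) \<eta> \<and> payoff T \<rho> f0 U1 U2 (?D k) \<eta> c = ?V k \<longrightarrow>
        truncate_strategy M c \<in> admissible T f0 ?Dp \<eta> \<and>
        ?V k - ereal \<epsilon> \<le> payoff T \<rho> f0 U1 U2 ?Dp \<eta> (truncate_strategy M c))"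
    proof eventually_elim
      case (elim k)
      interpret X: control_system T Cf0 f0 \<eta> A ?I "?D k" \<rho> U1 U2 B1 B2 by (rule ck)
      have "truncate_strategy M c \<in> admissible T f0 ?Dp \<eta> \<and>
        ?V k - ereal \<epsilon> \<le> payoff T \<rho> f0 U1 U2 ?Dp \<eta> (truncate_strategy M c)"
        if c: "c \<in> admissible T f0 (?D k) \<eta>" "payoff T \<rho> f0 U1 U2 (?D k) \<eta> c = ?V k" for c
      proof -
        have "X.V - ereal r \<le> X.pay c" unfolding c(2) using X.V_finite par(2) by (cases X.V) auto
        note t = tr[OF mk m0 elim c(1) this]
        have "X.V - ereal \<epsilon> \<le> X.V - ereal (\<epsilon> / 2)" using X.V_finite \<epsilon> by (cases X.V) auto
        then show ?thesis using t unfolding c(2) by (auto intro: order_trans)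
      qed
      then show ?case using le[OF mk m0 elim] le[OF m0 mk data.close_sym[OF elim]] by blast
    qed
    then show ?thesis using par(1) by blast
    qed
  qed
  have lim: "?V \<longlonglongrightarrow> ?Vp"
  proof -
    define v where "v k = real_of_ereal (?V k)" for k
    define v0 where "v0 = real_of_ereal ?Vp"
    have v: "?V k = ereal (v k)" for k
      using control_system.V_finite[OF ck, of k] by (simp add: v_def ereal_real)
    have v0: "?Vp = ereal v0" using P.V_finite by (simp add: v0_def ereal_real)
    have "v \<longlonglongrightarrow> v0"
    proof (rule tendstoI)
      fix e :: real assume "0 < e"
      then have "0 < e / 2" by simp
      from key[OF this] have "\<forall>\<^sub>F k in sequentially. ?V k \<le> ?Vp + ereal (e / 2) \<and> ?Vp \<le> ?V k + ereal (e / 2)"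
        by (auto elim: eventually_mono)
      then show "\<forall>\<^sub>F k in sequentially. dist (v k) v0 < e"
        by eventually_elim (use \<open>0 < e\<close> in \<open>auto simp: v v0 dist_real_def\<close>)
    qed
    then show ?thesis unfolding v v0 by simp
  qed
  moreover have "\<exists>M\<ge>0. \<exists>k. truncate_strategy M (cstar k) \<in> admissible T f0 ?Dp \<eta> \<and>
         payoff T \<rho> f0 U1 U2 ?Dp \<eta> (truncate_strategy M (cstar k)) > ?Vp - ereal \<epsilon>"
    if opt: "\<forall>k. optimal_feedback_strategy T \<rho> f0 U1 U2 (?D k) \<eta> (cstar k)" and \<epsilon>: "0 < \<epsilon>" for cstar \<epsilon>
  proof -
    have "0 < \<epsilon> / 3" using \<epsilon> by simp
    from key[OF this] obtain M k where M: "0 \<le> M" and k: "?Vp \<le> ?V k + ereal (\<epsilon> / 3)"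
      "\<And>c. c \<in> admissible T f0 (?D k) \<eta> \<Longrightarrow> payoff T \<rho> f0 U1 U2 (?D k) \<eta> c = ?V k \<Longrightarrow>
        truncate_strategy M c \<in> admissible T f0 ?Dp \<eta> \<and>
        ?V k - ereal (\<epsilon> / 3) \<le> payoff T \<rho> f0 U1 U2 ?Dp \<eta> (truncate_strategy M c)"
      unfolding eventually_sequentially by blast
    have t: "truncate_strategy M (cstar k) \<in> admissible T f0 ?Dp \<eta>"
        "?V k - ereal (\<epsilon> / 3) \<le> payoff T \<rho> f0 U1 U2 ?Dp \<eta> (truncate_strategy M (cstar k))"
      using opt k(2)[of "cstar k"] unfolding optimal_feedback_strategy_def by blast+
    have "?Vp - ereal \<epsilon> < ?V k - ereal (\<epsilon> / 3)"
      using k(1) \<epsilon> P.V_finite control_system.V_finite[OF ck, of k]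
      by (cases ?Vp; cases "?V k") auto
    then show ?thesis using M t by (blast intro: less_le_trans)
  qed
  ultimately show ?thesis by blast
qed

end
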